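(* Let $n\ge2$, $1\le k\le n-1$, $\alpha_1,\alpha_2,\beta_1,\beta_2\in\mathbb{R}$, $p\ge\max\{1,1+\alpha_2\}$ with $p>1+\alpha_2$ when $\alpha_2>0$, and $p\le r<\infty$. Consider $$\|R_kf\|_{L^r_{\beta_1,\beta_2}(\Xi_k(\mathbb{S}^n))}\le C\|f\|_{L^p_{\alpha_1,\alpha_2}(\mathbb{S}^n)}\quad\text{for all even radial }f\in L^p_{\alpha_1,\alpha_2}(\mathbb{S}^n).\qquad( * )$$ Let (N) denote the conditions: $\beta_1>k-n$, $\frac{\alpha_1+n}{p}-\frac{\beta_1+n-k}{r}\le k$, and $\frac{\beta_2+k+1}{r}\ge\frac{\alpha_2+1}{p}$, the last inequality being strict if $p=1+\alpha_2$. (A) If $k\ge2$, $( * )$ holds if and only if (N) holds. (B) If $k=1$ and in addition $\frac1p-\frac1r\le\frac12$ when $p>1$, or $r<2$ when $p=1$, then $( * )$ holds if and only if (N) holds.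
   Context: $\mathbb{S}^n\subset\mathbb{R}^{n+1}$ unit sphere with origin $0:=e_{n+1}$, distance $d$, surface measure $dx$. $\Xi_k(\mathbb{S}^n)$: $k$-dimensional totally geodesic submanifolds (intersections with $(k+1)$-dimensional linear subspaces) with $d(0,\xi)<\pi/2$, with invariant measure such that for $\varphi(\xi)=\tilde\varphi(d(0,\xi))$, $\int\varphi\,d\xi=c_{n,k}\int_0^{\pi/2}\tilde\varphi(h)\sin^{n-k-1}h\cos^kh\,dh$. $R_kf(\xi)=\int_\xi f\,d_\xi x$. $\|f\|^p_{L^p_{\alpha_1,\alpha_2}(\mathbb{S}^n)}=\int|f(x)|^p\sin^{\alpha_1}d(0,x)|\cos d(0,x)|^{\alpha_2}dx$, $\|\varphi\|^r_{L^r_{\beta_1,\beta_2}(\Xi_k(\mathbb{S}^n))}=\int|\varphi(\xi)|^r\sin^{\beta_1}d(0,\xi)\cos^{\beta_2}d(0,\xi)d\xi$. Even radial: $f(x)=F(|x_{n+1}|)$. $C$ independent of $f$. *)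

theory Defs
  imports "HOL-Analysis.Analysis"
begin

text \<open>The sphere S^n is the unit sphere of real^'m with CARD('m) = n+1.
  The origin of S^n is the basis vector axis a 1 for a fixed index a.\<close>

definition sdist :: "'m::finite \<Rightarrow> real^'m \<Rightarrow> real" where
  "sdist a x = arccos (x $ a)"  \<comment> \<open>geodesic distance d(0,x) on the unit sphere\<close>

text \<open>Integral over S^n w.r.t. surface measure (cone formula).\<close>
definition sphere_integral :: "(real^'m::finite \<Rightarrow> ennreal) \<Rightarrow> ennreal" where
  "sphere_integral g = of_nat CARD('m) *
     (\<integral>\<^sup>+ x. indicator {x. 0 < norm x \<and> norm x \<le> 1} x * g (sgn x) \<partial>lborel)"

definition Lnorm :: "real \<Rightarrow> ennreal \<Rightarrow> ennreal" where
  "Lnorm p I = (if I = \<infinity> then \<infinity> else ennreal (enn2real I powr (1 / p)))"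

definition normS :: "real \<Rightarrow> real \<Rightarrow> real \<Rightarrow> 'm::finite \<Rightarrow> (real^'m \<Rightarrow> real) \<Rightarrow> ennreal" where
  "normS p \<alpha>1 \<alpha>2 a f = Lnorm p (sphere_integral (\<lambda>u.
      ennreal (\<bar>f u\<bar> powr p * sin (sdist a u) powr \<alpha>1 * \<bar>cos (sdist a u)\<bar> powr \<alpha>2)))"

text \<open>A k-dimensional totally geodesic submanifold xi = V \<inter> S^n is represented by
  the (k+1)-dimensional linear subspace V.\<close>
definition xi_dist :: "'m::finite \<Rightarrow> (real^'m) set \<Rightarrow> real" where
  "xi_dist a V = (INF x\<in>V \<inter> sphere 0 1. sdist a x)"

definition gauss :: "(real^'m::finite) measure" where
  "gauss = density lborel (\<lambda>x. ennreal (exp (- (norm x)\<^sup>2 / 2)))"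

text \<open>Integration over the Grassmannian of (k+1)-planes w.r.t. the O(n+1)-invariant
  measure (realised as the law of the span of k+1 independent Gaussian vectors,
  up to a positive constant).\<close>
definition plane_measure :: "nat \<Rightarrow> (nat \<Rightarrow> real^'m::finite) measure" where
  "plane_measure k = PiM {..k} (\<lambda>_. gauss)"

definition Xi_integral :: "nat \<Rightarrow> ((real^'m::finite) set \<Rightarrow> ennreal) \<Rightarrow> ennreal" where
  "Xi_integral k \<Phi> = (\<integral>\<^sup>+ v. (if dim (span (v ` {..k})) = k + 1
       then \<Phi> (span (v ` {..k})) else 0) \<partial>plane_measure k)"

definition normXi :: "real \<Rightarrow> real \<Rightarrow> real \<Rightarrow> 'm::finite \<Rightarrow> nat
                      \<Rightarrow> ((real^'m) set \<Rightarrow> real) \<Rightarrow> ennreal" where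
  "normXi r \<beta>1 \<beta>2 a k \<phi> = Lnorm r (Xi_integral k (\<lambda>V.
      if xi_dist a V < pi / 2 then
        ennreal (\<bar>\<phi> V\<bar> powr r * sin (xi_dist a V) powr \<beta>1 * cos (xi_dist a V) powr \<beta>2)
      else 0))"

text \<open>Radon transform: integral over the k-sphere V \<inter> S^n w.r.t. its surface measure,
  computed through an orthonormal basis of V and the cone formula.\<close>
definition onb :: "nat \<Rightarrow> (real^'m::finite) set \<Rightarrow> nat \<Rightarrow> real^'m" where
  "onb k V = (SOME b. (\<forall>i\<le>k. \<forall>j\<le>k. b i \<bullet> b j = (if i = j then 1 else 0))
                      \<and> span (b ` {..k}) = V)"

definition unit_ball_k :: "nat \<Rightarrow> (nat \<Rightarrow> real) set" where
  "unit_ball_k k = {y. 0 < (\<Sum>i\<le>k. (y i)\<^sup>2) \<and> (\<Sum>i\<le>k. (y i)\<^sup>2) \<le> 1}"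

definition radon_integrand :: "nat \<Rightarrow> (real^'m::finite \<Rightarrow> real) \<Rightarrow> (real^'m) set
                               \<Rightarrow> (nat \<Rightarrow> real) \<Rightarrow> real" where
  "radon_integrand k f V y = indicator (unit_ball_k k) y * f (sgn (\<Sum>i\<le>k. y i *\<^sub>R onb k V i))"

definition radon_integrable :: "nat \<Rightarrow> (real^'m::finite \<Rightarrow> real) \<Rightarrow> (real^'m) set \<Rightarrow> bool" where
  "radon_integrable k f V = integrable (PiM {..k} (\<lambda>_. lborel)) (radon_integrand k f V)"

definition radon :: "nat \<Rightarrow> (real^'m::finite \<Rightarrow> real) \<Rightarrow> (real^'m) set \<Rightarrow> real" where
  "radon k f V = real (k + 1) * (\<integral>y. radon_integrand k f V y \<partial>PiM {..k} (\<lambda>_. lborel))"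

text \<open>The estimate (*) for all even radial f(x) = F(|x_{n+1}|) in L^p_{\<alpha>1,\<alpha>2}:
  R_k f is defined for almost every xi and the norm inequality holds.\<close>
definition radon_bound :: "'m::finite \<Rightarrow> nat \<Rightarrow> real \<Rightarrow> real \<Rightarrow> real \<Rightarrow> real \<Rightarrow> real \<Rightarrow> real \<Rightarrow> bool" where
  "radon_bound a k p r \<alpha>1 \<alpha>2 \<beta>1 \<beta>2 \<longleftrightarrow>
     (\<exists>C::real. \<forall>F::real \<Rightarrow> real. F \<in> borel_measurable borel \<longrightarrow>
        normS p \<alpha>1 \<alpha>2 a (\<lambda>x. F \<bar>x $ a\<bar>) < \<infinity> \<longrightarrow>
          (AE v in plane_measure k. dim (span (v ` {..k})) = k + 1
              \<longrightarrow> xi_dist a (span (v ` {..k})) < pi / 2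
              \<longrightarrow> radon_integrable k (\<lambda>x. F \<bar>x $ a\<bar>) (span (v ` {..k})))
          \<and> normXi r \<beta>1 \<beta>2 a k (radon k (\<lambda>x. F \<bar>x $ a\<bar>))
              \<le> ennreal C * normS p \<alpha>1 \<alpha>2 a (\<lambda>x. F \<bar>x $ a\<bar>))"

definition cond_N :: "nat \<Rightarrow> nat \<Rightarrow> real \<Rightarrow> real \<Rightarrow> real \<Rightarrow> real \<Rightarrow> real \<Rightarrow> real \<Rightarrow> bool" where
  "cond_N n k p r \<alpha>1 \<alpha>2 \<beta>1 \<beta>2 \<longleftrightarrow>
     \<beta>1 > real k - real n
   \<and> (\<alpha>1 + real n) / p - (\<beta>1 + real n - real k) / r \<le> real k
   \<and> (\<beta>2 + real k + 1) / r \<ge> (\<alpha>2 + 1) / p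
   \<and> (p = 1 + \<alpha>2 \<longrightarrow> (\<beta>2 + real k + 1) / r > (\<alpha>2 + 1) / p)"

end

theory Submission
  imports Defs
begin

text \<open>
  For even radial \<open>f(x) = F(|x\<^sub>a|)\<close> everything depends on the squared cosines \<open>\<sigma> = x\<^sub>a\<^sup>2\<close> and \<open>\<tau> = cos\<^sup>2 d(0,\<xi>)\<close>. Up to
  constants, the norms become weighted norms on \<open>(0,1)\<close> with densities \<open>\<sigma>\<^bsup>A-1\<^esup> (1-\<sigma>)\<^bsup>B-1\<^esup>\<close>, and
  \<open>R\<^sub>k f\<close> becomes \<open>\<integral>\<^sub>0\<^sup>1 F(\<surd>(\<tau>\<sigma>)) \<sigma>\<^bsup>-1/2\<^esup> (1-\<sigma>)\<^bsup>k/2-1\<^esup> d\<sigma>\<close>. The law of \<open>\<tau>\<close> is obtained by adding the Gaussian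
  vectors spanning the plane one at a time: by rotation invariance each of them multiplies \<open>1 - \<tau>\<close> by an independent
  Beta variable.

  In logistic coordinates \<open>\<sigma> = e\<^sup>\<xi>/(1+e\<^sup>\<xi>)\<close>, \<open>\<tau> = e\<^sup>\<eta>/(1+e\<^sup>\<eta>)\<close>, condition (N) bounds the kernel by
  \<open>e\<^bsup>-\<delta>z\<^esup> (1-e\<^bsup>-z\<^esup>)\<^bsup>k/2-1\<^esup>\<close> with \<open>z = \<eta> - \<xi> > 0\<close>, so sufficiency is Young's inequality. Only \<open>k = 1\<close>,
  \<open>1/p - 1/r = 1/2\<close> needs the Hardy-Littlewood-Sobolev inequality of order \<open>1/2\<close>, and only \<open>p = 1 + \<alpha>\<^sub>2 = 1\<close>,
  where \<open>\<delta>\<close> would vanish, a separate kernel bound. Necessity follows by testing with indicators of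
  intervals of \<open>\<sigma>\<close> at fixed distance from \<open>0\<close> and \<open>1\<close>, close to \<open>1\<close>, and close to \<open>0\<close>.
\<close>

section \<open>Substitutions on the real line\<close>

text \<open>Planes enter as spans of random vectors, the basis in \<open>onb\<close> is chosen by
  \<open>SOME\<close>, and sphere integrals are cone integrals. This is tractable because a radial
  integrand sees only the squared cosine of an angle, and a frame enters only through the sum of the
  squares of its axis coordinates.

  The weights degenerate at both ends of (0,1). The odds s/(1-s) treat both ends at once. Decay at
  rate delta needs delta <= 1/2 - (alpha_2+1)/(2p), positive exactly for p > 1 + alpha_2, and delta
  <= (beta_1+n-k)/(2r), positive by the first condition of (N). If p = 1 + alpha_2, the hypotheses
  force alpha_2 = 0 and p = 1; the strict inequality in (N) then supplies decay in tau instead.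

  For k = 1 the kernel behaves like z^(-1/2) near 0. Young's inequality takes its q-th power with
  1/q = 1 + 1/r - 1/p, which is integrable at 0 for q < 2, that is, for 1/p - 1/r < 1/2. At equality
  a truncation argument takes over; it needs p > 1, whence the condition r < 2 for p = 1.\<close>

lemma nn_integral_substitution_exhausting:
  fixes f :: "real \<Rightarrow> ennreal" and g g' :: "real \<Rightarrow> real" and A B :: "nat \<Rightarrow> real"
  assumes f[measurable]: "f \<in> borel_measurable borel"
    and g[measurable]: "g \<in> borel_measurable borel"
    and g'[measurable]: "g' \<in> borel_measurable borel"
    and AB: "\<And>n. A n < B n" "decseq A" "incseq B"
    and S: "S = (\<Union>n. {A n..B n})" and T: "T = (\<Union>n. {g (A n)..g (B n)})"
    and deriv: "\<And>x. x \<in> S \<Longrightarrow> (g has_real_derivative g' x) (at x)"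
    and cont: "continuous_on S g'"
    and nonneg: "\<And>x. x \<in> S \<Longrightarrow> g' x \<ge> 0"
  shows "(\<integral>\<^sup>+x\<in>T. f x \<partial>lborel) = (\<integral>\<^sup>+x\<in>S. f (g x) * ennreal (g' x) \<partial>lborel)"
proof -
  have mono_g: "g x \<le> g y" if "x \<le> y" "{x..y} \<subseteq> S" for x y
    by (rule DERIV_nonneg_imp_nondecreasing[OF that(1)])
       (use that deriv nonneg in \<open>meson atLeastAtMost_iff subsetD\<close>)
  have sub: "{A m..B m} \<subseteq> S" for m unfolding S by auto
  have mem: "A m \<le> x \<Longrightarrow> x \<le> B m \<Longrightarrow> x \<in> S" for m x unfolding S by auto
  have nest: "A n \<le> A m" "B m \<le> B n" if "m \<le> n" for m n
    using AB that by (auto simp: decseq_def incseq_def)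
  have gA: "g (A n) \<le> g (A m)" "g (B m) \<le> g (B n)" if "m \<le> n" for m n
  proof -
    have *: "A n \<le> A m" "B m \<le> B n" "A m \<le> B m" "A n \<le> B n" "A m \<le> B n"
      using nest[OF that] AB(1)[of m] AB(1)[of n] by linarith+
    show "g (A n) \<le> g (A m)" "g (B m) \<le> g (B n)"
      by (intro mono_g; use * in \<open>auto intro!: mem[of n]\<close>)+
  qed
  have inc: "incseq (\<lambda>n. {A n..B n})" "incseq (\<lambda>n. {g (A n)..g (B n)})"
    using nest gA by (force simp: incseq_def)+
  have incf: "incseq (\<lambda>n x. h x * indicator (X n) x :: ennreal)" if "incseq X" for h and X :: "nat \<Rightarrow> real set"
    using that by (auto simp: incseq_def le_fun_def indicator_def)
  have SUPind: "(SUP n. h x * indicator (X n) x) = h x * indicator (\<Union>n. X n) x"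
    if "incseq X" for h :: "real \<Rightarrow> ennreal" and X :: "nat \<Rightarrow> real set" and x
  proof (cases "x \<in> (\<Union>n. X n)")
    case True
    then obtain n where "x \<in> X n" by auto
    with True show ?thesis
      by (intro antisym SUP_least SUP_upper2[of n]) (auto simp: indicator_def)
  qed auto
  \<comment> \<open>The substitution rule on compact intervals applies to each piece; both families
    of intervals are nested, so monotone convergence passes to the unions.\<close>
  have "(\<integral>\<^sup>+x\<in>T. f x \<partial>lborel) = (\<integral>\<^sup>+x. (SUP n. f x * indicator {g (A n)..g (B n)} x) \<partial>lborel)"
    unfolding T by (simp only: SUPind[OF inc(2)])
  also have "\<dots> = (SUP n. \<integral>\<^sup>+x. f x * indicator {g (A n)..g (B n)} x \<partial>lborel)"
    by (rule nn_integral_monotone_convergence_SUP[OF incf[OF inc(2)]]) measurable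
  also have "\<dots> = (SUP n. \<integral>\<^sup>+x. f (g x) * ennreal (g' x) * indicator {A n..B n} x \<partial>lborel)"
    by (intro SUP_cong refl nn_integral_substitution_aux)
       (use AB deriv nonneg in \<open>auto intro: mem continuous_on_subset[OF cont sub]\<close>)
  also have "\<dots> = (\<integral>\<^sup>+x. (SUP n. f (g x) * ennreal (g' x) * indicator {A n..B n} x) \<partial>lborel)"
    by (rule nn_integral_monotone_convergence_SUP[OF incf[OF inc(1)], symmetric]) measurable
  also have "\<dots> = (\<integral>\<^sup>+x\<in>S. f (g x) * ennreal (g' x) \<partial>lborel)"
    unfolding S by (simp only: SUPind[OF inc(1), where h="\<lambda>x. f (g x) * ennreal (g' x)"])
  finally show ?thesis .
qed

text \<open>Both square roots of z contribute, which cancels the 1/2 from the Jacobian of the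
  square.\<close>

lemma nn_integral_square_real:
  fixes g :: "real \<Rightarrow> ennreal"
  assumes [measurable]: "g \<in> borel_measurable borel"
  shows "(\<integral>\<^sup>+y. g (y\<^sup>2) \<partial>lborel) = (\<integral>\<^sup>+z\<in>{0<..}. g z * ennreal (z powr (-1/2)) \<partial>lborel)"
proof -
  \<comment> \<open>The right end is \<open>real (Suc n) + 1\<close> so that the interval is
    nondegenerate already for n = 0, as \<open>AB\<close> requires.\<close>
  have U: "{0<..} = (\<Union>n. {1 / real (Suc n)..real (Suc n) + 1})"
  proof (safe, goal_cases)
    case (1 x)
    obtain n where n: "1 / real (Suc n) < x" using 1 reals_Archimedean[of x] by (auto simp: inverse_eq_divide)
    obtain m where m: "x < real m" using reals_Archimedean2 by blast
    have "1 / real (Suc (max n m)) \<le> 1 / real (Suc n)" by (simp add: field_simps)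
    with n m show ?case by (intro UN_I[of "max n m"]) auto
  next
    case (2 x n) 
    have "0 < 1 / real (Suc n)" by simp
    then show ?case using 2 by (metis atLeastAtMost_iff greaterThan_iff less_le_trans)
  qed
  have U2: "{0<..} = (\<Union>n. {(1 / real (Suc n))\<^sup>2..(real (Suc n) + 1)\<^sup>2})"
  proof (safe, goal_cases)
    case (1 x)
    then have "sqrt x \<in> {0<..}" by simp
    then obtain n where n: "1 / real (Suc n) \<le> sqrt x" "sqrt x \<le> real (Suc n) + 1" unfolding U by auto
    have "(1 / real (Suc n))\<^sup>2 \<le> (sqrt x)\<^sup>2" "(sqrt x)\<^sup>2 \<le> (real (Suc n) + 1)\<^sup>2"
      using n 1 by (intro power_mono; simp)+
    with 1 show ?case by (intro UN_I[of n]) auto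
  next
    case (2 x n) 
    have "0 < (1 / real (Suc n))\<^sup>2" by simp
    then show ?case using 2 by (metis atLeastAtMost_iff greaterThan_iff less_le_trans)
  qed
  have AB: "1 / real (Suc n) < real (Suc n) + 1" for n
    by (rule le_less_trans[of _ 1]) (auto simp: field_simps)
  have reflect: "(\<integral>\<^sup>+y\<in>{..<0}. g (y\<^sup>2) \<partial>lborel) = (\<integral>\<^sup>+y\<in>{0<..}. g (y\<^sup>2) \<partial>lborel)"
    by (subst nn_integral_real_affine[where c="-1" and t=0]) (auto simp: indicator_def intro!: nn_integral_cong)
  have "(\<integral>\<^sup>+z\<in>{0<..}. g z * ennreal (z powr (-1/2)) \<partial>lborel)
      = (\<integral>\<^sup>+y\<in>{0<..}. g (y\<^sup>2) * ennreal ((y\<^sup>2) powr (-1/2)) * ennreal (2 * y) \<partial>lborel)"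
    by (rule nn_integral_substitution_exhausting[where A="\<lambda>n. 1 / real (Suc n)" and B="\<lambda>n. real (Suc n) + 1"
          and g="\<lambda>y. y\<^sup>2" and g'="\<lambda>y. 2 * y", OF _ _ _ AB _ _ U U2])
       (auto intro!: derivative_eq_intros continuous_intros decseq_SucI incseq_SucI simp: field_simps)
  also have "\<dots> = (\<integral>\<^sup>+y\<in>{0<..}. 2 * g (y\<^sup>2) \<partial>lborel)"
  proof (intro nn_integral_cong)
    fix y :: real
    have "(y\<^sup>2) powr (-1/2) * (2 * y) = 2" if "y > 0"
      using that by (simp add: powr_minus powr_half_sqrt field_simps)
    then have *: "ennreal ((y\<^sup>2) powr (-1/2)) * ennreal (2 * y) = 2" if "y > 0"
      using that by (simp only: ennreal_mult'[symmetric, OF powr_ge_zero] ennreal_numeral)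
    show "g (y\<^sup>2) * ennreal ((y\<^sup>2) powr (-1/2)) * ennreal (2 * y) * indicator {0<..} y
        = 2 * g (y\<^sup>2) * indicator {0<..} y"
    proof (cases "y > 0")
      case True
      have "g (y\<^sup>2) * ennreal ((y\<^sup>2) powr (-1/2)) * ennreal (2 * y) = 2 * g (y\<^sup>2)"
        by (subst mult.assoc, subst *[OF True], rule mult.commute)
      then show ?thesis by simp
    qed simp
  qed
  also have "\<dots> = (\<integral>\<^sup>+y. g (y\<^sup>2) * indicator {0<..} y + g (y\<^sup>2) * indicator {0<..} y \<partial>lborel)"
    by (simp add: mult_2 distrib_right)
  also have "\<dots> = (\<integral>\<^sup>+y\<in>{0<..}. g (y\<^sup>2) \<partial>lborel) + (\<integral>\<^sup>+y\<in>{0<..}. g (y\<^sup>2) \<partial>lborel)"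
    by (rule nn_integral_add) measurable
  also have "\<dots> = (\<integral>\<^sup>+y\<in>{..<0}. g (y\<^sup>2) \<partial>lborel) + (\<integral>\<^sup>+y\<in>{0<..}. g (y\<^sup>2) \<partial>lborel)"
    by (simp only: reflect)
  also have "\<dots> = (\<integral>\<^sup>+y. g (y\<^sup>2) * indicator {..<0} y + g (y\<^sup>2) * indicator {0<..} y \<partial>lborel)"
    by (rule nn_integral_add[symmetric]) measurable
  also have "\<dots> = (\<integral>\<^sup>+y. g (y\<^sup>2) \<partial>lborel)"
  proof (rule nn_integral_cong_AE)
    show "AE y in lborel. g (y\<^sup>2) * indicator {..<0} y + g (y\<^sup>2) * indicator {0<..} y = g (y\<^sup>2)"
      using AE_lborel_singleton[of "0 :: real"] by eventually_elim (auto simp: indicator_def)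
  qed
  finally show ?thesis by simp
qed

definition logistic :: "real \<Rightarrow> real" where "logistic \<xi> = exp \<xi> / (1 + exp \<xi>)"

lemma logistic_bounds [simp]: "0 < logistic \<xi>" "logistic \<xi> < 1"
  and one_minus_logistic: "1 - logistic \<xi> = 1 / (1 + exp \<xi>)"
  by (auto simp: logistic_def add_pos_pos divide_simps add_eq_0_iff split: if_splits)
     (smt (verit) exp_gt_zero)+

lemma logistic_less_iff [simp]: "logistic \<xi> < logistic \<eta> \<longleftrightarrow> \<xi> < \<eta>"
proof -
  have "logistic \<xi> < logistic \<eta> \<longleftrightarrow> 1 / (1 + exp \<eta>) < 1 / (1 + exp \<xi>)"
    unfolding one_minus_logistic[symmetric] by auto
  also have "\<dots> \<longleftrightarrow> 1 + exp \<xi> < 1 + exp \<eta>"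
    by (simp add: divide_simps add_pos_pos add_eq_0_iff)
  finally show ?thesis by simp
qed

lemma logistic_surj: assumes "0 < \<sigma>" "\<sigma> < 1" shows "logistic (ln (\<sigma> / (1 - \<sigma>))) = \<sigma>"
  using assms by (simp add: logistic_def field_simps)

lemma logistic_measurable [measurable]: "logistic \<in> borel_measurable borel"
  unfolding logistic_def by measurable

text \<open>The derivative s(1-s) raises both exponents of a density s^(A-1) (1-s)^(B-1) by one, so
  on the line the weights become the pure powers s^A (1-s)^B.\<close>

lemma nn_integral_logistic:
  fixes f :: "real \<Rightarrow> ennreal"
  assumes [measurable]: "f \<in> borel_measurable borel"
  shows "(\<integral>\<^sup>+\<sigma>\<in>{0<..<1}. f \<sigma> \<partial>lborel)
       = (\<integral>\<^sup>+\<xi>. f (logistic \<xi>) * ennreal (logistic \<xi> * (1 - logistic \<xi>)) \<partial>lborel)"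
proof -
  have U: "(UNIV :: real set) = (\<Union>n. {- real (Suc n)..real (Suc n)})"
  proof (safe, goal_cases)
    case (1 x)
    obtain m where "\<bar>x\<bar> < real m" using reals_Archimedean2 by blast
    then show ?case by (intro UN_I[of m]) auto
  qed auto
  have lle: "logistic x \<le> logistic y \<longleftrightarrow> x \<le> y" for x y
    by (meson logistic_less_iff linorder_not_le)
  have U2: "{0<..<1} = (\<Union>n. {logistic (- real (Suc n))..logistic (real (Suc n))})"
  proof (safe, goal_cases)
    case (1 x)
    then have x: "0 < x" "x < 1" by auto
    obtain n where "ln (x / (1 - x)) \<in> {- real (Suc n)..real (Suc n)}" using U by blast
    then have "logistic (ln (x / (1 - x))) \<in> {logistic (- real (Suc n))..logistic (real (Suc n))}"
      by (simp add: lle)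
    then show ?case unfolding logistic_surj[OF x] by blast
  next
    case (2 x n) 
    then show ?case using logistic_bounds(1)[of "- real (Suc n)"] logistic_bounds(2)[of "real (Suc n)"] 
      by (auto simp del: logistic_bounds)
  qed
  have nz: "1 + exp x \<noteq> 0" for x :: real by (smt (verit) exp_gt_zero)
  have der: "(logistic has_real_derivative logistic x * (1 - logistic x)) (at x)" for x
    unfolding logistic_def[abs_def] using nz[of x]
    by (auto intro!: derivative_eq_intros simp: field_simps power2_eq_square)
  have cont: "continuous_on UNIV (\<lambda>x. logistic x * (1 - logistic x))"
    unfolding logistic_def by (intro continuous_intros) (use nz in auto)
  have "(\<integral>\<^sup>+\<sigma>\<in>{0<..<1}. f \<sigma> \<partial>lborel)
       = (\<integral>\<^sup>+\<xi>\<in>UNIV. f (logistic \<xi>) * ennreal (logistic \<xi> * (1 - logistic \<xi>)) \<partial>lborel)"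
    by (rule nn_integral_substitution_exhausting[where A="\<lambda>n. - real (Suc n)" and B="\<lambda>n. real (Suc n)"
          and g=logistic and g'="\<lambda>x. logistic x * (1 - logistic x)", OF _ _ _ _ _ _ U U2 der cont])
       (auto intro!: decseq_SucI incseq_SucI mult_nonneg_nonneg less_imp_le)
  then show ?thesis by simp
qed

lemma nn_integral_scale_real:
  fixes f :: "real \<Rightarrow> ennreal"
  assumes [measurable]: "f \<in> borel_measurable borel" and c: "0 < c"
  shows "(\<integral>\<^sup>+x\<in>{0<..<c}. f x \<partial>lborel) = (\<integral>\<^sup>+x\<in>{0<..<1}. f (c * x) * ennreal c \<partial>lborel)"
proof -
  have "(\<integral>\<^sup>+x\<in>{0<..<c}. f x \<partial>lborel) = ennreal c * (\<integral>\<^sup>+x. f (c * x) * indicator {0<..<c} (c * x) \<partial>lborel)"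
    by (subst nn_integral_real_affine[where c=c and t=0]) (use c in auto)
  also have "\<dots> = (\<integral>\<^sup>+x. ennreal c * (f (c * x) * indicator {0<..<c} (c * x)) \<partial>lborel)"
    by (rule nn_integral_cmult[symmetric]) measurable
  also have "\<dots> = (\<integral>\<^sup>+x\<in>{0<..<1}. f (c * x) * ennreal c \<partial>lborel)"
    using c by (intro nn_integral_cong) (auto simp: indicator_def zero_less_mult_iff mult.commute)
  finally show ?thesis .
qed

text \<open>The map (z, w) -> (z + w, z/(z + w)) splits two Gamma-type variables into an independent
  sum and a Beta-type ratio. A shift, Fubini and a scaling replace the two-dimensional
  Jacobian.\<close>

lemma nn_integral_beta_gamma:
  fixes G :: "real \<times> real \<Rightarrow> ennreal"
  assumes [measurable]: "G \<in> borel_measurable (borel \<Otimes>\<^sub>M borel)"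
  shows "(\<integral>\<^sup>+z\<in>{0<..}. (\<integral>\<^sup>+w\<in>{0<..}. G (z + w, z / (z + w))
            * ennreal (z powr (a - 1) * w powr (b - 1)) \<partial>lborel) \<partial>lborel)
       = (\<integral>\<^sup>+\<rho>\<in>{0<..}. (\<integral>\<^sup>+\<sigma>\<in>{0<..<1}. G (\<rho>, \<sigma>)
            * ennreal (\<rho> powr (a + b - 1) * (\<sigma> powr (a - 1) * (1 - \<sigma>) powr (b - 1))) \<partial>lborel) \<partial>lborel)"
    (is "?L = ?R")
proof -
  define H where "H z \<rho> = (if 0 < z \<and> z < \<rho> then G (\<rho>, z / \<rho>) * ennreal (z powr (a - 1) * (\<rho> - z) powr (b - 1)) else
      0)"
    for z \<rho>
  have [measurable]: "case_prod H \<in> borel_measurable (borel \<Otimes>\<^sub>M borel)"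
    unfolding H_def by measurable
  have "?L = (\<integral>\<^sup>+z. (\<integral>\<^sup>+\<rho>. H z \<rho> \<partial>lborel) \<partial>lborel)"
  proof (intro nn_integral_cong, goal_cases)
    case (1 z)
    have "(\<integral>\<^sup>+\<rho>. H z \<rho> \<partial>lborel) = (\<integral>\<^sup>+w. H z (z + w) \<partial>lborel)"
      by (subst nn_integral_real_affine[where c=1 and t=z]) auto
    also have "\<dots> = (\<integral>\<^sup>+w\<in>{0<..}. G (z + w, z / (z + w)) * ennreal (z powr (a - 1) * w powr (b - 1)) \<partial>lborel)
        * indicator {0<..} z"
      by (subst nn_integral_multc[symmetric], measurable) 
         (auto simp: indicator_def H_def intro!: nn_integral_cong)
    finally show ?case by simp
  qed
  also have "\<dots> = (\<integral>\<^sup>+\<rho>. (\<integral>\<^sup>+z. H z \<rho> \<partial>lborel) \<partial>lborel)"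
    by (rule lborel_pair.Fubini') simp
  also have "\<dots> = ?R"
  proof (intro nn_integral_cong, goal_cases)
    case (1 \<rho>)
    show ?case
    proof (cases "0 < \<rho>")
      case True
      have "(\<integral>\<^sup>+z. H z \<rho> \<partial>lborel)
        = (\<integral>\<^sup>+z\<in>{0<..<\<rho>}. G (\<rho>, z / \<rho>) * ennreal (z powr (a - 1) * (\<rho> - z) powr (b - 1)) \<partial>lborel)"
        by (auto simp: indicator_def H_def intro!: nn_integral_cong)
      also have "\<dots>
        = (\<integral>\<^sup>+\<sigma>\<in>{0<..<1}. G (\<rho>, \<rho> * \<sigma> / \<rho>) * ennreal ((\<rho> * \<sigma>) powr (a - 1) * (\<rho> - \<rho> * \<sigma>) powr (b - 1)) * ennreal \<rho>
            \<partial>lborel)"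
        by (rule nn_integral_scale_real) (use True in auto)
      also have "\<dots> = (\<integral>\<^sup>+\<sigma>\<in>{0<..<1}. G (\<rho>, \<sigma>) * ennreal (\<rho> powr (a + b - 1) * (\<sigma> powr (a - 1) * (1 - \<sigma>) powr (b - 1)))
          \<partial>lborel)"
      proof (intro nn_integral_cong, goal_cases)
        case (1 \<sigma>)
        have "(\<rho> * \<sigma>) powr (a - 1) * (\<rho> - \<rho> * \<sigma>) powr (b - 1) * \<rho>
             = \<rho> powr (a + b - 1) * (\<sigma> powr (a - 1) * (1 - \<sigma>) powr (b - 1))" if "0 < \<sigma>" "\<sigma> < 1"
        proof -
          have "\<rho> - \<rho> * \<sigma> = \<rho> * (1 - \<sigma>)" by algebra
          moreover have "\<rho> powr (a + b - 1) = \<rho> powr (a - 1) * \<rho> powr (b - 1) * \<rho>"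
            using True powr_add[of \<rho> "a - 1" "b - 1"] powr_add[of \<rho> "a - 1 + (b - 1)" 1] by (simp add: algebra_simps)
          ultimately show ?thesis using that True by (simp add: powr_mult mult_ac)
        qed
        then show ?case using True
          by (auto simp: indicator_def mult.assoc ennreal_mult[symmetric])
      qed
      finally show ?thesis using True by simp
    next
      case False
      then show ?thesis by (auto simp: H_def intro!: nn_integral_0_iff_AE[THEN iffD2])
    qed
  qed
  finally show ?thesis .
qed

text \<open>Up to constants: if x is Beta(C + D, B) and y is Beta(C, D) distributed and they are
  independent, then x y is Beta(C, D + B) distributed. The shared parameter C + D makes the powers
  of x cancel after y = w/x. This closes the induction on the number of Gaussian vectors.\<close>

lemma nn_integral_beta_product:
  fixes \<Phi> :: "real \<Rightarrow> ennreal"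
  assumes [measurable]: "\<Phi> \<in> borel_measurable borel" and "B > 0" "D > 0"
  shows "(\<integral>\<^sup>+x\<in>{0<..<1}. (\<integral>\<^sup>+y\<in>{0<..<1}. \<Phi> (x * y) * ennreal (y powr (C - 1) * (1 - y) powr (D - 1)) \<partial>lborel)
            * ennreal (x powr (C + D - 1) * (1 - x) powr (B - 1)) \<partial>lborel)
       = ennreal (Beta D B) * (\<integral>\<^sup>+w\<in>{0<..<1}. \<Phi> w * ennreal (w powr (C - 1) * (1 - w) powr (D + B - 1)) \<partial>lborel)"
    (is "?L = ?R")
proof -
  define H where "H x w = (if 0 < w \<and> w < x \<and> x < 1
       then \<Phi> w * ennreal (w powr (C - 1) * ((x - w) powr (D - 1) * (1 - x) powr (B - 1))) else 0)" for x w
  have [measurable]: "case_prod H \<in> borel_measurable (borel \<Otimes>\<^sub>M borel)"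
    unfolding H_def by measurable
  have "?L = (\<integral>\<^sup>+x. (\<integral>\<^sup>+w. H x w \<partial>lborel) \<partial>lborel)"
  proof (intro nn_integral_cong, goal_cases)
    case (1 x)
    show ?case
    proof (cases "0 < x \<and> x < 1")
      case True
      have "(\<integral>\<^sup>+w. H x w \<partial>lborel) = (\<integral>\<^sup>+w\<in>{0<..<x}. \<Phi> w * ennreal (w powr (C - 1) * ((x - w) powr (D - 1)
          * (1 - x) powr (B - 1))) \<partial>lborel)"
        using True by (auto simp: indicator_def H_def intro!: nn_integral_cong)
      also have "\<dots> = (\<integral>\<^sup>+y\<in>{0<..<1}. \<Phi> (x * y) * ennreal ((x * y) powr (C - 1) * ((x - x * y) powr (D - 1)
          * (1 - x) powr (B - 1))) * ennreal x \<partial>lborel)"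
        by (rule nn_integral_scale_real) (use True in auto)
      also have "\<dots> = (\<integral>\<^sup>+y. \<Phi> (x * y) * ennreal (y powr (C - 1) * (1 - y) powr (D - 1)) * indicator {0<..<1} y * 
            ennreal (x powr (C + D - 1) * (1 - x) powr (B - 1)) \<partial>lborel)"
      proof (intro nn_integral_cong, goal_cases)
        case (1 y)
        have "(x * y) powr (C - 1) * ((x - x * y) powr (D - 1) * (1 - x) powr (B - 1)) * x
             = y powr (C - 1) * (1 - y) powr (D - 1) * (x powr (C + D - 1) * (1 - x) powr (B - 1))" if "0 < y" "y < 1"
        proof -
          have "x - x * y = x * (1 - y)" by algebra
          moreover have "x powr (C + D - 1) = x powr (C - 1) * x powr (D - 1) * x"
            using True powr_add[of x "C - 1" "D - 1"] powr_add[of x "C - 1 + (D - 1)" 1] by (simp add: algebra_simps)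
          ultimately show ?thesis using that True by (simp add: powr_mult mult_ac)
        qed
        then have "ennreal ((x * y) powr (C - 1) * ((x - x * y) powr (D - 1) * (1 - x) powr (B - 1))) * ennreal x
             = ennreal (y powr (C - 1) * (1 - y) powr (D - 1)) * ennreal (x powr (C + D - 1) * (1 - x) powr (B -
                 1))" if "0 < y" "y < 1"
          using True that by (subst (1 2) ennreal_mult[symmetric]) auto
        then show ?case
          by (auto simp: indicator_def mult.assoc)
      qed
      also have "\<dots> = (\<integral>\<^sup>+y\<in>{0<..<1}. \<Phi> (x * y) * ennreal (y powr (C - 1) * (1 - y) powr (D - 1)) \<partial>lborel)
            * ennreal (x powr (C + D - 1) * (1 - x) powr (B - 1))"
        by (rule nn_integral_multc) measurable
      finally show ?thesis using True by simp
    next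
      case False
      then show ?thesis by (auto simp: H_def intro!: nn_integral_0_iff_AE[THEN iffD2])
    qed
  qed
  also have "\<dots> = (\<integral>\<^sup>+w. (\<integral>\<^sup>+x. H x w \<partial>lborel) \<partial>lborel)"
    by (rule lborel_pair.Fubini') simp
  also have "\<dots> = (\<integral>\<^sup>+w. ennreal (Beta D B) * (\<Phi> w * ennreal (w powr (C - 1) * (1 - w) powr (D + B - 1))
      * indicator {0<..<1} w) \<partial>lborel)"
  proof (intro nn_integral_cong, goal_cases)
    case (1 w)
    show ?case
    proof (cases "0 < w \<and> w < 1")
      case True
      have [measurable]: "H x \<in> borel_measurable borel" "(\<lambda>w. H w x) \<in> borel_measurable borel" for x
        by measurable
      \<comment> \<open>The substitution x = w + (1 - w) t maps (0, 1) onto (w, 1) and turns the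
        inner integral into \<open>Beta D B\<close>.\<close>
      have "(\<integral>\<^sup>+x. H x w \<partial>lborel) = (\<integral>\<^sup>+x. ennreal (1 - w) * H (w + (1 - w) * x) w \<partial>lborel)"
        by (subst nn_integral_real_affine[where c="1 - w" and t=w]) (use True in \<open>auto simp: nn_integral_cmult\<close>)
      also have "\<dots> = (\<integral>\<^sup>+x. \<Phi> w * ennreal (w powr (C - 1) * (1 - w) powr (D + B - 1)) *
          (ennreal (indicator {0<..<1} x * (x powr (D - 1) * (1 - x) powr (B - 1)))) \<partial>lborel)"
      proof (intro nn_integral_cong, goal_cases)
        case (1 x)
        have iff: "0 < w \<and> w < w + (1 - w) * x \<and> w + (1 - w) * x < 1 \<longleftrightarrow> 0 < x \<and> x < 1"
        proof -
          have "w + (1 - w) * x < 1 \<longleftrightarrow> (1 - w) * (1 - x) > 0" by (auto simp: algebra_simps)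
          then show ?thesis using True by (auto simp: zero_less_mult_iff)
        qed
        have "w powr (C - 1) * ((w + (1 - w) * x - w) powr (D - 1) * (1 - (w + (1 - w) * x)) powr (B - 1)) * (1 - w)
             = w powr (C - 1) * (1 - w) powr (D + B - 1) * (x powr (D - 1) * (1 - x) powr (B - 1))" if "0 < x" "x < 1"
        proof -
          have "1 - (w + (1 - w) * x) = (1 - w) * (1 - x)" by algebra
          moreover have "(1 - w) powr (D + B - 1) = (1 - w) powr (D - 1) * (1 - w) powr (B - 1) * (1 - w)"
            using True powr_add[of "1 - w" "D - 1" "B - 1"] powr_add[of "1 - w" "D - 1 + (B - 1)" 1]
                by (simp add: algebra_simps)
          ultimately show ?thesis using that True by (simp add: powr_mult mult_ac)
        qed
        then have "ennreal (w powr (C - 1) * ((w + (1 - w) * x - w) powr (D - 1) * (1 - (w + (1 - w) * x)) powr (B -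
            1))) * ennreal (1 - w)
             = ennreal (w powr (C - 1) * (1 - w) powr (D + B - 1)) * ennreal (x powr (D - 1) * (1 - x) powr (B -
                 1))" if "0 < x" "x < 1"
          using True that by (subst (1 2) ennreal_mult[symmetric]) auto
        then show ?case using True unfolding H_def iff
          by (auto simp: indicator_def mult.assoc mult.commute[of "ennreal (1 - w)"])
      qed
      also have "\<dots> = \<Phi> w * ennreal (w powr (C - 1) * (1 - w) powr (D + B - 1)) *
          (\<integral>\<^sup>+x. ennreal (indicator {0<..<1} x * (x powr (D - 1) * (1 - x) powr (B - 1))) \<partial>lborel)"
        by (rule nn_integral_cmult) measurable
      also have "(\<integral>\<^sup>+x. ennreal (indicator {0<..<1} x * (x powr (D - 1) * (1 - x) powr (B - 1))) \<partial>lborel)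
          = ennreal (Beta D B)"
        using has_integral_Beta_real[of D B] assms
        by (intro nn_integral_has_integral_lebesgue) (auto simp: has_integral_Icc_iff_Ioo)
      finally show ?thesis using True by (simp add: mult_ac)
    next
      case False
      then show ?thesis by (auto simp: H_def intro!: nn_integral_0_iff_AE[THEN iffD2])
    qed
  qed
  also have "\<dots> = ?R"
    by (rule nn_integral_cmult) measurable
  finally show ?thesis .
qed

section \<open>Radial integration over coordinate products\<close>

interpretation lborel_PiM: product_sigma_finite "\<lambda>_. lborel :: real measure"
  by standard

text \<open>For N >= 1 this is pi^(N/2) / Gamma(N/2), half the area of the unit sphere of an
  N-dimensional space, in the form that adding one coordinate at a time produces. The value at 0 is
  a positive default, so that positivity holds for all N.\<close>

primrec radial_const :: "nat \<Rightarrow> real" where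
  "radial_const 0 = 1"
| "radial_const (Suc N) = (if N = 0 then 1 else radial_const N * Beta (1 / 2) (real N / 2))"

lemma Beta_real_pos: "0 < a \<Longrightarrow> 0 < b \<Longrightarrow> 0 < Beta a (b :: real)"
  unfolding Beta_def by (simp add: Gamma_real_pos)

lemma radial_const_pos: "radial_const N > 0"
  by (induction N) (auto intro!: mult_pos_pos Beta_real_pos)

lemma nn_integral_Beta:
  assumes "a > 0" "b > (0 :: real)"
  shows "(\<integral>\<^sup>+x\<in>{0<..<1}. ennreal (x powr (a - 1) * (1 - x) powr (b - 1)) \<partial>lborel) = ennreal (Beta a b)"
proof -
  have "(\<integral>\<^sup>+x. ennreal (indicator {0<..<1} x * (x powr (a - 1) * (1 - x) powr (b - 1))) \<partial>lborel) = ennreal (Beta a b)"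
    using has_integral_Beta_real[OF assms]
    by (intro nn_integral_has_integral_lebesgue) (auto simp: has_integral_Icc_iff_Ioo)
  then show ?thesis
    by (rule trans[rotated]) (auto intro!: nn_integral_cong simp: indicator_def)
qed

text \<open>The radial formula for \<open>I\<close> is a hypothesis so that the lemma can serve as
  the induction step in the proof of that formula, and again once the formula is known.\<close>

lemma nn_integral_PiM_split_coordinate:
  fixes H :: "real \<times> real \<Rightarrow> ennreal"
  assumes I: "finite I" "I \<noteq> {}" "i \<notin> I"
    and [measurable]: "H \<in> borel_measurable (borel \<Otimes>\<^sub>M borel)"
    and radial: "\<And>h :: real \<Rightarrow> ennreal. h \<in> borel_measurable borel \<Longrightarrow>
        (\<integral>\<^sup>+y. h (\<Sum>j\<in>I. (y j)\<^sup>2) \<partial>PiM I (\<lambda>_. lborel))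
      = ennreal C * (\<integral>\<^sup>+z\<in>{0<..}. h z * ennreal (z powr (real (card I) / 2 - 1)) \<partial>lborel)"
  shows "(\<integral>\<^sup>+y. H ((y i)\<^sup>2, \<Sum>j\<in>I. (y j)\<^sup>2) \<partial>PiM (insert i I) (\<lambda>_. lborel))
      = ennreal C * (\<integral>\<^sup>+z\<in>{0<..}. (\<integral>\<^sup>+w\<in>{0<..}. H (z, w)
           * ennreal (z powr (1 / 2 - 1) * w powr (real (card I) / 2 - 1)) \<partial>lborel) \<partial>lborel)"
proof -
  let ?e = "real (card I) / 2 - 1"
  have [measurable]: "(\<lambda>y. \<Sum>j\<in>I. (y j)\<^sup>2 :: real) \<in> borel_measurable (PiM (insert i I) (\<lambda>_. lborel))"
    using I by measurable
  have neq: "j \<in> I \<Longrightarrow> j \<noteq> i" for j using I by auto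
  have "(\<integral>\<^sup>+y. H ((y i)\<^sup>2, \<Sum>j\<in>I. (y j)\<^sup>2) \<partial>PiM (insert i I) (\<lambda>_. lborel))
      = (\<integral>\<^sup>+t. (\<integral>\<^sup>+y. H (t\<^sup>2, \<Sum>j\<in>I. (y j)\<^sup>2) \<partial>PiM I (\<lambda>_. lborel)) \<partial>lborel)"
    by (subst lborel_PiM.product_nn_integral_insert_rev) (use I neq in \<open>auto cong: sum.cong\<close>)
  also have "\<dots> = (\<integral>\<^sup>+t. ennreal C * (\<integral>\<^sup>+w\<in>{0<..}. H (t\<^sup>2, w) * ennreal (w powr ?e) \<partial>lborel) \<partial>lborel)"
    by (intro nn_integral_cong radial) measurable
  also have "\<dots> = ennreal C * (\<integral>\<^sup>+t. (\<integral>\<^sup>+w\<in>{0<..}. H (t\<^sup>2, w) * ennreal (w powr ?e) \<partial>lborel) \<partial>lborel)"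
    by (rule nn_integral_cmult) measurable
  also have "(\<integral>\<^sup>+t. (\<integral>\<^sup>+w\<in>{0<..}. H (t\<^sup>2, w) * ennreal (w powr ?e) \<partial>lborel) \<partial>lborel)
    = (\<integral>\<^sup>+z\<in>{0<..}. (\<integral>\<^sup>+w\<in>{0<..}. H (z, w) * ennreal (w powr ?e) \<partial>lborel) * ennreal (z powr (-1/2)) \<partial>lborel)"
    by (rule nn_integral_square_real) measurable
  also have "\<dots> = (\<integral>\<^sup>+z\<in>{0<..}. (\<integral>\<^sup>+w\<in>{0<..}. H (z, w)
           * ennreal (z powr (1 / 2 - 1) * w powr ?e) \<partial>lborel) \<partial>lborel)"
    by (intro nn_integral_cong arg_cong2[where f="(*)"] refl, subst nn_integral_multc[symmetric], measurable)
       (auto intro!: nn_integral_cong simp: ennreal_mult indicator_def mult_ac)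
  finally show ?thesis .
qed

lemma nn_integral_PiM_radial:
  fixes h :: "real \<Rightarrow> ennreal"
  assumes "finite I" "I \<noteq> {}" and "h \<in> borel_measurable borel"
  shows "(\<integral>\<^sup>+y. h (\<Sum>j\<in>I. (y j)\<^sup>2) \<partial>PiM I (\<lambda>_. lborel))
      = ennreal (radial_const (card I)) * (\<integral>\<^sup>+z\<in>{0<..}. h z * ennreal (z powr (real (card I) / 2 - 1)) \<partial>lborel)"
  using assms
proof (induction I arbitrary: h rule: finite_ne_induct)
  case (singleton i)
  note [measurable] = singleton
  have "(\<integral>\<^sup>+y. h (\<Sum>j\<in>{i}. (y j)\<^sup>2) \<partial>PiM {i} (\<lambda>_. lborel)) = (\<integral>\<^sup>+t. h (t\<^sup>2) \<partial>lborel)"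
    using lborel_PiM.product_nn_integral_singleton[where f="\<lambda>t. h (t\<^sup>2)"] by simp
  then show ?case by (simp add: nn_integral_square_real)
next
  case (insert i I)
  note [measurable] = insert.prems
  let ?N = "card I"
  have N: "?N > 0" using insert by (simp add: card_gt_0_iff)
  have "(\<integral>\<^sup>+y. h (\<Sum>j\<in>insert i I. (y j)\<^sup>2) \<partial>PiM (insert i I) (\<lambda>_. lborel))
      = (\<integral>\<^sup>+y. (\<lambda>(z, w). h (z + w)) ((y i)\<^sup>2, \<Sum>j\<in>I. (y j)\<^sup>2) \<partial>PiM (insert i I) (\<lambda>_. lborel))"
    using insert by simp
  also have "\<dots> = ennreal (radial_const ?N) * (\<integral>\<^sup>+z\<in>{0<..}. (\<integral>\<^sup>+w\<in>{0<..}. (\<lambda>(z, w). h (z + w)) (z, w)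
           * ennreal (z powr (1 / 2 - 1) * w powr (real ?N / 2 - 1)) \<partial>lborel) \<partial>lborel)"
    by (rule nn_integral_PiM_split_coordinate) (use insert in measurable)
  also have "(\<integral>\<^sup>+z\<in>{0<..}. (\<integral>\<^sup>+w\<in>{0<..}. (\<lambda>(z, w). h (z + w)) (z, w)
           * ennreal (z powr (1 / 2 - 1) * w powr (real ?N / 2 - 1)) \<partial>lborel) \<partial>lborel)
     = (\<integral>\<^sup>+z\<in>{0<..}. (\<integral>\<^sup>+w\<in>{0<..}. (\<lambda>(\<rho>, \<sigma>). h \<rho>) (z + w, z / (z + w))
           * ennreal (z powr (1 / 2 - 1) * w powr (real ?N / 2 - 1)) \<partial>lborel) \<partial>lborel)" by simp
  also have "\<dots> = (\<integral>\<^sup>+\<rho>\<in>{0<..}. (\<integral>\<^sup>+\<sigma>\<in>{0<..<1}. (\<lambda>(\<rho>, \<sigma>). h \<rho>) (\<rho>, \<sigma>)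
            * ennreal (\<rho> powr (1 / 2 + real ?N / 2 - 1) * (\<sigma> powr (1 / 2 - 1) * (1 - \<sigma>) powr (real ?N / 2 - 1)))
                \<partial>lborel) \<partial>lborel)"
    by (rule nn_integral_beta_gamma) measurable
  also have "\<dots> = (\<integral>\<^sup>+\<rho>\<in>{0<..}. h \<rho> * ennreal (\<rho> powr (1 / 2 + real ?N / 2 - 1)) *
        ennreal (Beta (1 / 2) (real ?N / 2)) \<partial>lborel)"
  proof (intro nn_integral_cong arg_cong2[where f="(*)"] refl, goal_cases)
    case (1 \<rho>)
    show ?case using N
      by (subst nn_integral_Beta[symmetric], simp, simp, subst nn_integral_cmult[symmetric], measurable)
         (auto intro!: nn_integral_cong simp: ennreal_mult indicator_def mult_ac)
  qed
  also have "\<dots> = (\<integral>\<^sup>+\<rho>\<in>{0<..}. h \<rho> * ennreal (\<rho> powr (1 / 2 + real ?N / 2 - 1)) \<partial>lborel)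
        * ennreal (Beta (1 / 2) (real ?N / 2))"
    by (subst nn_integral_multc[symmetric], measurable) (auto intro!: nn_integral_cong simp: mult_ac)
  finally show ?case using N insert.hyps radial_const_pos[of ?N] Beta_real_pos[of "1/2" "real ?N / 2"]
    by (simp add: ennreal_mult mult_ac add_divide_distrib)
qed

text \<open>Rotation invariance in the plane from one-dimensional affine substitutions in each
  variable and Fubini. The substitutions divide by c, and their factors 1/|c| and |c| cancel; the
  quarter turns c = 0 are therefore separate.\<close>

lemma nn_integral_rotate_plane:
  fixes H :: "real \<times> real \<Rightarrow> ennreal"
  assumes [measurable]: "H \<in> borel_measurable (borel \<Otimes>\<^sub>M borel)" and cd: "c\<^sup>2 + d\<^sup>2 = (1 :: real)"
  shows "(\<integral>\<^sup>+y. (\<integral>\<^sup>+x. H (c * x + d * y, c * y - d * x) \<partial>lborel) \<partial>lborel)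
       = (\<integral>\<^sup>+y. (\<integral>\<^sup>+x. H (x, y) \<partial>lborel) \<partial>lborel)"
proof (cases "c = 0")
  case True
  then have d: "d = 1 \<or> d = -1" using cd by (simp add: power2_eq_1_iff)
  then have nz: "d \<noteq> 0" "\<bar>d\<bar> = 1" "-d \<noteq> 0" "\<bar>-d\<bar> = 1" by auto
  have "(\<integral>\<^sup>+y. (\<integral>\<^sup>+x. H (c * x + d * y, c * y - d * x) \<partial>lborel) \<partial>lborel)
      = (\<integral>\<^sup>+y. (\<integral>\<^sup>+x. H (d * y, -d * x) \<partial>lborel) \<partial>lborel)" using True by simp
  also have "\<dots> = (\<integral>\<^sup>+y. (\<integral>\<^sup>+x. H (d * y, x) \<partial>lborel) \<partial>lborel)"
    by (subst nn_integral_real_affine[where c="-d" and t=0, OF _ nz(3), unfolded nz]) auto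
  also have "\<dots> = (\<integral>\<^sup>+y. (\<integral>\<^sup>+x. H (y, x) \<partial>lborel) \<partial>lborel)"
    by (subst (2) nn_integral_real_affine[where c="d" and t=0, OF _ nz(1), unfolded nz]) auto
  also have "\<dots> = (\<integral>\<^sup>+y. (\<integral>\<^sup>+x. H (x, y) \<partial>lborel) \<partial>lborel)"
    by (rule lborel_pair.Fubini') simp
  finally show ?thesis .
next
  case c: False
  have "(\<integral>\<^sup>+y. (\<integral>\<^sup>+x. H (x, y) \<partial>lborel) \<partial>lborel) = (\<integral>\<^sup>+u. (\<integral>\<^sup>+w. H (u, w) \<partial>lborel) \<partial>lborel)"
    by (rule lborel_pair.Fubini') simp
  also have "\<dots> = (\<integral>\<^sup>+u. ennreal \<bar>1 / c\<bar> * (\<integral>\<^sup>+y. H (u, (y - d * u) / c) \<partial>lborel) \<partial>lborel)"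
  proof (intro nn_integral_cong, goal_cases)
    case (1 u)
    show ?case
      by (subst nn_integral_real_affine[where c="1/c" and t="- d * u / c"])
         (use c in \<open>auto simp: diff_divide_distrib\<close>)
  qed
  also have "\<dots> = ennreal \<bar>1 / c\<bar> * (\<integral>\<^sup>+u. (\<integral>\<^sup>+y. H (u, (y - d * u) / c) \<partial>lborel) \<partial>lborel)"
    by (rule nn_integral_cmult) measurable
  also have "(\<integral>\<^sup>+u. (\<integral>\<^sup>+y. H (u, (y - d * u) / c) \<partial>lborel) \<partial>lborel) = (\<integral>\<^sup>+y. (\<integral>\<^sup>+u. H (u, (y - d * u) / c) \<partial>lborel)
      \<partial>lborel)"
    by (rule lborel_pair.Fubini') simp
  also have "\<dots> = (\<integral>\<^sup>+y. ennreal \<bar>c\<bar> * (\<integral>\<^sup>+x. H (c * x + d * y, c * y - d * x) \<partial>lborel) \<partial>lborel)"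
  proof (intro nn_integral_cong, goal_cases)
    case (1 y)
    have "(y - d * (d * y + c * x)) / c = c * y - d * x" for x
    proof -
      have "y - d * (d * y + c * x) = c * (c * y - d * x) + y * (1 - (c\<^sup>2 + d\<^sup>2))"
        by (simp add: algebra_simps power2_eq_square)
      then show ?thesis using c cd by simp
    qed
    then show ?case
      by (subst nn_integral_real_affine[where c=c and t="d * y"]) (use c in \<open>auto simp: add.commute\<close>)
  qed
  also have "\<dots> = ennreal \<bar>c\<bar> * (\<integral>\<^sup>+y. (\<integral>\<^sup>+x. H (c * x + d * y, c * y - d * x) \<partial>lborel) \<partial>lborel)"
    by (rule nn_integral_cmult) measurable
  finally show ?thesis using c
    by (simp add: mult.assoc[symmetric] ennreal_mult[symmetric] abs_mult[symmetric])
qed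

text \<open>A rotation that sends the direction (a, b) to the first axis; the radius is
  unaffected.\<close>

lemma nn_integral_rotate_plane_radial:
  fixes G :: "real \<times> real \<Rightarrow> ennreal"
  assumes [measurable]: "G \<in> borel_measurable (borel \<Otimes>\<^sub>M borel)"
  shows "(\<integral>\<^sup>+y. (\<integral>\<^sup>+x. G (a * x + b * y, x\<^sup>2 + y\<^sup>2) \<partial>lborel) \<partial>lborel)
       = (\<integral>\<^sup>+y. (\<integral>\<^sup>+x. G (sqrt (a\<^sup>2 + b\<^sup>2) * x, x\<^sup>2 + y\<^sup>2) \<partial>lborel) \<partial>lborel)"
proof (cases "a = 0 \<and> b = 0")
  case False
  define \<kappa> where "\<kappa> = sqrt (a\<^sup>2 + b\<^sup>2)"
  have \<kappa>: "\<kappa> > 0" using False by (auto simp: \<kappa>_def sum_power2_gt_zero_iff)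
  have k2: "\<kappa>\<^sup>2 = a\<^sup>2 + b\<^sup>2" by (simp add: \<kappa>_def)
  have cd: "(a / \<kappa>)\<^sup>2 + (b / \<kappa>)\<^sup>2 = 1" using \<kappa> by (simp add: power_divide add_divide_distrib[symmetric] k2[symmetric])
  have eq: "\<kappa> * (a / \<kappa> * x + b / \<kappa> * y) = a * x + b * y" for x y using \<kappa> by (simp add: field_simps)
  have eq2: "(a / \<kappa> * x + b / \<kappa> * y)\<^sup>2 + (a / \<kappa> * y - b / \<kappa> * x)\<^sup>2 = x\<^sup>2 + y\<^sup>2" for x y
  proof -
    have "(a / \<kappa> * x + b / \<kappa> * y)\<^sup>2 + (a / \<kappa> * y - b / \<kappa> * x)\<^sup>2 = ((a / \<kappa>)\<^sup>2 + (b / \<kappa>)\<^sup>2) * (x\<^sup>2 + y\<^sup>2)"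
      by (simp only: power2_eq_square algebra_simps)
    then show ?thesis unfolding cd by simp
  qed
  have "(\<lambda>(u, w). G (\<kappa> * u, u\<^sup>2 + w\<^sup>2)) \<in> borel_measurable (borel \<Otimes>\<^sub>M borel)"
    by measurable
  from nn_integral_rotate_plane[OF this cd] show ?thesis
    by (simp only: prod.case eq eq2 \<kappa>_def[symmetric])
qed simp

lemma nn_integral_PiM_insert2:
  assumes "finite J" "i \<notin> J" "j \<notin> J" "i \<noteq> j"
    and [measurable]: "F \<in> borel_measurable (PiM (insert i (insert j J)) (\<lambda>_. lborel))"
  shows "(\<integral>\<^sup>+y. F y \<partial>PiM (insert i (insert j J)) (\<lambda>_. lborel :: real measure))
       = (\<integral>\<^sup>+y. (\<integral>\<^sup>+t. (\<integral>\<^sup>+s. F (y(j := t, i := s)) \<partial>lborel) \<partial>lborel) \<partial>PiM J (\<lambda>_. lborel))"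
proof -
  have "(\<integral>\<^sup>+y. F y \<partial>PiM (insert i (insert j J)) (\<lambda>_. lborel :: real measure))
      = (\<integral>\<^sup>+y. (\<integral>\<^sup>+s. F (y(i := s)) \<partial>lborel) \<partial>PiM (insert j J) (\<lambda>_. lborel))"
    using assms by (intro lborel_PiM.product_nn_integral_insert) auto
  also have "\<dots> = (\<integral>\<^sup>+y. (\<integral>\<^sup>+t. (\<integral>\<^sup>+s. F (y(j := t, i := s)) \<partial>lborel) \<partial>lborel) \<partial>PiM J (\<lambda>_. lborel))"
  proof (rule lborel_PiM.product_nn_integral_insert)
    have [measurable]: "(\<lambda>(y, s). F (y(i := s))) \<in> borel_measurable (PiM (insert j J) (\<lambda>_. lborel) \<Otimes>\<^sub>M lborel)"
      using measurable_compose[OF measurable_add_dim[of i "insert j J" "\<lambda>_. lborel"] assms(5)]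
      by (simp add: case_prod_beta')
    show "(\<lambda>y. \<integral>\<^sup>+s. F (y(i := s)) \<partial>lborel) \<in> borel_measurable (PiM (insert j J) (\<lambda>_. lborel))"
      by measurable
  qed (use assms in auto)
  finally show ?thesis .
qed

text \<open>An integrand that sees only a linear form and the squared norm does not notice
  rotations, so the form can be collapsed onto coordinate i by rotating one coordinate plane at a
  time.\<close>

lemma nn_integral_PiM_rotate:
  fixes G :: "real \<times> real \<Rightarrow> ennreal"
  assumes "finite J" "i \<notin> J" and G: "G \<in> borel_measurable (borel \<Otimes>\<^sub>M borel)"
  shows "(\<integral>\<^sup>+y. G (\<Sum>j\<in>insert i J. c j * y j, \<Sum>j\<in>insert i J. (y j)\<^sup>2) \<partial>PiM (insert i J) (\<lambda>_. lborel))
       = (\<integral>\<^sup>+y. G (sqrt (\<Sum>j\<in>insert i J. (c j)\<^sup>2) * y i, \<Sum>j\<in>insert i J. (y j)\<^sup>2) \<partial>PiM (insert i J) (\<lambda>_. lborel))"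
  using assms
proof (induction J arbitrary: G rule: finite_induct)
  case empty
  note [measurable] = empty.prems(2)
  have "(\<integral>\<^sup>+y. G (c i * y i, (y i)\<^sup>2) \<partial>PiM {i} (\<lambda>_. lborel)) = (\<integral>\<^sup>+t. G (c i * t, t\<^sup>2) \<partial>lborel)"
    by (rule lborel_PiM.product_nn_integral_singleton[where f="\<lambda>t. G (c i * t, t\<^sup>2)"]) measurable
  also have "\<dots> = (\<integral>\<^sup>+t. G (\<bar>c i\<bar> * t, t\<^sup>2) \<partial>lborel)"
  proof (cases "c i \<ge> 0")
    case False
    then show ?thesis by (subst nn_integral_real_affine[where c="-1" and t=0]) auto
  qed simp
  also have "\<dots> = (\<integral>\<^sup>+y. G (\<bar>c i\<bar> * y i, (y i)\<^sup>2) \<partial>PiM {i} (\<lambda>_. lborel))"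
    by (rule lborel_PiM.product_nn_integral_singleton[where f="\<lambda>t. G (\<bar>c i\<bar> * t, t\<^sup>2)", symmetric]) measurable
  finally show ?case by simp
next
  case (insert j J)
  note [measurable] = insert.prems(2)
  let ?P = "\<lambda>A. PiM A (\<lambda>_. lborel :: real measure)"
  let ?K = "insert i (insert j J)"
  have i: "i \<notin> J" "i \<noteq> j" "j \<noteq> i" "j \<notin> J" and fin: "finite J" "finite (insert i J)" and j: "j \<notin> insert i J"
    using insert by auto
  define \<kappa> where "\<kappa> = sqrt (\<Sum>l\<in>insert i J. (c l)\<^sup>2)"
  have I: "?K = insert j (insert i J)" by auto
  have sumK: "(\<Sum>l\<in>?K. f l) = f j + (\<Sum>l\<in>insert i J. f l)" "(\<Sum>l\<in>?K. f l) = f j + (f i + (\<Sum>l\<in>J. f l))"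
      for f :: "_ \<Rightarrow> real"
    using i fin by (auto simp: add_ac)
  have upd: "(\<Sum>l\<in>insert i J. f l ((y(j := t)) l)) = (\<Sum>l\<in>insert i J. f l (y l))"
     "(\<Sum>l\<in>J. f l ((y(j := t, i := s)) l)) = (\<Sum>l\<in>J. f l (y l))" for f :: "_ \<Rightarrow> real \<Rightarrow> real" and y t s
    using i by (auto intro!: sum.cong simp del: sum.insert)
  note upd1 = upd(1)[of "\<lambda>l v. c l * v"] upd(1)[of "\<lambda>l v. v\<^sup>2"] upd(2)[of "\<lambda>l v. v\<^sup>2"]
  have ms[measurable]: "(\<lambda>y. \<Sum>l\<in>A. f l * y l :: real) \<in> borel_measurable (?P B)"
       "(\<lambda>y. \<Sum>l\<in>A. (y l)\<^sup>2 :: real) \<in> borel_measurable (?P B)" if "A \<subseteq> B" for A B f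
    using that by (auto intro!: borel_measurable_sum borel_measurable_times borel_measurable_power
        measurable_component_singleton[where M="\<lambda>_. lborel", simplified])
  have mc[measurable]: "(\<lambda>y. y i) \<in> borel_measurable (?P ?K)" "(\<lambda>y. y j) \<in> borel_measurable (?P ?K)"
    by (auto intro!: measurable_component_singleton[where M="\<lambda>_. lborel", simplified])
  have mG: "(\<lambda>y. G (u y, \<Sum>l\<in>?K. (y l)\<^sup>2)) \<in> borel_measurable (?P ?K)" if "u \<in> borel_measurable (?P ?K)" for u
    by (intro measurable_compose[OF _ insert.prems(2)] measurable_Pair that ms) auto
  have "(\<integral>\<^sup>+y. G (\<Sum>l\<in>?K. c l * y l, \<Sum>l\<in>?K. (y l)\<^sup>2) \<partial>?P ?K)
      = (\<integral>\<^sup>+t. (\<integral>\<^sup>+y. G (c j * t + (\<Sum>l\<in>insert i J. c l * y l), t\<^sup>2 + (\<Sum>l\<in>insert i J. (y l)\<^sup>2)) \<partial>?P (insert i J)) \<partial>lborel)"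
    unfolding I
    by (subst lborel_PiM.product_nn_integral_insert_rev[OF fin(2) j])
       (use mG[OF ms(1)[OF subset_refl, of c]] in \<open>simp_all only: I[symmetric] sumK(1) upd1 fun_upd_same\<close>)
  \<comment> \<open>With coordinate j frozen at t, the rest of the form collapses onto coordinate i.
    Freezing shifts both arguments of \<open>G\<close>, which is why the induction generalises over
    \<open>G\<close>.\<close>
  also have "\<dots> = (\<integral>\<^sup>+t. (\<integral>\<^sup>+y. G (c j * t + \<kappa> * y i, t\<^sup>2 + (\<Sum>l\<in>insert i J. (y l)\<^sup>2)) \<partial>?P (insert i J)) \<partial>lborel)"
  proof (rule nn_integral_cong, goal_cases)
    case (1 t)
    have "(\<lambda>(u, w). G (c j * t + u, t\<^sup>2 + w)) \<in> borel_measurable (borel \<Otimes>\<^sub>M borel)" by measurable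
    from insert.IH[OF i(1) this] show ?case unfolding \<kappa>_def prod.case .
  qed
  also have "\<dots> = (\<integral>\<^sup>+y. G (c j * y j + \<kappa> * y i, \<Sum>l\<in>?K. (y l)\<^sup>2) \<partial>?P ?K)"
    unfolding I
    by (subst lborel_PiM.product_nn_integral_insert_rev[OF fin(2) j])
       (use mG[of "\<lambda>y. c j * y j + \<kappa> * y i"] i in \<open>simp_all only: I[symmetric] sumK(1) upd1 fun_upd_same fun_upd_other
           simp_thms borel_measurable_add borel_measurable_times mc borel_measurable_const\<close>)
  also have "\<dots> = (\<integral>\<^sup>+y. (\<integral>\<^sup>+t. (\<integral>\<^sup>+s. G (c j * t + \<kappa> * s, t\<^sup>2 + (s\<^sup>2 + (\<Sum>l\<in>J. (y l)\<^sup>2))) \<partial>lborel) \<partial>lborel) \<partial>?P J)"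
    by (subst nn_integral_PiM_insert2[OF fin(1) i(1,4,2)])
       (use mG[of "\<lambda>y. c j * y j + \<kappa> * y i"] i in \<open>simp_all only: sumK(2) upd1 fun_upd_same fun_upd_other simp_thms
           borel_measurable_add borel_measurable_times mc borel_measurable_const\<close>)
  \<comment> \<open>A rotation in the plane of coordinates i and j absorbs \<open>c j\<close> into
    the coefficient of coordinate i.\<close>
  also have "\<dots> = (\<integral>\<^sup>+y. (\<integral>\<^sup>+t. (\<integral>\<^sup>+s. G (sqrt (\<kappa>\<^sup>2 + (c j)\<^sup>2) * s, t\<^sup>2 + (s\<^sup>2 + (\<Sum>l\<in>J. (y l)\<^sup>2))) \<partial>lborel) \<partial>lborel) \<partial>?P J)"
  proof (rule nn_integral_cong, goal_cases)
    case (1 y)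
    have "(\<lambda>(u, w). G (u, w + (\<Sum>l\<in>J. (y l)\<^sup>2))) \<in> borel_measurable (borel \<Otimes>\<^sub>M borel)" by measurable
    from nn_integral_rotate_plane_radial[OF this, of \<kappa> "c j"] show ?case
      by (simp add: add_ac)
  qed
  also have "sqrt (\<kappa>\<^sup>2 + (c j)\<^sup>2) = sqrt (\<Sum>l\<in>?K. (c l)\<^sup>2)"
    using i insert.hyps by (simp add: \<kappa>_def sum_nonneg add_ac)
  also have "(\<integral>\<^sup>+y. (\<integral>\<^sup>+t. (\<integral>\<^sup>+s. G (sqrt (\<Sum>l\<in>?K. (c l)\<^sup>2) * s, t\<^sup>2 + (s\<^sup>2 + (\<Sum>l\<in>J. (y l)\<^sup>2))) \<partial>lborel) \<partial>lborel) \<partial>?P J)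
     = (\<integral>\<^sup>+y. G (sqrt (\<Sum>l\<in>?K. (c l)\<^sup>2) * y i, \<Sum>l\<in>?K. (y l)\<^sup>2) \<partial>?P ?K)"
    by (subst nn_integral_PiM_insert2[OF fin(1) i(1,4,2)])
       (use mG[of "\<lambda>y. sqrt (\<Sum>l\<in>?K. (c l)\<^sup>2) * y i"] i in \<open>simp_all only: sumK(2) upd1 fun_upd_same fun_upd_other
           simp_thms borel_measurable_add borel_measurable_times mc borel_measurable_const\<close>)
  finally show ?case .
qed

text \<open>After rotation the form is sqrt(tau) times one coordinate. The ratio of that squared
  coordinate to the squared norm is Beta(1/2, (N-1)/2) distributed, independently of the norm, where
  N is the number of coordinates.\<close>

lemma nn_integral_PiM_direction:
  fixes G :: "real \<times> real \<Rightarrow> ennreal"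
  assumes "finite I" "card I \<ge> 2" and [measurable]: "G \<in> borel_measurable (borel \<Otimes>\<^sub>M borel)"
    and c: "(\<Sum>j\<in>I. (c j)\<^sup>2) = \<tau>"
  shows "(\<integral>\<^sup>+y. G (\<Sum>j\<in>I. (y j)\<^sup>2, (\<Sum>j\<in>I. c j * y j)\<^sup>2 / (\<Sum>j\<in>I. (y j)\<^sup>2)) \<partial>PiM I (\<lambda>_. lborel))
       = ennreal (radial_const (card I - 1)) * (\<integral>\<^sup>+\<rho>\<in>{0<..}. (\<integral>\<^sup>+\<sigma>\<in>{0<..<1}. G (\<rho>, \<tau> * \<sigma>)
            * ennreal (\<rho> powr (real (card I) / 2 - 1) * (\<sigma> powr (1 / 2 - 1) * (1 - \<sigma>) powr ((real (card I) - 1) / 2 -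
                1))) \<partial>lborel) \<partial>lborel)"
proof -
  obtain i where i: "i \<in> I" using assms by fastforce
  define J where "J = I - {i}"
  have J: "I = insert i J" "i \<notin> J" "finite J" using i assms by (auto simp: J_def)
  have cJ: "card J = card I - 1" "real (card J) = real (card I) - 1" "J \<noteq> {}" "card I \<ge> 1"
    using J assms by auto
  have "\<tau> \<ge> 0" using c by (auto intro: sum_nonneg)
  then have sq: "(sqrt \<tau> * u)\<^sup>2 = \<tau> * u\<^sup>2" for u by (simp add: power_mult_distrib)
  have mG[measurable]: "(\<lambda>(u, w). G (w, u\<^sup>2 / w)) \<in> borel_measurable (borel \<Otimes>\<^sub>M borel)" by measurable
  have "(\<integral>\<^sup>+y. G (\<Sum>j\<in>I. (y j)\<^sup>2, (\<Sum>j\<in>I. c j * y j)\<^sup>2 / (\<Sum>j\<in>I. (y j)\<^sup>2)) \<partial>PiM I (\<lambda>_. lborel))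
      = (\<integral>\<^sup>+y. (\<lambda>(z, w). G (z + w, \<tau> * (z / (z + w)))) ((y i)\<^sup>2, \<Sum>j\<in>J. (y j)\<^sup>2) \<partial>PiM (insert i J) (\<lambda>_. lborel))"
    using nn_integral_PiM_rotate[OF J(3,2) mG, of c] c J by (simp add: sq)
  also have "\<dots> = ennreal (radial_const (card J)) * (\<integral>\<^sup>+z\<in>{0<..}. (\<integral>\<^sup>+w\<in>{0<..}. (\<lambda>(z, w). G (z + w, \<tau> * (z / (z
      + w)))) (z, w)
           * ennreal (z powr (1 / 2 - 1) * w powr (real (card J) / 2 - 1)) \<partial>lborel) \<partial>lborel)"
    by (rule nn_integral_PiM_split_coordinate[OF J(3) cJ(3) J(2) _ nn_integral_PiM_radial[OF J(3) cJ(3)]]) measurable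
  also have "(\<integral>\<^sup>+z\<in>{0<..}. (\<integral>\<^sup>+w\<in>{0<..}. (\<lambda>(z, w). G (z + w, \<tau> * (z / (z + w)))) (z, w)
           * ennreal (z powr (1 / 2 - 1) * w powr (real (card J) / 2 - 1)) \<partial>lborel) \<partial>lborel)
     = (\<integral>\<^sup>+z\<in>{0<..}. (\<integral>\<^sup>+w\<in>{0<..}. (\<lambda>(\<rho>, \<sigma>). G (\<rho>, \<tau> * \<sigma>)) (z + w, z / (z + w))
           * ennreal (z powr (1 / 2 - 1) * w powr (real (card J) / 2 - 1)) \<partial>lborel) \<partial>lborel)" by simp
  also have "\<dots> = (\<integral>\<^sup>+\<rho>\<in>{0<..}. (\<integral>\<^sup>+\<sigma>\<in>{0<..<1}. (\<lambda>(\<rho>, \<sigma>). G (\<rho>, \<tau> * \<sigma>)) (\<rho>, \<sigma>)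
            * ennreal (\<rho> powr (1 / 2 + real (card J) / 2 - 1) * (\<sigma> powr (1 / 2 - 1) * (1 - \<sigma>) powr (real (card J) / 2
                - 1))) \<partial>lborel) \<partial>lborel)"
    by (rule nn_integral_beta_gamma) measurable
  also have "1 / 2 + real (card J) / 2 - 1 = real (card I) / 2 - 1" using cJ by (simp add: field_simps)
  finally show ?thesis using cJ by simp
qed

section \<open>Isometry invariance and Gaussian residuals\<close>

lemma nn_integral_lborel_PiM_Basis:
  fixes f :: "'a :: euclidean_space \<Rightarrow> ennreal"
  assumes [measurable]: "f \<in> borel_measurable borel"
  shows "(\<integral>\<^sup>+x. f x \<partial>lborel) = (\<integral>\<^sup>+y. f (\<Sum>b\<in>Basis. y b *\<^sub>R b) \<partial>PiM Basis (\<lambda>_. lborel))"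
  by (subst lborel_eq, subst nn_integral_distr) auto

lemma nn_integral_lborel_translate:
  fixes f :: "'a :: euclidean_space \<Rightarrow> ennreal"
  assumes [measurable]: "f \<in> borel_measurable borel"
  shows "(\<integral>\<^sup>+x. f (x + t) \<partial>lborel) = (\<integral>\<^sup>+x. f x \<partial>lborel)"
proof -
  have "(\<integral>\<^sup>+x. f x \<partial>lborel) = (\<integral>\<^sup>+x. f x \<partial>distr lborel borel ((+) t))"
    by (simp add: lborel_distr_plus)
  also have "\<dots> = (\<integral>\<^sup>+x. f (t + x) \<partial>lborel)" by (subst nn_integral_distr) auto
  finally show ?thesis by (simp add: add.commute)
qed

text \<open>Uniqueness of Haar measure in disguise: the pushforward \<open>\<mu>\<close> of Lebesgue measure under an isometry is
  translation invariant, and Fubini applied to \<open>1\<^sub>A(x) 1\<^sub>B(y - x)\<close> with the unit ball \<open>B\<close>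
  gives \<open>\<mu>(A) |B| = |A| \<mu>(B)\<close>.\<close>

lemma distr_lborel_isometry:
  fixes T :: "'a :: euclidean_space \<Rightarrow> 'a"
  assumes lin: "linear T" and norm: "\<And>x. norm (T x) = norm x"
  shows "distr lborel borel T = lborel"
proof (rule measure_eqI)
  have [measurable]: "T \<in> borel_measurable borel"
    using lin by (intro borel_measurable_continuous_onI linear_continuous_on) (simp add: linear_conv_bounded_linear)
  have surj: "surj T" using lin norm by (metis linear_injective_imp_surjective linear_injective_0 norm_eq_zero)
  fix A assume "A \<in> sets (distr lborel borel T)"
  then have [measurable]: "A \<in> sets borel" by simp
  define B where "B = ball (0 :: 'a) 1"
  have [measurable]: "B \<in> sets borel" by (simp add: B_def)
  have T_diff: "T (x - y) = T x - T y" "T (x + y) = T x + T y" for x y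
    using lin by (simp_all add: linear_diff linear_add)
  have L: "emeasure lborel B \<noteq> 0" "emeasure lborel B \<noteq> \<infinity>"
    unfolding B_def using less_imp_neq[OF unit_ball_vol_pos[of "real DIM('a)", OF of_nat_0_le_iff]]
    by (simp_all add: emeasure_ball)
  have TB: "T x \<in> B \<longleftrightarrow> x \<in> B" for x by (simp add: B_def norm)
  have "emeasure (distr lborel borel T) A * emeasure lborel B
      = (\<integral>\<^sup>+x. indicator A (T x) * emeasure lborel B \<partial>lborel)"
  proof -
    have "emeasure (distr lborel borel T) A = (\<integral>\<^sup>+x. indicator A x \<partial>distr lborel borel T)" by simp
    also have "\<dots> = (\<integral>\<^sup>+x. indicator A (T x) \<partial>lborel)" by (rule nn_integral_distr) auto
    finally show ?thesis by (simp add: nn_integral_multc)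
  qed
  also have "\<dots> = (\<integral>\<^sup>+x. indicator A (T x) * (\<integral>\<^sup>+y. indicator B y \<partial>lborel) \<partial>lborel)" by simp
  also have "\<dots> = (\<integral>\<^sup>+x. (\<integral>\<^sup>+y. indicator A (T x) * indicator B (y - T x) \<partial>lborel) \<partial>lborel)"
  proof (rule nn_integral_cong, goal_cases)
    case (1 x)
    show ?case
      using nn_integral_lborel_translate[of "indicator B" "- T x"] by (simp add: nn_integral_cmult)
  qed
  also have "\<dots> = (\<integral>\<^sup>+y. (\<integral>\<^sup>+x. indicator A (T x) * indicator B (y - T x) \<partial>lborel) \<partial>lborel)"
    by (rule lborel_pair.Fubini') measurable
  also have "\<dots> = (\<integral>\<^sup>+y. (\<integral>\<^sup>+x. indicator A (T x + y) * indicator B x \<partial>lborel) \<partial>lborel)"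
  proof (rule nn_integral_cong, goal_cases)
    case (1 y)
    obtain z where z: "y = T z" using surj by blast
    have "(\<integral>\<^sup>+x. indicator A (T x) * indicator B (y - T x) \<partial>lborel)
        = (\<integral>\<^sup>+x. indicator A (T (x + z)) * indicator B (y - T (x + z)) \<partial>lborel :: ennreal)"
      by (rule nn_integral_lborel_translate[symmetric]) measurable
    also have "\<dots> = (\<integral>\<^sup>+x. indicator A (T x + y) * indicator B x \<partial>lborel)"
      by (intro nn_integral_cong) (auto simp: T_diff z B_def norm indicator_def)
    finally show ?case .
  qed
  also have "\<dots> = (\<integral>\<^sup>+x. (\<integral>\<^sup>+y. indicator A (T x + y) * indicator B x \<partial>lborel) \<partial>lborel)"
    by (rule lborel_pair.Fubini') measurable
  also have "\<dots> = (\<integral>\<^sup>+x. emeasure lborel A * indicator B x \<partial>lborel)"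
  proof (rule nn_integral_cong, goal_cases)
    case (1 x)
    show ?case
      using nn_integral_lborel_translate[of "indicator A" "T x"] by (simp add: nn_integral_multc add.commute)
  qed
  also have "\<dots> = emeasure lborel A * emeasure lborel B" by (simp add: nn_integral_cmult)
  finally show "emeasure (distr lborel borel T) A = emeasure lborel A"
    using L by (simp add: mult.commute[of _ "emeasure lborel B"] ennreal_mult_cancel_left)
qed simp

definition orthonormal_on :: "'i set \<Rightarrow> ('i \<Rightarrow> 'a :: real_inner) \<Rightarrow> bool" where
  "orthonormal_on I h \<longleftrightarrow> (\<forall>i\<in>I. \<forall>j\<in>I. h i \<bullet> h j = (if i = j then 1 else 0))"

lemma orthonormal_on_inner:
  assumes "orthonormal_on I h" "finite I" "i \<in> I"
  shows "(\<Sum>j\<in>I. y j *\<^sub>R h j) \<bullet> h i = y i"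
proof -
  have "(\<Sum>j\<in>I. y j *\<^sub>R h j) \<bullet> h i = (\<Sum>j\<in>I. y j * (if j = i then 1 else 0))"
    unfolding inner_sum_left by (rule sum.cong) (use assms in \<open>auto simp: orthonormal_on_def\<close>)
  then show ?thesis using assms by (simp add: if_distrib cong: if_cong)
qed

lemma orthonormal_on_norm:
  assumes "orthonormal_on I h" "finite I"
  shows "(norm (\<Sum>i\<in>I. y i *\<^sub>R h i))\<^sup>2 = (\<Sum>i\<in>I. (y i)\<^sup>2)"
proof -
  have "(norm (\<Sum>i\<in>I. y i *\<^sub>R h i))\<^sup>2 = (\<Sum>i\<in>I. y i * ((\<Sum>j\<in>I. y j *\<^sub>R h j) \<bullet> h i))"
    by (simp add: power2_norm_eq_inner inner_sum_right)
  also have "\<dots> = (\<Sum>i\<in>I. (y i)\<^sup>2)"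
    by (rule sum.cong) (use assms in \<open>auto simp: orthonormal_on_inner power2_eq_square\<close>)
  finally show ?thesis .
qed

lemma orthonormal_Basis_isometry:
  fixes h :: "'a :: euclidean_space \<Rightarrow> 'a"
  assumes h: "orthonormal_on Basis h"
  defines "T \<equiv> \<lambda>x. \<Sum>b\<in>Basis. (x \<bullet> b) *\<^sub>R h b"
  shows "linear T" "norm (T x) = norm x"
proof -
  show "linear T" unfolding T_def
    by (intro linear_compose_sum ballI linear_compose[unfolded o_def, of "\<lambda>x. x \<bullet> b" "\<lambda>c. c *\<^sub>R h b" for b]
         bounded_linear.linear bounded_linear_inner_left bounded_linear_scaleR_left)
  have "(norm (T x))\<^sup>2 = (norm x)\<^sup>2"
    unfolding T_def orthonormal_on_norm[OF h finite_Basis]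
    using euclidean_inner[of x x] by (simp add: power2_norm_eq_inner[symmetric] power2_eq_square[symmetric])
  then show "norm (T x) = norm x" by simp
qed

lemma orthonormal_Basis_expansion:
  fixes h :: "'a :: euclidean_space \<Rightarrow> 'a"
  assumes h: "orthonormal_on Basis h"
  shows "(\<Sum>b\<in>Basis. (q \<bullet> h b) *\<^sub>R h b) = q"
proof -
  define T where "T x = (\<Sum>b\<in>Basis. (x \<bullet> b) *\<^sub>R h b)" for x
  have "linear T" "norm (T x) = norm x" for x
    using orthonormal_Basis_isometry[OF h] unfolding T_def by auto
  then have "surj T" by (metis linear_injective_imp_surjective linear_injective_0 norm_eq_zero)
  then obtain z where z: "q = T z" by blast
  have "q \<bullet> h b = z \<bullet> b" if "b \<in> Basis" for b
    unfolding z T_def using orthonormal_on_inner[OF h finite_Basis that] .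
  then show ?thesis unfolding z T_def by simp
qed

text \<open>A frame indexed by \<open>Basis\<close> is the image of the standard basis under an
  isometry, so its coordinates again carry product Lebesgue measure.\<close>

lemma nn_integral_lborel_orthonormal:
  fixes f :: "'a :: euclidean_space \<Rightarrow> ennreal" and h :: "'a \<Rightarrow> 'a"
  assumes [measurable]: "f \<in> borel_measurable borel" and h: "orthonormal_on Basis h"
  shows "(\<integral>\<^sup>+x. f x \<partial>lborel) = (\<integral>\<^sup>+y. f (\<Sum>b\<in>Basis. y b *\<^sub>R h b) \<partial>PiM Basis (\<lambda>_. lborel))"
proof -
  define T where "T x = (\<Sum>b\<in>Basis. (x \<bullet> b) *\<^sub>R h b)" for x
  have lin: "linear T" and norm: "norm (T x) = norm x" for x
    using orthonormal_Basis_isometry[OF h] unfolding T_def by auto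
  have [measurable]: "T \<in> borel_measurable borel"
    using lin by (intro borel_measurable_continuous_onI linear_continuous_on) (simp add: linear_conv_bounded_linear)
  have "(\<integral>\<^sup>+x. f x \<partial>lborel) = (\<integral>\<^sup>+x. f (T x) \<partial>lborel)"
    by (subst distr_lborel_isometry[OF lin norm, symmetric], subst nn_integral_distr) auto
  also have "\<dots> = (\<integral>\<^sup>+y. f (T (\<Sum>b\<in>Basis. y b *\<^sub>R b)) \<partial>PiM Basis (\<lambda>_. lborel))"
    by (rule nn_integral_lborel_PiM_Basis) measurable
  also have "\<dots> = (\<integral>\<^sup>+y. f (\<Sum>b\<in>Basis. y b *\<^sub>R h b) \<partial>PiM Basis (\<lambda>_. lborel))"
    unfolding T_def by (simp add: inner_sum_left_Basis cong: sum.cong)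
  finally show ?thesis .
qed


text \<open>Gram-Schmidt without normalisation: the component of x orthogonal to the first j
  vectors. If the residual of \<open>v j\<close> vanishes, division by zero gives 0 and the vector
  is skipped, so dependent vectors do no harm. The explicit recursion makes measurability in v
  immediate.\<close>

fun gs_residual :: "(nat \<Rightarrow> 'a :: euclidean_space) \<Rightarrow> nat \<Rightarrow> 'a \<Rightarrow> 'a" where
  "gs_residual v 0 x = x"
| "gs_residual v (Suc j) x = gs_residual v j x -
     ((gs_residual v j x \<bullet> gs_residual v j (v j)) / (gs_residual v j (v j) \<bullet> gs_residual v j (v j))) *\<^sub>R gs_residual v
         j (v j)"

lemma gs_residual_cong:
  "(\<And>i. i < j \<Longrightarrow> v i = v' i) \<Longrightarrow> gs_residual v j x = gs_residual v' j x"
  by (induction j arbitrary: x) auto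

lemma gs_residual_span: "x - gs_residual v j x \<in> span (v ` {..<j})"
proof (induction j arbitrary: x)
  case 0
  then show ?case by (simp add: span_zero)
next
  case (Suc j)
  let ?w = "gs_residual v j (v j)" and ?S = "span (v ` {..<Suc j})"
  have sub: "span (v ` {..<j}) \<subseteq> ?S" by (rule span_mono) auto
  have "v j - ?w \<in> ?S" "x - gs_residual v j x \<in> ?S" using Suc sub by auto
  moreover have "v j \<in> ?S" by (rule span_base) auto
  ultimately have w: "?w \<in> ?S" and x: "x - gs_residual v j x \<in> ?S"
    using span_diff[of "v j" "v ` {..<Suc j}" "v j - ?w"] by auto
  have "x - gs_residual v (Suc j) x = (x - gs_residual v j x) + 
     ((gs_residual v j x \<bullet> ?w) / (?w \<bullet> ?w)) *\<^sub>R ?w" by simp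
  then show ?case using w x by (metis span_add span_scale)
qed

lemma gs_residual_orth: "y \<in> span (v ` {..<j}) \<Longrightarrow> gs_residual v j x \<bullet> y = 0"
proof (induction j arbitrary: x y)
  case 0
  then show ?case by simp
next
  case (Suc j)
  let ?w = "gs_residual v j (v j)" and ?r = "gs_residual v (Suc j) x"
  have base: "?r \<bullet> v i = 0" if "i < Suc j" for i
  proof (cases "i < j")
    case True
    then have "v i \<in> span (v ` {..<j})" by (intro span_base) auto
    then show ?thesis using Suc.IH by (simp add: inner_diff_left)
  next
    case False
    with that have i: "i = j" by simp
    have d: "v j - ?w \<in> span (v ` {..<j})" by (rule gs_residual_span)
    have "?r \<bullet> (v j - ?w) = 0" using Suc.IH[OF d] by (simp add: inner_diff_left)
    moreover have "?r \<bullet> ?w = 0" by (cases "?w = 0") (auto simp: inner_diff_left)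
    ultimately show ?thesis unfolding i by (simp add: inner_diff_right)
  qed
  have "subspace {y. ?r \<bullet> y = 0}" by (rule subspace_hyperplane)
  moreover have "v ` {..<Suc j} \<subseteq> {y. ?r \<bullet> y = 0}" using base by auto
  ultimately have "span (v ` {..<Suc j}) \<subseteq> {y. ?r \<bullet> y = 0}" by (rule span_minimal[rotated])
  then show ?case using Suc.prems by auto
qed

lemma gs_residual_unique:
  assumes "x - r \<in> span (v ` {..<j})" "\<And>y. y \<in> span (v ` {..<j}) \<Longrightarrow> r \<bullet> y = 0"
  shows "gs_residual v j x = r"
proof -
  have "gs_residual v j x - r \<in> span (v ` {..<j})"
    using span_diff[OF assms(1) gs_residual_span[of x v j]] by simp
  then have "(gs_residual v j x - r) \<bullet> (gs_residual v j x - r) = 0"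
    using assms(2) gs_residual_orth[of _ v j x] by (simp add: inner_diff_left)
  then show ?thesis by simp
qed

lemma gs_residual_eq_0_iff: "gs_residual v j x = 0 \<longleftrightarrow> x \<in> span (v ` {..<j})"
  using gs_residual_span[of x v j] gs_residual_unique[of x 0 v j] by auto

text \<open>Turns the rank condition on a random span into conditions on single residuals, which are
  measurable and can be handled one vector at a time.\<close>

lemma dim_span_gs_residual:
  "dim (span (v ` {..<j})) = j \<longleftrightarrow> (\<forall>i<j. gs_residual v i (v i) \<noteq> 0)"
proof (induction j)
  case (Suc j)
  have le: "dim (v ` {..<j}) \<le> j" by (metis card_image_le card_lessThan dim_le_card' finite_imageI finite_lessThan
      order_trans)
  have "v ` {..<Suc j} = insert (v j) (v ` {..<j})" by (auto simp: lessThan_Suc)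
  then show ?case using Suc le
    by (auto simp: dim_insert gs_residual_eq_0_iff less_Suc_eq)
qed simp

text \<open>Pythagoras. For the axis vector this is the recursion that 1 - tau satisfies when one
  more vector is added to the span.\<close>

lemma norm_gs_residual_Suc:
  "(norm (gs_residual v (Suc j) x))\<^sup>2 = (norm (gs_residual v j x))\<^sup>2
     - (gs_residual v j x \<bullet> gs_residual v j (v j))\<^sup>2 / (norm (gs_residual v j (v j)))\<^sup>2"
proof -
  let ?w = "gs_residual v j (v j)" and ?q = "gs_residual v j x"
  have "(norm (gs_residual v (Suc j) x))\<^sup>2 = ?q \<bullet> ?q - 2 * ((?q \<bullet> ?w) / (?w \<bullet> ?w)) * (?q \<bullet> ?w)
      + ((?q \<bullet> ?w) / (?w \<bullet> ?w))\<^sup>2 * (?w \<bullet> ?w)"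
    unfolding gs_residual.simps power2_norm_eq_inner
    by (simp add: inner_diff_left inner_diff_right inner_commute power2_eq_square)
  also have "\<dots> = ?q \<bullet> ?q - (?q \<bullet> ?w)\<^sup>2 / (?w \<bullet> ?w)"
    by (cases "?w = 0") (auto simp: power2_eq_square field_simps)
  finally show ?thesis by (simp add: power2_norm_eq_inner)
qed

lemma gs_residual_measurable [measurable (raw)]:
  assumes "\<And>i. i < j \<Longrightarrow> (\<lambda>\<omega>. V \<omega> i) \<in> borel_measurable M" "X \<in> borel_measurable M"
  shows "(\<lambda>\<omega>. gs_residual (V \<omega>) j (X \<omega>)) \<in> borel_measurable M"
  using assms
proof (induction j arbitrary: X)
  case (Suc j)
  have [measurable]: "(\<lambda>\<omega>. gs_residual (V \<omega>) j (X \<omega>)) \<in> borel_measurable M"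
      "(\<lambda>\<omega>. gs_residual (V \<omega>) j (V \<omega> j)) \<in> borel_measurable M"
    using Suc by auto
  show ?case by simp
qed simp

lemma nn_integral_exp_powr_finite:
  assumes "a > (0 :: real)"
  obtains c where "c > 0" "(\<integral>\<^sup>+z\<in>{0<..}. ennreal (exp (- z / 2) * z powr (a - 1)) \<partial>lborel) = ennreal c"
proof
  have "(\<integral>\<^sup>+z\<in>{0<..}. ennreal (exp (- z / 2) * z powr (a - 1)) \<partial>lborel)
      = 2 * (\<integral>\<^sup>+z. ennreal (exp (- z) * (2 * z) powr (a - 1)) * indicator {0<..} (2 * z) \<partial>lborel)"
    by (subst nn_integral_real_affine[where c=2 and t=0]) auto
  also have "(\<integral>\<^sup>+z. ennreal (exp (- z) * (2 * z) powr (a - 1)) * indicator {0<..} (2 * z) \<partial>lborel)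
     = (\<integral>\<^sup>+z. ennreal (2 powr (a - 1)) * ennreal (indicator {0..} z * z powr (a - 1) / exp z) \<partial>lborel)"
  proof (rule nn_integral_cong_AE)
    show "AE z in lborel. ennreal (exp (- z) * (2 * z) powr (a - 1)) * indicator {0<..} (2 * z)
       = ennreal (2 powr (a - 1)) * ennreal (indicator {0..} z * z powr (a - 1) / exp z)"
      using AE_lborel_singleton[of "0 :: real"]
      by eventually_elim (auto simp: indicator_def ennreal_mult[symmetric] powr_mult exp_minus field_simps)
  qed
  also have "\<dots> = ennreal (2 powr (a - 1)) * ennreal (Gamma a)"
    by (subst nn_integral_cmult) (auto simp: Gamma_conv_nn_integral_real[OF assms])
  also have "2 * (ennreal (2 powr (a - 1)) * ennreal (Gamma a)) = ennreal (2 * (2 powr (a - 1) * Gamma a))"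
    using Gamma_real_pos[OF assms] by (simp add: ennreal_mult)
  finally show "(\<integral>\<^sup>+z\<in>{0<..}. ennreal (exp (- z / 2) * z powr (a - 1)) \<partial>lborel) = ennreal (2 * (2 powr (a - 1)
      * Gamma a))" .
  show "2 * (2 powr (a - 1) * Gamma a) > 0" using Gamma_real_pos[OF assms] by simp
qed

text \<open>Indexing the frame by \<open>Basis\<close> and its part orthogonal to V by a subset
  \<open>J\<close> lets the product measure over \<open>Basis\<close> factor into directions inside
  V and directions orthogonal to V.\<close>

lemma orthonormal_basis_adapted:
  fixes V :: "'a :: euclidean_space set"
  assumes V: "subspace V"
  obtains h :: "'a \<Rightarrow> 'a" and J where "orthonormal_on Basis h" "J \<subseteq> Basis" "card J = DIM('a) - dim V"
    "\<And>b. b \<in> Basis - J \<Longrightarrow> h b \<in> V" "\<And>b y. b \<in> J \<Longrightarrow> y \<in> V \<Longrightarrow> h b \<bullet> y = 0"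
proof -
  define W where "W = {y \<in> UNIV. \<forall>x\<in>V. orthogonal x y}"
  have dimW: "dim W + dim V = DIM('a)"
    unfolding W_def using dim_subspace_orthogonal_to_vectors[OF V subspace_UNIV] by (simp add: dim_UNIV)
  have subW: "subspace W" unfolding W_def using subspace_orthogonal_to_vectors[of V] by simp
  obtain A where A: "A \<subseteq> V" "pairwise orthogonal A" "\<And>x. x \<in> A \<Longrightarrow> norm x = 1" "independent A" "card A = dim V"
    using orthonormal_basis_subspace[OF V] by metis
  obtain B where B: "B \<subseteq> W" "pairwise orthogonal B" "\<And>x. x \<in> B \<Longrightarrow> norm x = 1" "independent B" "card B = dim W"
    using orthonormal_basis_subspace[OF subW] by metis
  have fin: "finite A" "finite B" using A B by (auto intro: independent_imp_finite)
  have VW: "x \<bullet> y = 0" "y \<bullet> x = 0" if "x \<in> V" "y \<in> W" for x y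
    using that by (auto simp: W_def orthogonal_def inner_commute)
  have disj: "A \<inter> B = {}"
  proof (rule ccontr)
    assume "A \<inter> B \<noteq> {}"
    then obtain x where x: "x \<in> A" "x \<in> B" by auto
    then have "x \<bullet> x = 0" using A(1) B(1) VW by blast
    then show False using A(3)[OF x(1)] by simp
  qed
  have "card (A \<union> B) = card (Basis :: 'a set)"
    using card_Un_disjoint[OF fin disj] A B dimW by simp
  then obtain h where h: "bij_betw h (Basis :: 'a set) (A \<union> B)"
    using finite_same_card_bij[of "Basis :: 'a set" "A \<union> B"] fin by auto
  have inj: "inj_on h Basis" and im: "h ` Basis = A \<union> B" using h by (auto simp: bij_betw_def)
  define J where "J = {b \<in> Basis. h b \<in> B}"
  have "h ` J = B" using im by (auto simp: J_def)
  moreover have "inj_on h J" using inj by (auto simp: J_def inj_on_def)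
  ultimately have "card J = card B" using card_image by metis
  have orth: "orthonormal_on Basis h"
    unfolding orthonormal_on_def
  proof (intro ballI)
    fix b b' :: 'a assume b: "b \<in> Basis" "b' \<in> Basis"
    have mem: "h b \<in> A \<union> B" "h b' \<in> A \<union> B" using b im by auto
    show "h b \<bullet> h b' = (if b = b' then 1 else 0)"
    proof (cases "b = b'")
      case True
      then show ?thesis using mem A(3) B(3) by (auto simp: norm_eq_1)
    next
      case False
      then have ne: "h b \<noteq> h b'" using inj b by (auto simp: inj_on_def)
      have "h b \<bullet> h b' = 0"
        using mem ne A(1,2) B(1,2) VW unfolding pairwise_def orthogonal_def by blast
      then show ?thesis using False by simp
    qed
  qed
  show thesis
  proof (rule that[OF orth, of J])
    show "J \<subseteq> Basis" by (auto simp: J_def)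
    show "card J = DIM('a) - dim V" using \<open>card J = card B\<close> B dimW by simp
    show "h b \<in> V" if "b \<in> Basis - J" for b using that im A(1) by (auto simp: J_def)
    show "h b \<bullet> y = 0" if "b \<in> J" "y \<in> V" for b y using that B(1) VW by (auto simp: J_def)
  qed
qed


section \<open>Gaussian measure and the law of a residual\<close>

lemma sets_gauss [simp, measurable_cong]: "sets gauss = sets borel"
  and space_gauss [simp]: "space gauss = UNIV"
  by (simp_all add: gauss_def)

lemma sigma_finite_gauss: "sigma_finite_measure gauss"
  unfolding gauss_def
  by (subst sigma_finite_measure.sigma_finite_iff_density_finite) (auto intro: lborel.sigma_finite_measure_axioms)

interpretation gauss_PiM: product_sigma_finite "\<lambda>_. gauss"
  by (rule product_sigma_finite.intro) (rule sigma_finite_gauss)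

text \<open>The projection of a Gaussian vector to the orthogonal complement of a fixed subspace is again Gaussian,
  so the squared cosine of its angle with a fixed vector of the complement is Beta distributed.\<close>

lemma gauss_residual_law:
  fixes j :: nat
  assumes j: "j + 2 \<le> CARD('m :: finite)"
  shows "\<exists>K>0. \<forall>(v :: nat \<Rightarrow> real ^ 'm) q (\<Phi> :: real \<Rightarrow> ennreal).
      \<Phi> \<in> borel_measurable borel \<longrightarrow> (\<forall>i<j. gs_residual v i (v i) \<noteq> 0) \<longrightarrow> (\<forall>y\<in>span (v ` {..<j}). q \<bullet> y = 0) \<longrightarrow>
      (\<integral>\<^sup>+x. (if gs_residual v j x \<noteq> 0
          then \<Phi> ((norm q)\<^sup>2 - (q \<bullet> gs_residual v j x)\<^sup>2 / (norm (gs_residual v j x))\<^sup>2) else 0) \<partial>gauss)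
      = ennreal K * (\<integral>\<^sup>+y\<in>{0<..<1}. \<Phi> ((norm q)\<^sup>2 * y)
            * ennreal (y powr ((real CARD('m) - real j - 1) / 2 - 1) * (1 - y) powr (1 / 2 - 1)) \<partial>lborel)"
proof -
  define d where "d = CARD('m) - j"
  have d: "d \<ge> 2" "real d = real CARD('m) - real j" using j by (auto simp: d_def)
  obtain c1 where c1: "c1 > 0" "(\<integral>\<^sup>+z\<in>{0<..}. ennreal (exp (- z / 2) * z powr (real d / 2 - 1)) \<partial>lborel) = ennreal c1"
    using nn_integral_exp_powr_finite[of "real d / 2"] d by auto
  \<comment> \<open>\<open>c2\<close> is the Gaussian mass of the j coordinates inside the span. For
    j = 0 it comes from the empty product, because the radial formula requires a nonempty index
    set.\<close>
  obtain c2 where c2: "c2 > 0" "\<And>I :: (real ^ 'm) set. finite I \<Longrightarrow> card I = j \<Longrightarrow>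
      (\<integral>\<^sup>+y. ennreal (exp (- (\<Sum>b\<in>I. (y b)\<^sup>2) / 2)) \<partial>PiM I (\<lambda>_. lborel)) = ennreal c2"
  proof (cases "j = 0")
    case True
    show ?thesis
    proof (rule that[of 1])
      fix I :: "(real ^ 'm) set" assume "finite I" "card I = j"
      then have "I = {}" using True by auto
      then show "(\<integral>\<^sup>+y. ennreal (exp (- (\<Sum>b\<in>I. (y b)\<^sup>2) / 2)) \<partial>PiM I (\<lambda>_. lborel)) = ennreal 1"
        by (simp add: PiM_empty)
    qed simp
  next
    case False
    then obtain c where c: "c > 0" "(\<integral>\<^sup>+z\<in>{0<..}. ennreal (exp (- z / 2) * z powr (real j / 2 - 1)) \<partial>lborel)
        = ennreal c"
      using nn_integral_exp_powr_finite[of "real j / 2"] by auto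
    show ?thesis
    proof (rule that[of "radial_const j * c"])
      show "radial_const j * c > 0" using c radial_const_pos by simp
      fix I :: "(real ^ 'm) set" assume I: "finite I" "card I = j"
      then have "I \<noteq> {}" using False by auto
      from nn_integral_PiM_radial[OF I(1) this, of "\<lambda>z. ennreal (exp (- z / 2))"]
      show "(\<integral>\<^sup>+y. ennreal (exp (- (\<Sum>b\<in>I. (y b)\<^sup>2) / 2)) \<partial>PiM I (\<lambda>_. lborel)) = ennreal (radial_const j * c)"
        using I c radial_const_pos[of j] by (simp add: ennreal_mult[symmetric])
    qed
  qed
  \<comment> \<open>The constant depends only on j and the dimension; being chosen before v and q,
    it can later leave the integral over the earlier vectors.\<close>
  define K where "K = c2 * (radial_const (d - 1) * c1)"
  show ?thesis
  proof (intro exI[of _ K] conjI allI impI)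
    show "K > 0" using c1 c2 radial_const_pos by (simp add: K_def)
    fix v :: "nat \<Rightarrow> real ^ 'm" and q :: "real ^ 'm" and \<Phi> :: "real \<Rightarrow> ennreal"
    assume [measurable]: "\<Phi> \<in> borel_measurable borel" and nz: "\<forall>i<j. gs_residual v i (v i) \<noteq> 0"
      and q: "\<forall>y\<in>span (v ` {..<j}). q \<bullet> y = 0"
    define V where "V = span (v ` {..<j})"
    have dimV: "dim V = j" using dim_span_gs_residual[of v j] nz by (simp add: V_def)
    obtain h :: "real ^ 'm \<Rightarrow> real ^ 'm" and J where h: "orthonormal_on Basis h" and J: "J \<subseteq> Basis" "card J
        = CARD('m) - j"
      and hV: "\<And>b. b \<in> Basis - J \<Longrightarrow> h b \<in> V" and hJ: "\<And>b y. b \<in> J \<Longrightarrow> y \<in> V \<Longrightarrow> h b \<bullet> y = 0"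
      using orthonormal_basis_adapted[of V] dimV unfolding V_def by auto
    define J' where "J' = Basis - J"
    have fin: "finite J" "finite J'" using finite_subset[OF J(1) finite_Basis] by (auto simp: J'_def)
    have B: "(Basis :: (real ^ 'm) set) = J' \<union> J" and disj: "J' \<inter> J = {}" using J by (auto simp: J'_def)
    have cJ: "card J = d" "card J' = j"
      using J j fin card_Diff_subset[of J Basis] by (auto simp: d_def J'_def)
    have oJ: "orthonormal_on J h" using h J(1) unfolding orthonormal_on_def by blast
    have split: "(\<Sum>b\<in>Basis. f b) = (\<Sum>b\<in>J'. f b) + (\<Sum>b\<in>J. f b)" for f :: "_ \<Rightarrow> 'z :: comm_monoid_add"
      unfolding B using fin disj by (intro sum.union_disjoint) auto
    have res: "gs_residual v j (\<Sum>b\<in>Basis. y b *\<^sub>R h b) = (\<Sum>b\<in>J. y b *\<^sub>R h b)" for y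
    proof (rule gs_residual_unique)
      show "(\<Sum>b\<in>Basis. y b *\<^sub>R h b) - (\<Sum>b\<in>J. y b *\<^sub>R h b) \<in> span (v ` {..<j})"
        unfolding split using hV by (auto simp: J'_def V_def intro!: span_sum span_scale)
      show "(\<Sum>b\<in>J. y b *\<^sub>R h b) \<bullet> z = 0" if "z \<in> span (v ` {..<j})" for z
        using hJ that by (simp add: inner_sum_left V_def)
    qed
    have normq: "(\<Sum>b\<in>J. (q \<bullet> h b)\<^sup>2) = (norm q)\<^sup>2"
    proof -
      have sp: "(\<Sum>b\<in>Basis. (q \<bullet> h b) *\<^sub>R h b) = q"
        by (rule orthonormal_Basis_expansion[OF h])
      have "(norm q)\<^sup>2 = (\<Sum>b\<in>Basis. (q \<bullet> h b)\<^sup>2)"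
        using orthonormal_on_norm[OF h finite_Basis, of "\<lambda>b. q \<bullet> h b"] sp by simp
      also have "\<dots> = (\<Sum>b\<in>J. (q \<bullet> h b)\<^sup>2)"
        unfolding split using hV q by (simp add: J'_def V_def)
      finally show ?thesis by simp
    qed
    \<comment> \<open>The first argument is the squared norm of the residual, which carries the
      remaining Gaussian factor; the second is the squared length of the projection of q onto the
      residual.\<close>
    define G where "G = (\<lambda>(\<rho>, s). ennreal (exp (- \<rho> / 2)) * (if \<rho> \<noteq> 0 then \<Phi> ((norm q)\<^sup>2 - s) else 0))"
    have mG[measurable]: "G \<in> borel_measurable (borel \<Otimes>\<^sub>M borel)" unfolding G_def by measurable
    have mg[measurable]: "(\<lambda>x. gs_residual v j x) \<in> borel_measurable borel" by measurable
    have "(\<integral>\<^sup>+x. (if gs_residual v j x \<noteq> 0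
          then \<Phi> ((norm q)\<^sup>2 - (q \<bullet> gs_residual v j x)\<^sup>2 / (norm (gs_residual v j x))\<^sup>2) else 0) \<partial>gauss)
       = (\<integral>\<^sup>+x. ennreal (exp (- (norm x)\<^sup>2 / 2)) * (if gs_residual v j x \<noteq> 0
          then \<Phi> ((norm q)\<^sup>2 - (q \<bullet> gs_residual v j x)\<^sup>2 / (norm (gs_residual v j x))\<^sup>2) else 0) \<partial>lborel)"
      unfolding gauss_def by (rule nn_integral_density) measurable
    also have "\<dots> = (\<integral>\<^sup>+y. ennreal (exp (- (\<Sum>b\<in>J'. (y b)\<^sup>2) / 2)) *
         G (\<Sum>b\<in>J. (y b)\<^sup>2, (\<Sum>b\<in>J. (q \<bullet> h b) * y b)\<^sup>2 / (\<Sum>b\<in>J. (y b)\<^sup>2)) \<partial>PiM Basis (\<lambda>_. lborel))"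
      (is "_ = (\<integral>\<^sup>+y. ?F y \<partial>_)")
    proof (subst nn_integral_lborel_orthonormal[OF _ h], measurable, rule nn_integral_cong, goal_cases)
      case (1 y)
      have n: "(norm (\<Sum>b\<in>J. y b *\<^sub>R h b))\<^sup>2 = (\<Sum>b\<in>J. (y b)\<^sup>2)" by (rule orthonormal_on_norm[OF oJ fin(1)])
      have z: "(\<Sum>b\<in>J. y b *\<^sub>R h b) = 0 \<longleftrightarrow> (\<Sum>b\<in>J. (y b)\<^sup>2) = 0"
        unfolding n[symmetric] by simp
      have ip: "q \<bullet> (\<Sum>b\<in>J. y b *\<^sub>R h b) = (\<Sum>b\<in>J. (q \<bullet> h b) * y b)"
        by (simp add: inner_sum_right mult.commute)
      have e: "exp (- (norm (\<Sum>b\<in>Basis. y b *\<^sub>R h b))\<^sup>2 / 2) = exp (- (\<Sum>b\<in>J'. (y b)\<^sup>2) / 2) * exp (- (\<Sum>b\<in>J. (y b)\<^sup>2) / 2)"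
        unfolding trans[OF orthonormal_on_norm[OF h finite_Basis, of y] split] mult_exp_exp
        by (simp add: add_divide_distrib)
      show ?case unfolding res e G_def n z ip prod.case by (simp only: ennreal_mult'[OF exp_ge_zero] mult.assoc
          if_not_P if_True cong: if_cong)
    qed
    also have "\<dots> = (\<integral>\<^sup>+x. (\<integral>\<^sup>+y. ?F (merge J' J (x, y)) \<partial>PiM J (\<lambda>_. lborel)) \<partial>PiM J' (\<lambda>_. lborel))"
      unfolding B by (rule lborel_PiM.product_nn_integral_fold[OF disj fin(2,1)]) measurable
    also have "\<dots> = (\<integral>\<^sup>+x. (\<integral>\<^sup>+y. ennreal (exp (- (\<Sum>b\<in>J'. (x b)\<^sup>2) / 2)) *
         G (\<Sum>b\<in>J. (y b)\<^sup>2, (\<Sum>b\<in>J. (q \<bullet> h b) * y b)\<^sup>2 / (\<Sum>b\<in>J. (y b)\<^sup>2)) \<partial>PiM J (\<lambda>_. lborel)) \<partial>PiM J' (\<lambda>_. lborel))"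
    proof (intro nn_integral_cong, goal_cases)
      case (1 x y)
      have "(\<Sum>b\<in>J'. (merge J' J (x, y) b)\<^sup>2) = (\<Sum>b\<in>J'. (x b)\<^sup>2)" "(\<Sum>b\<in>J. (merge J' J (x, y) b)\<^sup>2) = (\<Sum>b\<in>J. (y b)\<^sup>2)"
        "(\<Sum>b\<in>J. (q \<bullet> h b) * merge J' J (x, y) b) = (\<Sum>b\<in>J. (q \<bullet> h b) * y b)"
        using disj by (auto intro!: sum.cong simp: merge_def)
      then show ?case by simp
    qed
    also have "\<dots> = (\<integral>\<^sup>+x. ennreal (exp (- (\<Sum>b\<in>J'. (x b)\<^sup>2) / 2)) \<partial>PiM J' (\<lambda>_. lborel)) *
      (\<integral>\<^sup>+y. G (\<Sum>b\<in>J. (y b)\<^sup>2, (\<Sum>b\<in>J. (q \<bullet> h b) * y b)\<^sup>2 / (\<Sum>b\<in>J. (y b)\<^sup>2)) \<partial>PiM J (\<lambda>_. lborel))"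
      by (subst nn_integral_cmult, measurable, rule nn_integral_multc) measurable
    also have "(\<integral>\<^sup>+x. ennreal (exp (- (\<Sum>b\<in>J'. (x b)\<^sup>2) / 2)) \<partial>PiM J' (\<lambda>_. lborel)) = ennreal c2"
      by (rule c2) (use fin cJ in auto)
    also have "(\<integral>\<^sup>+y. G (\<Sum>b\<in>J. (y b)\<^sup>2, (\<Sum>b\<in>J. (q \<bullet> h b) * y b)\<^sup>2 / (\<Sum>b\<in>J. (y b)\<^sup>2)) \<partial>PiM J (\<lambda>_. lborel))
      = ennreal (radial_const (d - 1)) * (\<integral>\<^sup>+\<rho>\<in>{0<..}. (\<integral>\<^sup>+\<sigma>\<in>{0<..<1}. G (\<rho>, (norm q)\<^sup>2 * \<sigma>)
            * ennreal (\<rho> powr (real d / 2 - 1) * (\<sigma> powr (1 / 2 - 1) * (1 - \<sigma>) powr ((real d - 1) / 2 - 1))) \<partial>lborel)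
                \<partial>lborel)"
      using nn_integral_PiM_direction[OF fin(1) _ mG normq] cJ d by simp
    also have "(\<integral>\<^sup>+\<rho>\<in>{0<..}. (\<integral>\<^sup>+\<sigma>\<in>{0<..<1}. G (\<rho>, (norm q)\<^sup>2 * \<sigma>)
            * ennreal (\<rho> powr (real d / 2 - 1) * (\<sigma> powr (1 / 2 - 1) * (1 - \<sigma>) powr ((real d - 1) / 2 - 1))) \<partial>lborel)
                \<partial>lborel)
      = (\<integral>\<^sup>+\<rho>\<in>{0<..}. ennreal (exp (- \<rho> / 2) * \<rho> powr (real d / 2 - 1)) * 
          (\<integral>\<^sup>+\<sigma>\<in>{0<..<1}. \<Phi> ((norm q)\<^sup>2 - (norm q)\<^sup>2 * \<sigma>)
            * ennreal (\<sigma> powr (1 / 2 - 1) * (1 - \<sigma>) powr ((real d - 1) / 2 - 1)) \<partial>lborel) \<partial>lborel)"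
    proof (rule nn_integral_cong, goal_cases)
      case (1 \<rho>)
      show ?case
        by (subst nn_integral_cmult[symmetric], measurable)
           (auto simp: indicator_def G_def ennreal_mult mult_ac intro!: nn_integral_cong)
    qed
    also have "\<dots> = ennreal c1 * (\<integral>\<^sup>+\<sigma>\<in>{0<..<1}. \<Phi> ((norm q)\<^sup>2 - (norm q)\<^sup>2 * \<sigma>)
            * ennreal (\<sigma> powr (1 / 2 - 1) * (1 - \<sigma>) powr ((real d - 1) / 2 - 1)) \<partial>lborel)"
      unfolding c1(2)[symmetric] by (subst nn_integral_multc[symmetric], measurable) (simp add: mult_ac)
    \<comment> \<open>The reflection y = 1 - sigma exchanges the Beta parameters: the component of q
      that survives has squared length |q|^2 (1 - sigma).\<close>
    also have "(\<integral>\<^sup>+\<sigma>\<in>{0<..<1}. \<Phi> ((norm q)\<^sup>2 - (norm q)\<^sup>2 * \<sigma>)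
            * ennreal (\<sigma> powr (1 / 2 - 1) * (1 - \<sigma>) powr ((real d - 1) / 2 - 1)) \<partial>lborel)
       = (\<integral>\<^sup>+y\<in>{0<..<1}. \<Phi> ((norm q)\<^sup>2 * y)
            * ennreal (y powr ((real d - 1) / 2 - 1) * (1 - y) powr (1 / 2 - 1)) \<partial>lborel)"
      by (subst nn_integral_real_affine[where c="-1" and t=1])
         (auto simp: indicator_def algebra_simps intro!: nn_integral_cong)
    finally show "(\<integral>\<^sup>+x. (if gs_residual v j x \<noteq> 0
          then \<Phi> ((norm q)\<^sup>2 - (q \<bullet> gs_residual v j x)\<^sup>2 / (norm (gs_residual v j x))\<^sup>2) else 0) \<partial>gauss)
      = ennreal K * (\<integral>\<^sup>+y\<in>{0<..<1}. \<Phi> ((norm q)\<^sup>2 * y)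
            * ennreal (y powr ((real CARD('m) - real j - 1) / 2 - 1) * (1 - y) powr (1 / 2 - 1)) \<partial>lborel)"
      using d c1 c2 radial_const_pos[of "d - 1"] by (simp add: K_def ennreal_mult mult.assoc)
  qed
qed

section \<open>The law of the distance to a random plane\<close>

lemma gs_independent_pred [measurable]:
  assumes "j \<le> l"
  shows "Measurable.pred (PiM {..<l} (\<lambda>_. gauss :: (real ^ 'm :: finite) measure)) (\<lambda>v. \<forall>i<j. gs_residual v i (v i) \<noteq>
      0)"
proof (intro pred_intros_countable, goal_cases)
  case (1 i)
  show ?case
  proof (cases "i < j")
    case True
    have [measurable]: "(\<lambda>v. v i') \<in> borel_measurable (PiM {..<l} (\<lambda>_. gauss :: (real ^ 'm) measure))" if "i' \<le> i"
        for i'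
      using measurable_component_singleton[of i' "{..<l}" "\<lambda>_. gauss :: (real ^ 'm) measure"] that True assms by simp
    have [measurable]: "(\<lambda>v. gs_residual v i (v i)) \<in> borel_measurable (PiM {..<l} (\<lambda>_. gauss :: (real ^ 'm)
        measure))"
      by (rule gs_residual_measurable) measurable
    show ?thesis using True by simp
  qed simp
qed

lemma gs_residual_measurable_PiM:
  assumes "j \<le> l"
  shows "(\<lambda>v. gs_residual v j e) \<in> borel_measurable (PiM {..<l} (\<lambda>_. gauss :: (real ^ 'm :: finite) measure))"
proof (rule gs_residual_measurable)
  show "(\<lambda>v. v i) \<in> borel_measurable (PiM {..<l} (\<lambda>_. gauss :: (real ^ 'm) measure))" if "i < j" for i
    using measurable_component_singleton[of i "{..<l}" "\<lambda>_. gauss :: (real ^ 'm) measure"] that assms by simp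
qed simp

text \<open>Each new vector multiplies the squared residual norm w = 1 - tau by an independent Beta
  variable, and these products stay within the Beta family. The induction starts at j = 1: for j = 0
  the law is a point mass at 1 and has no density.\<close>

lemma gauss_distance_law_ex:
  fixes e :: "real ^ 'm :: finite"
  assumes e: "norm e = 1" and "1 \<le> j" "j + 1 \<le> CARD('m)"
  shows "\<exists>C>0. \<forall>\<Phi>\<in>borel_measurable borel.
     (\<integral>\<^sup>+v. (if \<forall>i<j. gs_residual v i (v i) \<noteq> 0 then \<Phi> ((norm (gs_residual v j e))\<^sup>2) else 0) \<partial>PiM {..<j} (\<lambda>_. gauss))
     = ennreal C * (\<integral>\<^sup>+w\<in>{0<..<1}. \<Phi> w * ennreal (w powr ((real CARD('m) - real j) / 2 - 1) * (1 - w) powr (real j / 2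
         - 1)) \<partial>lborel)"
proof -
  \<comment> \<open>Integrate out the last vector with the earlier ones fixed. The role of q is
    played by the current residual of e, and \<open>norm_gs_residual_Suc\<close> expresses the next
    residual norm through it.\<close>
  have step: "\<exists>K>0. \<forall>\<Phi>\<in>borel_measurable borel.
     (\<integral>\<^sup>+v. (if \<forall>i<Suc j. gs_residual v i (v i) \<noteq> 0 then \<Phi> ((norm (gs_residual v (Suc j) e))\<^sup>2) else 0) \<partial>PiM {..<Suc j}
         (\<lambda>_. gauss))
     = ennreal K * (\<integral>\<^sup>+v. (if \<forall>i<j. gs_residual v i (v i) \<noteq> 0 then
          (\<integral>\<^sup>+y\<in>{0<..<1}. \<Phi> ((norm (gs_residual v j e))\<^sup>2 * y)
            * ennreal (y powr ((real CARD('m) - real j - 1) / 2 - 1) * (1 - y) powr (1 / 2 - 1)) \<partial>lborel) else 0) \<partial>PiM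
                {..<j} (\<lambda>_. gauss))"
    if j: "j + 2 \<le> CARD('m)" for j
  proof -
    obtain K where K: "K > 0" "\<forall>(v :: nat \<Rightarrow> real ^ 'm) q (\<Phi> :: real \<Rightarrow> ennreal).
      \<Phi> \<in> borel_measurable borel \<longrightarrow> (\<forall>i<j. gs_residual v i (v i) \<noteq> 0) \<longrightarrow> (\<forall>y\<in>span (v ` {..<j}). q \<bullet> y = 0) \<longrightarrow>
      (\<integral>\<^sup>+x. (if gs_residual v j x \<noteq> 0
          then \<Phi> ((norm q)\<^sup>2 - (q \<bullet> gs_residual v j x)\<^sup>2 / (norm (gs_residual v j x))\<^sup>2) else 0) \<partial>gauss)
      = ennreal K * (\<integral>\<^sup>+y\<in>{0<..<1}. \<Phi> ((norm q)\<^sup>2 * y)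
            * ennreal (y powr ((real CARD('m) - real j - 1) / 2 - 1) * (1 - y) powr (1 / 2 - 1)) \<partial>lborel)"
      using gauss_residual_law[OF j] by blast
    show ?thesis
    proof (intro exI[of _ K] conjI ballI)
      fix \<Phi> :: "real \<Rightarrow> ennreal" assume \<Phi>[measurable]: "\<Phi> \<in> borel_measurable borel"
      let ?F = "\<lambda>v. if \<forall>i<Suc j. gs_residual v i (v i) \<noteq> 0 then \<Phi> ((norm (gs_residual v (Suc j) e))\<^sup>2) else 0"
      have [measurable]: "Measurable.pred (PiM {..<l} (\<lambda>_. gauss :: (real ^ 'm) measure)) (\<lambda>v. \<forall>i<l. gs_residual v i
          (v i) \<noteq> 0)"
        "(\<lambda>v. gs_residual v l e) \<in> borel_measurable (PiM {..<l} (\<lambda>_. gauss :: (real ^ 'm) measure))" for l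
        by (auto intro: gs_independent_pred gs_residual_measurable_PiM)
      have mF: "?F \<in> borel_measurable (PiM (insert j {..<j}) (\<lambda>_. gauss))"
        unfolding lessThan_Suc[symmetric] by measurable
      have "(\<integral>\<^sup>+v. ?F v \<partial>PiM {..<Suc j} (\<lambda>_. gauss)) = (\<integral>\<^sup>+v. (\<integral>\<^sup>+x. ?F (v(j := x)) \<partial>gauss) \<partial>PiM {..<j} (\<lambda>_. gauss))"
        unfolding lessThan_Suc by (rule gauss_PiM.product_nn_integral_insert[OF _ _ mF]) auto
      also have "\<dots> = (\<integral>\<^sup>+v. ennreal K * (if \<forall>i<j. gs_residual v i (v i) \<noteq> 0 then
          (\<integral>\<^sup>+y\<in>{0<..<1}. \<Phi> ((norm (gs_residual v j e))\<^sup>2 * y)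
            * ennreal (y powr ((real CARD('m) - real j - 1) / 2 - 1) * (1 - y) powr (1 / 2 - 1)) \<partial>lborel) else 0) \<partial>PiM
                {..<j} (\<lambda>_. gauss))"
      proof (rule nn_integral_cong, goal_cases)
        case (1 v)
        have c: "gs_residual (v(j := x)) i y = gs_residual v i y" if "i \<le> j" for i x y
          using that by (intro gs_residual_cong) auto
        have F: "?F (v(j := x)) = (if (\<forall>i<j. gs_residual v i (v i) \<noteq> 0) \<and> gs_residual v j x \<noteq> 0 then
           \<Phi> ((norm (gs_residual v j e))\<^sup>2 - (gs_residual v j e \<bullet> gs_residual v j x)\<^sup>2 / (norm (gs_residual v j x))\<^sup>2)
               else 0)" for x
          unfolding norm_gs_residual_Suc by (auto simp: less_Suc_eq c)
        show ?case
        proof (cases "\<forall>i<j. gs_residual v i (v i) \<noteq> 0")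
          case True
          then show ?thesis unfolding F using K(2)[rule_format, OF \<Phi> True[rule_format] gs_residual_orth] by simp
        next
          case False
          then have "(\<forall>i<j. gs_residual v i (v i) \<noteq> 0) = False" by blast
          then show ?thesis unfolding F by (simp only: simp_thms if_False nn_integral_const mult_zero_left
              mult_zero_right)
        qed
      qed
      also have "\<dots> = ennreal K * (\<integral>\<^sup>+v. (if \<forall>i<j. gs_residual v i (v i) \<noteq> 0 then
          (\<integral>\<^sup>+y\<in>{0<..<1}. \<Phi> ((norm (gs_residual v j e))\<^sup>2 * y)
            * ennreal (y powr ((real CARD('m) - real j - 1) / 2 - 1) * (1 - y) powr (1 / 2 - 1)) \<partial>lborel) else 0) \<partial>PiM
                {..<j} (\<lambda>_. gauss))"
      proof (rule nn_integral_cmult)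
        have [measurable]: "(\<lambda>x. \<integral>\<^sup>+y\<in>{0<..<1}. \<Phi> (x * y)
            * ennreal (y powr ((real CARD('m) - real j - 1) / 2 - 1) * (1 - y) powr (1 / 2 - 1)) \<partial>lborel) \<in>
                borel_measurable borel"
          by measurable
        show "(\<lambda>v. if \<forall>i<j. gs_residual v i (v i) \<noteq> 0 then
          (\<integral>\<^sup>+y\<in>{0<..<1}. \<Phi> ((norm (gs_residual v j e))\<^sup>2 * y)
            * ennreal (y powr ((real CARD('m) - real j - 1) / 2 - 1) * (1 - y) powr (1 / 2 - 1)) \<partial>lborel) else 0)
          \<in> borel_measurable (PiM {..<j} (\<lambda>_. gauss))"
          by measurable
      qed
      finally show "(\<integral>\<^sup>+v. ?F v \<partial>PiM {..<Suc j} (\<lambda>_. gauss)) = \<dots>" .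
    qed (rule K)
  qed
  show ?thesis using assms(2,3)
  proof (induction j rule: nat_induct_at_least)
    case base
    obtain K where K: "K > 0" "\<forall>\<Phi>\<in>borel_measurable borel.
     (\<integral>\<^sup>+v. (if \<forall>i<Suc 0. gs_residual v i (v i) \<noteq> 0 then \<Phi> ((norm (gs_residual v (Suc 0) e))\<^sup>2) else 0) \<partial>PiM {..<Suc 0}
         (\<lambda>_. gauss))
     = ennreal K * (\<integral>\<^sup>+v. (if \<forall>i<0. gs_residual v i (v i) \<noteq> 0 then
          (\<integral>\<^sup>+y\<in>{0<..<1}. \<Phi> ((norm (gs_residual v 0 e))\<^sup>2 * y)
            * ennreal (y powr ((real CARD('m) - real 0 - 1) / 2 - 1) * (1 - y) powr (1 / 2 - 1)) \<partial>lborel) else 0) \<partial>PiM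
                {..<0} (\<lambda>_. gauss))"
      using step[of 0] base by auto
    show ?case
      by (rule exI[of _ K]) (use K e in \<open>auto simp: PiM_empty cong: if_cong\<close>)
  next
    case (Suc j)
    then obtain C where C: "C > 0" "\<forall>\<Phi>\<in>borel_measurable borel.
     (\<integral>\<^sup>+v. (if \<forall>i<j. gs_residual v i (v i) \<noteq> 0 then \<Phi> ((norm (gs_residual v j e))\<^sup>2) else 0) \<partial>PiM {..<j} (\<lambda>_. gauss))
     = ennreal C * (\<integral>\<^sup>+w\<in>{0<..<1}. \<Phi> w * ennreal (w powr ((real CARD('m) - real j) / 2 - 1) * (1 - w) powr (real j / 2
         - 1)) \<partial>lborel)"
      by auto
    obtain K where K: "K > 0" "\<forall>\<Phi>\<in>borel_measurable borel.
     (\<integral>\<^sup>+v. (if \<forall>i<Suc j. gs_residual v i (v i) \<noteq> 0 then \<Phi> ((norm (gs_residual v (Suc j) e))\<^sup>2) else 0) \<partial>PiM {..<Suc j}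
         (\<lambda>_. gauss))
     = ennreal K * (\<integral>\<^sup>+v. (if \<forall>i<j. gs_residual v i (v i) \<noteq> 0 then
          (\<integral>\<^sup>+y\<in>{0<..<1}. \<Phi> ((norm (gs_residual v j e))\<^sup>2 * y)
            * ennreal (y powr ((real CARD('m) - real j - 1) / 2 - 1) * (1 - y) powr (1 / 2 - 1)) \<partial>lborel) else 0) \<partial>PiM
                {..<j} (\<lambda>_. gauss))"
      using step[of j] Suc.prems by auto
    define B where "B = K * (C * Beta (1 / 2) (real j / 2))"
    have beta: "Beta (1 / 2) (real j / 2) > 0" using Suc.hyps by (intro Beta_real_pos) auto
    show ?case
    proof (intro exI[of _ B] conjI ballI)
      show "B > 0" using K C beta by (simp add: B_def)
      fix \<Phi> :: "real \<Rightarrow> ennreal" assume \<Phi>[measurable]: "\<Phi> \<in> borel_measurable borel"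
      let ?c = "(real CARD('m) - real j - 1) / 2"
      \<comment> \<open>The first identity is the parameter match C + D of
        \<open>nn_integral_beta_product\<close> with C = \<open>?c\<close> and D = 1/2; the other
        two bring its output into the form of the claim for \<open>Suc j\<close>.\<close>
      have ex: "(real CARD('m) - real j) / 2 = ?c + 1 / 2" "1 / 2 + real j / 2 = real (Suc j) / 2"
        "?c = (real CARD('m) - real (Suc j)) / 2" by (auto simp: field_simps)
      have "(\<integral>\<^sup>+v. (if \<forall>i<j. gs_residual v i (v i) \<noteq> 0 then
          (\<integral>\<^sup>+y\<in>{0<..<1}. \<Phi> ((norm (gs_residual v j e))\<^sup>2 * y) * ennreal (y powr (?c - 1) * (1 - y) powr (1 / 2 - 1))
              \<partial>lborel) else 0) \<partial>PiM {..<j} (\<lambda>_. gauss))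
        = ennreal C * (\<integral>\<^sup>+x\<in>{0<..<1}. (\<integral>\<^sup>+y\<in>{0<..<1}. \<Phi> (x * y) * ennreal (y powr (?c - 1) * (1 - y) powr (1 / 2 - 1))
            \<partial>lborel)
           * ennreal (x powr (?c + 1 / 2 - 1) * (1 - x) powr (real j / 2 - 1)) \<partial>lborel)"
        unfolding ex(1)[symmetric] by (rule C(2)[rule_format]) measurable
      also have "\<dots> = ennreal C * (ennreal (Beta (1 / 2) (real j / 2)) * (\<integral>\<^sup>+w\<in>{0<..<1}. \<Phi> w * ennreal (w powr (?c - 1)
          * (1 - w) powr (1 / 2 + real j / 2 - 1)) \<partial>lborel))"
        by (subst nn_integral_beta_product) (use Suc.hyps in auto)
      finally show "(\<integral>\<^sup>+v. (if \<forall>i<Suc j. gs_residual v i (v i) \<noteq> 0 then \<Phi> ((norm (gs_residual v (Suc j) e))\<^sup>2) else 0)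
          \<partial>PiM {..<Suc j} (\<lambda>_. gauss))
        = ennreal B * (\<integral>\<^sup>+w\<in>{0<..<1}. \<Phi> w * ennreal (w powr ((real CARD('m) - real (Suc j)) / 2 - 1) * (1 - w) powr
            (real (Suc j) / 2 - 1)) \<partial>lborel)"
        unfolding K(2)[rule_format, OF \<Phi>] using K C beta unfolding ex(2,3) B_def
            by (simp add: ennreal_mult mult.assoc)
    qed
  qed
qed


section \<open>Distance and Radon transform along a fixed plane\<close>

lemma onb_exists:
  fixes V :: "(real ^ 'm :: finite) set"
  assumes V: "subspace V" "dim V = k + 1"
  shows "orthonormal_on {..k} (onb k V)" "span (onb k V ` {..k}) = V"
proof -
  obtain B where B: "B \<subseteq> V" "pairwise orthogonal B" "\<And>x. x \<in> B \<Longrightarrow> norm x = 1" "independent B" "card B = dim V" "span B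
      = V"
    using orthonormal_basis_subspace[OF V(1)] by metis
  have fin: "finite B" using B by (auto intro: independent_imp_finite)
  have "card {..k} = card B" using B V by simp
  then obtain b where b: "bij_betw b {..k} B" using finite_same_card_bij[of "{..k}" B] fin by auto
  then have im: "b ` {..k} = B" and inj: "inj_on b {..k}" by (auto simp: bij_betw_def)
  have "b i \<bullet> b j = (if i = j then 1 else 0)" if "i \<le> k" "j \<le> k" for i j
  proof (cases "i = j")
    case True
    then show ?thesis using im that B(3) by (auto simp: norm_eq_1)
  next
    case False
    then have "b i \<noteq> b j" using inj that by (auto simp: inj_on_def)
    then show ?thesis using False im that B(2) unfolding pairwise_def orthogonal_def by auto
  qed
  then have "\<exists>b. (\<forall>i\<le>k. \<forall>j\<le>k. b i \<bullet> b j = (if i = j then 1 else 0)) \<and> span (b ` {..k}) = V"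
    using B(6) im by (intro exI[of _ b]) simp
  from someI_ex[OF this] show "orthonormal_on {..k} (onb k V)" "span (onb k V ` {..k}) = V"
    unfolding onb_def orthonormal_on_def by auto
qed

text \<open>The sum is the squared length of the projection of the axis vector to the plane, hence
  the same for every orthonormal basis. This makes the arbitrary choice in \<open>onb\<close>
  harmless.\<close>

lemma sum_onb_squares:
  fixes v :: "nat \<Rightarrow> real ^ 'm :: finite"
  assumes V: "dim (span (v ` {..k})) = k + 1"
  shows "(\<Sum>i\<le>k. (onb k (span (v ` {..k})) i $ a)\<^sup>2) = 1 - (norm (gs_residual v (k + 1) (axis a 1)))\<^sup>2"
proof -
  let ?V = "span (v ` {..k})" and ?e = "axis a 1 :: real ^ 'm"
  define b where "b = onb k ?V"
  have b: "orthonormal_on {..k} b" "span (b ` {..k}) = ?V"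
    using onb_exists[of ?V k] V by (auto simp: b_def)
  have Veq: "v ` {..<k + 1} = v ` {..k}" by (simp add: lessThan_Suc_atMost)
  define y where "y = (\<Sum>i\<le>k. (?e \<bullet> b i) *\<^sub>R b i)"
  have yV: "y \<in> ?V" unfolding y_def b(2)[symmetric] by (intro span_sum span_scale span_base) auto
  have "(?e - y) \<bullet> b i = 0" if "i \<le> k" for i
    using orthonormal_on_inner[OF b(1), of i] that by (simp add: y_def inner_diff_left)
  then have "b ` {..k} \<subseteq> {z. (?e - y) \<bullet> z = 0}" by auto
  from span_minimal[OF this subspace_hyperplane] have orth: "(?e - y) \<bullet> z = 0" if "z \<in> ?V" for z
    using that b(2) by auto
  have "gs_residual v (k + 1) ?e = ?e - y"
    by (rule gs_residual_unique) (use yV orth Veq in auto)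
  moreover have "(norm ?e)\<^sup>2 = (norm y)\<^sup>2 + (norm (?e - y))\<^sup>2"
    using orth[OF yV] by (simp add: power2_norm_eq_inner inner_diff_left inner_diff_right inner_commute)
  moreover have "(norm y)\<^sup>2 = (\<Sum>i\<le>k. (?e \<bullet> b i)\<^sup>2)"
    unfolding y_def using b(1) by (rule orthonormal_on_norm) simp
  moreover have "(?e \<bullet> b i)\<^sup>2 = (b i $ a)\<^sup>2" for i by (simp add: inner_commute[of ?e] inner_axis)
  ultimately show ?thesis by (simp add: b_def norm_axis_1 del: gs_residual.simps)
qed

text \<open>With y the projection of the axis vector, every x in the plane satisfies
  \<open>x $ a\<close> = y . x. By Cauchy-Schwarz the largest value on the unit sphere is the norm
  of y, attained at y/|y|; if y = 0, at every unit vector of the plane.\<close>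

lemma xi_dist_span:
  fixes v :: "nat \<Rightarrow> real ^ 'm :: finite"
  assumes V: "dim (span (v ` {..k})) = k + 1"
  shows "xi_dist a (span (v ` {..k})) = arccos (sqrt (1 - (norm (gs_residual v (k + 1) (axis a 1)))\<^sup>2))"
proof -
  let ?V = "span (v ` {..k})" and ?e = "axis a 1 :: real ^ 'm"
  define z where "z = gs_residual v (k + 1) ?e"
  define y where "y = ?e - z"
  have Veq: "v ` {..<k + 1} = v ` {..k}" by (simp add: lessThan_Suc_atMost)
  have yV: "y \<in> ?V" using gs_residual_span[of ?e v "k + 1"] unfolding Veq y_def z_def .
  have orth: "z \<bullet> x = 0" if "x \<in> ?V" for x using gs_residual_orth[of x v "k + 1" ?e] that unfolding Veq z_def .
  have "(norm ?e)\<^sup>2 = (norm y)\<^sup>2 + (norm z)\<^sup>2"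
    using orth[OF yV] by (simp add: y_def power2_norm_eq_inner inner_diff_left inner_diff_right inner_commute)
  then have ny: "norm y = sqrt (1 - (norm z)\<^sup>2)" 
    by (intro real_sqrt_unique[symmetric]) (auto simp: norm_axis_1)
  have ny1: "norm y \<le> 1"
    unfolding ny by simp
  have coord: "x $ a = y \<bullet> x" if "x \<in> ?V" for x
    unfolding y_def inner_diff_left using orth[OF that] by (simp add: inner_axis inner_commute[of "axis a 1"])
  have le: "x $ a \<le> norm y" "\<bar>x $ a\<bar> \<le> 1" if "x \<in> ?V" "norm x = 1" for x
    using coord[OF that(1)] that(2) Cauchy_Schwarz_ineq2[of y x] ny1 by auto
  have "\<exists>x\<in>?V \<inter> sphere 0 1. x $ a = norm y"
  proof (cases "y = 0")
    case True
    have "\<not> ?V \<subseteq> {0}" using V dim_eq_0[of ?V] by linarith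
    then obtain x where x: "x \<in> ?V" "x \<noteq> 0" by blast
    then have "sgn x \<in> ?V \<inter> sphere 0 1" by (auto simp: norm_sgn sgn_div_norm span_scale)
    then show ?thesis using coord[of "sgn x"] True by auto
  next
    case False
    have "sgn y \<in> ?V \<inter> sphere 0 1" using yV False by (auto simp: norm_sgn sgn_div_norm span_scale)
    moreover have "sgn y $ a = norm y"
      using coord[of "sgn y"] calculation False by (simp add: sgn_div_norm power2_norm_eq_inner[symmetric]
          power2_eq_square)
    ultimately show ?thesis by blast
  qed
  then obtain x0 where x0: "x0 \<in> ?V \<inter> sphere 0 1" "x0 $ a = norm y" by auto
  have "xi_dist a ?V = arccos (norm y)"
    unfolding xi_dist_def
  proof (rule cInf_eq_minimum)
    show "arccos (norm y) \<in> sdist a ` (?V \<inter> sphere 0 1)"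
      using x0 by (auto simp: sdist_def intro!: rev_image_eqI[of x0])
    show "arccos (norm y) \<le> s" if "s \<in> sdist a ` (?V \<inter> sphere 0 1)" for s
      using that le ny1 by (auto simp: sdist_def intro!: arccos_le_arccos) (smt (verit) norm_ge_zero)+
  qed
  then show ?thesis by (simp add: ny z_def)
qed

text \<open>The arguments \<open>\<tau>\<close> and \<open>\<tau> \<sigma>\<close> are squared cosines of distances to the origin; in these variables all densities are
  exact products of powers of \<open>\<sigma>\<close> and \<open>1 - \<sigma>\<close>.\<close>

definition radon_profile :: "nat \<Rightarrow> (real \<Rightarrow> real) \<Rightarrow> real \<Rightarrow> ennreal" where
  "radon_profile k F \<tau> = (\<integral>\<^sup>+\<sigma>\<in>{0<..<1}. ennreal \<bar>F (sqrt (\<tau> * \<sigma>))\<bar>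
      * ennreal (\<sigma> powr (1 / 2 - 1) * (1 - \<sigma>) powr (real k / 2 - 1)) \<partial>lborel)"

lemma radon_profile_measurable [measurable]:
  assumes [measurable]: "F \<in> borel_measurable borel"
  shows "radon_profile k F \<in> borel_measurable borel"
  unfolding radon_profile_def by measurable

text \<open>The Beta factor is 2/(k+1), the integral of the radial variable over the unit ball.
  Thus, for k >= 1, (k + 1) times this constant is the area of the unit (k-1)-sphere.\<close>

definition radon_const :: "nat \<Rightarrow> real" where
  "radon_const k = radial_const k * Beta ((real k + 1) / 2) 1"

lemma radon_const_pos: "radon_const k > 0"
  unfolding radon_const_def by (intro mult_pos_pos radial_const_pos Beta_real_pos) auto

lemma nn_integral_unit_ball_direction:
  fixes g :: "real \<Rightarrow> ennreal"
  assumes I: "finite I" "card I = N + 1" "N \<ge> 1" and [measurable]: "g \<in> borel_measurable borel"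
    and c: "(\<Sum>j\<in>I. (c j)\<^sup>2) = \<tau>"
  shows "(\<integral>\<^sup>+y. indicator {\<rho>. 0 < \<rho> \<and> \<rho> \<le> 1} (\<Sum>j\<in>I. (y j)\<^sup>2) * g ((\<Sum>j\<in>I. c j * y j)\<^sup>2 / (\<Sum>j\<in>I. (y j)\<^sup>2)) \<partial>PiM I (\<lambda>_.
      lborel))
    = ennreal (radon_const N) * (\<integral>\<^sup>+\<sigma>\<in>{0<..<1}. g (\<tau> * \<sigma>) * ennreal (\<sigma> powr (1 / 2 - 1) * (1 - \<sigma>) powr (real N / 2 -
        1)) \<partial>lborel)"
proof -
  define G where "G = (\<lambda>(\<rho> :: real, s). indicator {\<rho>. 0 < \<rho> \<and> \<rho> \<le> 1} \<rho> * g s :: ennreal)"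
  have [measurable]: "G \<in> borel_measurable (borel \<Otimes>\<^sub>M borel)" unfolding G_def by measurable
  define S where "S = (\<integral>\<^sup>+\<sigma>\<in>{0<..<1}. g (\<tau> * \<sigma>) * ennreal (\<sigma> powr (1 / 2 - 1) * (1 - \<sigma>) powr (real N / 2 - 1))
      \<partial>lborel)"
  have "(\<integral>\<^sup>+y. G (\<Sum>j\<in>I. (y j)\<^sup>2, (\<Sum>j\<in>I. c j * y j)\<^sup>2 / (\<Sum>j\<in>I. (y j)\<^sup>2)) \<partial>PiM I (\<lambda>_. lborel))
      = ennreal (radial_const N) * (\<integral>\<^sup>+\<rho>\<in>{0<..}. (\<integral>\<^sup>+\<sigma>\<in>{0<..<1}. G (\<rho>, \<tau> * \<sigma>)
            * ennreal (\<rho> powr ((real N + 1) / 2 - 1) * (\<sigma> powr (1 / 2 - 1) * (1 - \<sigma>) powr (real N / 2 - 1))) \<partial>lborel)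
                \<partial>lborel)"
    using nn_integral_PiM_direction[OF I(1) _ \<open>G \<in> _\<close> c] I by (simp add: add.commute)
  also have "(\<integral>\<^sup>+\<rho>\<in>{0<..}. (\<integral>\<^sup>+\<sigma>\<in>{0<..<1}. G (\<rho>, \<tau> * \<sigma>)
            * ennreal (\<rho> powr ((real N + 1) / 2 - 1) * (\<sigma> powr (1 / 2 - 1) * (1 - \<sigma>) powr (real N / 2 - 1))) \<partial>lborel)
                \<partial>lborel)
     = (\<integral>\<^sup>+\<rho>. ennreal (\<rho> powr ((real N + 1) / 2 - 1)) * indicator {\<rho>. 0 < \<rho> \<and> \<rho> \<le> 1} \<rho> * S \<partial>lborel)"
  proof (rule nn_integral_cong, goal_cases)
    case (1 \<rho>)
    show ?case unfolding S_def
      by (subst nn_integral_cmult[symmetric], measurable, subst nn_integral_multc[symmetric], measurable)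
         (auto simp: indicator_def G_def ennreal_mult mult_ac intro!: nn_integral_cong)
  qed
  also have "\<dots> = (\<integral>\<^sup>+\<rho>. ennreal (\<rho> powr ((real N + 1) / 2 - 1)) * indicator {\<rho>. 0 < \<rho> \<and> \<rho> \<le> 1} \<rho> \<partial>lborel) * S"
    by (rule nn_integral_multc) measurable
  also have "(\<integral>\<^sup>+\<rho>. ennreal (\<rho> powr ((real N + 1) / 2 - 1)) * indicator {\<rho>. 0 < \<rho> \<and> \<rho> \<le> 1} \<rho> \<partial>lborel)
     = (\<integral>\<^sup>+\<rho>\<in>{0<..<1}. ennreal (\<rho> powr ((real N + 1) / 2 - 1) * (1 - \<rho>) powr (1 - 1)) \<partial>lborel)"
  proof (rule nn_integral_cong_AE)
    show "AE \<rho> in lborel. ennreal (\<rho> powr ((real N + 1) / 2 - 1)) * indicator {\<rho>. 0 < \<rho> \<and> \<rho> \<le> 1} \<rho>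
       = ennreal (\<rho> powr ((real N + 1) / 2 - 1) * (1 - \<rho>) powr (1 - 1)) * indicator {0<..<1} \<rho>"
      using AE_lborel_singleton[of "1 :: real"] by eventually_elim (auto simp: indicator_def)
  qed
  also have "\<dots> = ennreal (Beta ((real N + 1) / 2) 1)" by (rule nn_integral_Beta) auto
  finally show ?thesis using radial_const_pos[of N] Beta_real_pos[of "(real N + 1) / 2" 1]
    unfolding G_def S_def radon_const_def by (simp add: ennreal_mult mult.assoc)
qed

text \<open>In basis coordinates y the integrand depends only on the squared norm of y and on the
  linear form with coefficients \<open>b i $ a\<close>, whose squares add up to tau.\<close>

lemma radon_formula:
  fixes v :: "nat \<Rightarrow> real ^ 'm :: finite" and a :: 'm
  assumes V: "dim (span (v ` {..k})) = k + 1" and k: "k \<ge> 1" and [measurable]: "F \<in> borel_measurable borel"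
  defines "\<tau> \<equiv> 1 - (norm (gs_residual v (k + 1) (axis a 1)))\<^sup>2"
  shows "radon_integrand k (\<lambda>x. F \<bar>x $ a\<bar>) (span (v ` {..k})) \<in> borel_measurable (PiM {..k} (\<lambda>_. lborel))"
    "(\<integral>\<^sup>+y. ennreal \<bar>radon_integrand k (\<lambda>x. F \<bar>x $ a\<bar>) (span (v ` {..k})) y\<bar> \<partial>PiM {..k} (\<lambda>_. lborel))
       = ennreal (radon_const k) * radon_profile k F \<tau>"
proof -
  let ?V = "span (v ` {..k})"
  define b where "b = onb k ?V"
  have b: "orthonormal_on {..k} b" using onb_exists[of ?V k] V by (auto simp: b_def)
  define c where "c i = b i $ a" for i
  have c: "(\<Sum>i\<le>k. (c i)\<^sup>2) = \<tau>" unfolding c_def b_def \<tau>_def by (rule sum_onb_squares[OF V])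
  have eq: "radon_integrand k (\<lambda>x. F \<bar>x $ a\<bar>) ?V y
     = indicator {\<rho>. 0 < \<rho> \<and> \<rho> \<le> 1} (\<Sum>i\<le>k. (y i)\<^sup>2) * F (sqrt ((\<Sum>i\<le>k. c i * y i)\<^sup>2 / (\<Sum>i\<le>k. (y i)\<^sup>2)))" for y
  proof -
    define u where "u = (\<Sum>i\<le>k. y i *\<^sub>R b i)"
    have "norm u = sqrt (\<Sum>i\<le>k. (y i)\<^sup>2)"
      using orthonormal_on_norm[OF b, of y] by (simp add: u_def real_sqrt_unique)
    moreover have "u $ a = (\<Sum>i\<le>k. c i * y i)" by (simp add: u_def c_def mult.commute)
    ultimately have "\<bar>sgn u $ a\<bar> = sqrt ((\<Sum>i\<le>k. c i * y i)\<^sup>2 / (\<Sum>i\<le>k. (y i)\<^sup>2))"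
      by (simp add: sgn_div_norm real_sqrt_divide abs_mult sum_nonneg) (simp add: divide_inverse mult.commute)
    then show ?thesis by (simp add: radon_integrand_def b_def[symmetric] u_def[symmetric] unit_ball_k_def
        indicator_def)
  qed
  show "radon_integrand k (\<lambda>x. F \<bar>x $ a\<bar>) ?V \<in> borel_measurable (PiM {..k} (\<lambda>_. lborel))"
    unfolding eq[abs_def] by measurable
  show "(\<integral>\<^sup>+y. ennreal \<bar>radon_integrand k (\<lambda>x. F \<bar>x $ a\<bar>) ?V y\<bar> \<partial>PiM {..k} (\<lambda>_. lborel))
       = ennreal (radon_const k) * radon_profile k F \<tau>"
    unfolding radon_profile_def
    by (subst nn_integral_unit_ball_direction[OF _ _ k _ c, symmetric, where g="\<lambda>s. ennreal \<bar>F (sqrt s)\<bar>"])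
       (auto simp: eq indicator_def intro!: nn_integral_cong)
qed


section \<open>The sphere norm as an integral against an unnormalised Beta density\<close>

definition cone_weight :: "real \<Rightarrow> real \<Rightarrow> real \<Rightarrow> real" where
  "cone_weight a b \<sigma> = \<sigma> powr (a - 1) * (1 - \<sigma>) powr (b - 1)"

lemma cone_weight_measurable [measurable]: "cone_weight a b \<in> borel_measurable borel"
  unfolding cone_weight_def by measurable

lemma cone_weight_nonneg [simp]: "0 \<le> cone_weight a b \<sigma>"
  by (simp add: cone_weight_def)

lemma sphere_integral_weighted:
  fixes a :: "'m :: finite"
  assumes card: "CARD('m) = n + 1" "n \<ge> 1" and [measurable]: "F \<in> borel_measurable borel"
  shows "sphere_integral (\<lambda>u :: real ^ 'm. ennreal (\<bar>F \<bar>u $ a\<bar>\<bar> powr p * sin (sdist a u) powr \<alpha>1 * \<bar>cos (sdist a u)\<bar>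
      powr \<alpha>2))
    = ennreal (real (n + 1) * radon_const n) * (\<integral>\<^sup>+\<sigma>\<in>{0<..<1}. ennreal (\<bar>F (sqrt \<sigma>)\<bar> powr p * cone_weight ((\<alpha>2 + 1) /
        2) ((\<alpha>1 + real n) / 2) \<sigma>) \<partial>lborel)"
proof -
  define g where "g s = ennreal (\<bar>F (sqrt s)\<bar> powr p * (1 - s) powr (\<alpha>1 / 2) * s powr (\<alpha>2 / 2))" for s
  have [measurable]: "g \<in> borel_measurable borel" unfolding g_def by measurable
  \<comment> \<open>The whole sphere is the case tau = 1 of the direction formula: the linear form
    is the coordinate a itself.\<close>
  define c where "c b = (if b = axis a 1 then 1 else 0 :: real)" for b :: "real ^ 'm"
  have ax: "axis a 1 \<in> (Basis :: (real ^ 'm) set)" by (auto simp: Basis_vec_def)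
  have c: "(\<Sum>b\<in>Basis. (c b)\<^sup>2) = 1" "(\<Sum>b\<in>Basis. c b * y b) = y (axis a 1)" for y
    using ax by (auto simp: c_def if_distrib[of "\<lambda>x. x\<^sup>2"] if_distrib[of "\<lambda>x. x * y _"] sum.delta cong: if_cong)
  have "(\<integral>\<^sup>+x. indicator {x. 0 < norm x \<and> norm x \<le> 1} x *
      ennreal (\<bar>F \<bar>sgn x $ a\<bar>\<bar> powr p * sin (sdist a (sgn x)) powr \<alpha>1 * \<bar>cos (sdist a (sgn x))\<bar> powr \<alpha>2) \<partial>(lborel ::
          (real ^ 'm) measure))
    = (\<integral>\<^sup>+x. indicator {\<rho>. 0 < \<rho> \<and> \<rho> \<le> 1} ((norm x)\<^sup>2) * g ((x $ a)\<^sup>2 / (norm x)\<^sup>2) \<partial>lborel)"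
  proof (rule nn_integral_cong, goal_cases)
    case (1 x)
    show ?case
    proof (cases "x = 0")
      case False
      define t where "t = sgn x $ a"
      have n1: "norm (sgn x) = 1" using False by (simp add: norm_sgn)
      have t: "\<bar>t\<bar> \<le> 1" using component_le_norm_cart[of "sgn x" a] n1 by (simp add: t_def)
      have t2: "t\<^sup>2 = (x $ a)\<^sup>2 / (norm x)\<^sup>2" by (simp add: t_def sgn_div_norm power_mult_distrib field_simps)
      have tt: "t\<^sup>2 \<le> 1" using t by (simp add: abs_square_le_1)
      have s: "sin (arccos t) = (1 - t\<^sup>2) powr (1 / 2)" "\<bar>cos (arccos t)\<bar> = (t\<^sup>2) powr (1 / 2)"
        using t tt by (auto simp: sin_arccos_abs cos_arccos_abs powr_half_sqrt)
      have "norm x \<le> 1 \<longleftrightarrow> (norm x)\<^sup>2 \<le> 1" by (simp add: power2_le_iff_abs_le abs_square_le_1)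
      moreover have "ennreal (\<bar>F \<bar>t\<bar>\<bar> powr p * sin (arccos t) powr \<alpha>1 * \<bar>cos (arccos t)\<bar> powr \<alpha>2) = g (t\<^sup>2)"
        unfolding s powr_powr g_def by simp
      ultimately show ?thesis using False by (simp add: sdist_def t_def[symmetric] t2[symmetric] indicator_def)
    qed simp
  qed
  also have "\<dots> = (\<integral>\<^sup>+y. indicator {\<rho>. 0 < \<rho> \<and> \<rho> \<le> 1} (\<Sum>b\<in>Basis. (y b)\<^sup>2) * g ((\<Sum>b\<in>Basis. c b * y b)\<^sup>2 / (\<Sum>b\<in>Basis. (y
      b)\<^sup>2)) \<partial>PiM (Basis :: (real ^ 'm) set) (\<lambda>_. lborel))"
  proof (subst nn_integral_lborel_PiM_Basis, measurable, rule nn_integral_cong, goal_cases)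
    case (1 y)
    have "orthonormal_on Basis (\<lambda>b :: real ^ 'm. b)" by (auto simp: orthonormal_on_def inner_Basis)
    from orthonormal_on_norm[OF this finite_Basis, of y] orthonormal_on_inner[OF this finite_Basis ax, of y]
    show ?case by (simp add: c inner_axis)
  qed
  also have "\<dots> = ennreal (radon_const n) * (\<integral>\<^sup>+\<sigma>\<in>{0<..<1}. g (1 * \<sigma>) * ennreal (\<sigma> powr (1 / 2 - 1) * (1 - \<sigma>) powr (real
      n / 2 - 1)) \<partial>lborel)"
    by (rule nn_integral_unit_ball_direction) (use card c in auto)
  also have "(\<integral>\<^sup>+\<sigma>\<in>{0<..<1}. g (1 * \<sigma>) * ennreal (\<sigma> powr (1 / 2 - 1) * (1 - \<sigma>) powr (real n / 2 - 1)) \<partial>lborel)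
     = (\<integral>\<^sup>+\<sigma>\<in>{0<..<1}. ennreal (\<bar>F (sqrt \<sigma>)\<bar> powr p * cone_weight ((\<alpha>2 + 1) / 2) ((\<alpha>1 + real n) / 2) \<sigma>) \<partial>lborel)"
  proof (rule nn_integral_cong, goal_cases)
    case (1 \<sigma>)
    have e: "(\<alpha>2 + 1) / 2 - 1 = \<alpha>2 / 2 + (1 / 2 - 1)" "(\<alpha>1 + real n) / 2 - 1 = \<alpha>1 / 2 + (real n / 2 - 1)"
      by (auto simp: field_simps)
    show ?case
      unfolding cone_weight_def e powr_add g_def
      by (auto simp: indicator_def ennreal_mult[symmetric] mult_ac)
  qed
  finally show ?thesis
    using radon_const_pos[of n] card by (simp add: sphere_integral_def ennreal_mult mult.assoc
        ennreal_of_nat_eq_real_of_nat)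
qed

section \<open>Reduction to one variable\<close>

definition plane_cos2 :: "'m :: finite \<Rightarrow> nat \<Rightarrow> (nat \<Rightarrow> real ^ 'm) \<Rightarrow> real" where
  "plane_cos2 a k v = 1 - (norm (gs_residual v (k + 1) (axis a 1)))\<^sup>2"

lemma plane_cos2_range:
  assumes "dim (span (v ` {..k})) = k + 1"
  shows "0 \<le> plane_cos2 a k v" "plane_cos2 a k v \<le> 1"
  using sum_nonneg[of "{..k}" "\<lambda>i. (onb k (span (v ` {..k})) i $ a)\<^sup>2"]
  unfolding plane_cos2_def sum_onb_squares[OF assms] by auto

lemma plane_measure_pred [measurable]:
  "Measurable.pred (plane_measure k :: (nat \<Rightarrow> real ^ 'm :: finite) measure) (\<lambda>v. dim (span (v ` {..k})) = k + 1)"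
proof -
  have "(dim (span (v ` {..k})) = k + 1) \<longleftrightarrow> (\<forall>i<k + 1. gs_residual v i (v i) \<noteq> 0)" for v :: "nat \<Rightarrow> real ^ 'm"
    using dim_span_gs_residual[of v "k + 1"] by (simp add: lessThan_Suc_atMost del: gs_residual.simps)
  then show ?thesis
    using gs_independent_pred[of "k + 1" "k + 1", where 'm='m] unfolding plane_measure_def
        by (simp add: lessThan_Suc_atMost)
qed

lemma plane_cos2_measurable [measurable]: "plane_cos2 a k \<in> borel_measurable (plane_measure k)"
proof -
  have [measurable]: "(\<lambda>v. gs_residual v (k + 1) (axis a 1)) \<in> borel_measurable (plane_measure k)"
    using gs_residual_measurable_PiM[of "k + 1" "k + 1" "axis a 1"]
    unfolding plane_measure_def by (simp add: lessThan_Suc_atMost del: gs_residual.simps)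
  show ?thesis unfolding plane_cos2_def by measurable
qed

text \<open>With tau = cos^2 h this is a constant times sin^(n-k-1) h cos^k h dh, so the Gaussian
  model reproduces the radial density of the invariant measure on planes.\<close>

lemma plane_law:
  fixes a :: "'m :: finite"
  assumes card: "CARD('m) = n + 1" and k: "1 \<le> k" "k \<le> n - 1"
  shows "\<exists>C>0. \<forall>\<Phi>\<in>borel_measurable borel.
     (\<integral>\<^sup>+v. (if dim (span (v ` {..k})) = k + 1 then \<Phi> (plane_cos2 a k v) else 0) \<partial>plane_measure k)
     = ennreal C * (\<integral>\<^sup>+\<tau>\<in>{0<..<1}. \<Phi> \<tau> * ennreal (cone_weight ((real k + 1) / 2) ((real n - real k) / 2) \<tau>) \<partial>lborel)"
proof -
  let ?e = "axis a 1 :: real ^ 'm"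
  have e: "norm ?e = 1" by (simp add: norm_axis_1)
  have c: "k + 1 + 1 \<le> CARD('m)" using k card by auto
  from gauss_distance_law_ex[OF e le_add2 c]
  obtain C where C: "C > 0" "\<forall>\<Phi>\<in>borel_measurable borel.
     (\<integral>\<^sup>+v. (if \<forall>i<k + 1. gs_residual v i (v i) \<noteq> 0 then \<Phi> ((norm (gs_residual v (k + 1) ?e))\<^sup>2) else 0) \<partial>PiM {..<k + 1}
         (\<lambda>_. gauss))
     = ennreal C * (\<integral>\<^sup>+w\<in>{0<..<1}. \<Phi> w * ennreal (w powr ((real (n + 1) - real (k + 1)) / 2 - 1) * (1 - w) powr (real
         (k + 1) / 2 - 1)) \<partial>lborel)"
    unfolding card by blast
  have dim: "(dim (span (v ` {..k})) = k + 1) \<longleftrightarrow> (\<forall>i<k + 1. gs_residual v i (v i) \<noteq> 0)" for v :: "nat \<Rightarrow> real ^ 'm"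
    using dim_span_gs_residual[of v "k + 1"] by (simp add: lessThan_Suc_atMost del: gs_residual.simps)
  have set: "{..<k + 1} = {..k}" by auto
  show ?thesis
  proof (intro exI[of _ C] conjI ballI C(1))
    fix \<Phi> :: "real \<Rightarrow> ennreal" assume \<Phi>[measurable]: "\<Phi> \<in> borel_measurable borel"
    have "(\<integral>\<^sup>+v. (if dim (span (v ` {..k})) = k + 1 then \<Phi> (plane_cos2 a k v) else 0) \<partial>plane_measure k)
      = ennreal C * (\<integral>\<^sup>+w\<in>{0<..<1}. \<Phi> (1 - w) * ennreal (w powr ((real (n + 1) - real (k + 1)) / 2 - 1) * (1 - w) powr
          (real (k + 1) / 2 - 1)) \<partial>lborel)"
      unfolding dim plane_measure_def plane_cos2_def set[symmetric] dim[unfolded set[symmetric]]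
          by (rule C(2)[rule_format]) measurable
    also have "(\<integral>\<^sup>+w\<in>{0<..<1}. \<Phi> (1 - w) * ennreal (w powr ((real (n + 1) - real (k + 1)) / 2 - 1) * (1 - w) powr (real
        (k + 1) / 2 - 1)) \<partial>lborel)
      = (\<integral>\<^sup>+\<tau>\<in>{0<..<1}. \<Phi> \<tau> * ennreal (cone_weight ((real k + 1) / 2) ((real n - real k) / 2) \<tau>) \<partial>lborel)"
      by (subst nn_integral_real_affine[where c="-1" and t=1])
         (auto simp: indicator_def cone_weight_def mult_ac add.commute intro!: nn_integral_cong)
    finally show "(\<integral>\<^sup>+v. (if dim (span (v ` {..k})) = k + 1 then \<Phi> (plane_cos2 a k v) else 0) \<partial>plane_measure k)
     = ennreal C * (\<integral>\<^sup>+\<tau>\<in>{0<..<1}. \<Phi> \<tau> * ennreal (cone_weight ((real k + 1) / 2) ((real n - real k) / 2) \<tau>) \<partial>lborel)" .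
  qed
qed

lemma xi_dist_less_iff:
  assumes "dim (span (v ` {..k})) = k + 1"
  shows "xi_dist a (span (v ` {..k})) < pi / 2 \<longleftrightarrow> 0 < plane_cos2 a k v"
    "sin (xi_dist a (span (v ` {..k}))) = sqrt (1 - plane_cos2 a k v)"
    "cos (xi_dist a (span (v ` {..k}))) = sqrt (plane_cos2 a k v)"
proof -
  define t where "t = plane_cos2 a k v"
  have t: "0 \<le> t" "t \<le> 1" using plane_cos2_range[OF assms] by (auto simp: t_def)
  have eq: "xi_dist a (span (v ` {..k})) = arccos (sqrt t)" unfolding t_def plane_cos2_def
      by (rule xi_dist_span[OF assms])
  have "arccos (sqrt t) < arccos 0 \<longleftrightarrow> 0 < t" using t by (subst arccos_less_mono) auto
  then show "xi_dist a (span (v ` {..k})) < pi / 2 \<longleftrightarrow> 0 < plane_cos2 a k v" unfolding eq t_def[symmetric] by simp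
  show "sin (xi_dist a (span (v ` {..k}))) = sqrt (1 - plane_cos2 a k v)"
    unfolding eq t_def[symmetric] using t by (subst sin_arccos_abs) auto
  show "cos (xi_dist a (span (v ` {..k}))) = sqrt (plane_cos2 a k v)"
    unfolding eq t_def[symmetric] using t by (subst cos_arccos_abs) auto
qed

text \<open>The absolute bound is enough for sufficiency and allows signed F; equality for
  nonnegative F serves the tests for necessity. The bound holds even if \<open>P\<close> is
  infinite: then the Bochner integral of a non-integrable function and \<open>enn2real\<close> of
  infinity are both 0.\<close>

lemma radon_profile_bound:
  fixes v :: "nat \<Rightarrow> real ^ 'm :: finite" and a :: 'm
  assumes V: "dim (span (v ` {..k})) = k + 1" and k: "k \<ge> 1" and F[measurable]: "F \<in> borel_measurable borel"
  defines "P \<equiv> radon_profile k F (plane_cos2 a k v)"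
  shows "P < \<infinity> \<Longrightarrow> radon_integrable k (\<lambda>x. F \<bar>x $ a\<bar>) (span (v ` {..k}))"
    "\<bar>radon k (\<lambda>x. F \<bar>x $ a\<bar>) (span (v ` {..k}))\<bar> \<le> real (k + 1) * radon_const k * enn2real P"
    "P < \<infinity> \<Longrightarrow> (\<And>x. 0 \<le> F x) \<Longrightarrow>
        radon k (\<lambda>x. F \<bar>x $ a\<bar>) (span (v ` {..k})) = real (k + 1) * radon_const k * enn2real P"
proof -
  let ?f = "radon_integrand k (\<lambda>x. F \<bar>x $ a\<bar>) (span (v ` {..k}))" and ?M = "PiM {..k} (\<lambda>_. lborel :: real measure)"
  have meas[measurable]: "?f \<in> borel_measurable ?M" and nn: "(\<integral>\<^sup>+y. ennreal \<bar>?f y\<bar> \<partial>?M) = ennreal (radon_const k) * P"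
    using radon_formula[OF V k F, of a] unfolding P_def plane_cos2_def by auto
  show int: "radon_integrable k (\<lambda>x. F \<bar>x $ a\<bar>) (span (v ` {..k}))" if "P < \<infinity>"
    unfolding radon_integrable_def using nn that
    by (intro integrableI_bounded) (auto simp: ennreal_mult_less_top)
  have abs: "(\<integral>y. \<bar>?f y\<bar> \<partial>?M) = radon_const k * enn2real P"
    using nn radon_const_pos[of k] by (subst integral_eq_nn_integral) (auto simp: enn2real_mult)
  show "\<bar>radon k (\<lambda>x. F \<bar>x $ a\<bar>) (span (v ` {..k}))\<bar> \<le> real (k + 1) * radon_const k * enn2real P"
    using integral_abs_bound[of ?M ?f] unfolding radon_def abs by (auto simp: abs_mult mult.assoc intro!:
        mult_left_mono)
  show "radon k (\<lambda>x. F \<bar>x $ a\<bar>) (span (v ` {..k})) = real (k + 1) * radon_const k * enn2real P" if "P < \<infinity>" "\<And>x. 0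
      \<le> F x"
  proof -
    have "\<bar>?f y\<bar> = ?f y" for y using that by (simp add: radon_integrand_def)
    then show ?thesis using abs by (simp add: radon_def mult.assoc)
  qed
qed

definition sphere_weighted :: "nat \<Rightarrow> real \<Rightarrow> real \<Rightarrow> real \<Rightarrow> (real \<Rightarrow> real) \<Rightarrow> ennreal" where
  "sphere_weighted n p \<alpha>1 \<alpha>2 F = (\<integral>\<^sup>+\<sigma>\<in>{0<..<1}. ennreal (\<bar>F (sqrt \<sigma>)\<bar> powr p
      * cone_weight ((\<alpha>2 + 1) / 2) ((\<alpha>1 + real n) / 2) \<sigma>) \<partial>lborel)"

text \<open>Where the profile is infinite, \<open>enn2real\<close> contributes 0. An estimate of
  this integral is therefore always paired with finiteness of the profile almost everywhere, as in
  \<open>radon_boundI\<close>.\<close>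

definition profile_weighted :: "nat \<Rightarrow> nat \<Rightarrow> real \<Rightarrow> real \<Rightarrow> real \<Rightarrow> (real \<Rightarrow> real) \<Rightarrow> ennreal" where
  "profile_weighted n k r \<beta>1 \<beta>2 F = (\<integral>\<^sup>+\<tau>\<in>{0<..<1}. ennreal (enn2real (radon_profile k F \<tau>) powr r
      * cone_weight ((\<beta>2 + real k + 1) / 2) ((\<beta>1 + real n - real k) / 2) \<tau>) \<partial>lborel)"

lemma Xi_integral_radon:
  fixes a :: "'m :: finite" and \<beta>1 \<beta>2 :: real
  assumes card: "CARD('m) = n + 1" and k: "1 \<le> k" "k \<le> n - 1" and r: "r > 0"
  defines "X F \<equiv> Xi_integral k (\<lambda>V :: (real ^ 'm) set. if xi_dist a V < pi / 2 then
        ennreal (\<bar>radon k (\<lambda>x. F \<bar>x $ a\<bar>) V\<bar> powr r * sin (xi_dist a V) powr \<beta>1 * cos (xi_dist a V) powr \<beta>2) else 0)"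
  shows "\<exists>C>0. \<forall>F\<in>borel_measurable borel. X F \<le> ennreal C * profile_weighted n k r \<beta>1 \<beta>2 F
     \<and> ((\<forall>x. 0 \<le> F x) \<and> (\<forall>\<tau>. radon_profile k F \<tau> < \<infinity>) \<longrightarrow> X F = ennreal C * profile_weighted n k r \<beta>1 \<beta>2 F)"
proof -
  obtain C where C: "C > 0" "\<forall>\<Phi>\<in>borel_measurable borel.
     (\<integral>\<^sup>+v. (if dim (span (v ` {..k})) = k + 1 then \<Phi> (plane_cos2 a k v) else 0) \<partial>plane_measure k)
     = ennreal C * (\<integral>\<^sup>+\<tau>\<in>{0<..<1}. \<Phi> \<tau> * ennreal (cone_weight ((real k + 1) / 2) ((real n - real k) / 2) \<tau>) \<partial>lborel)"
    using plane_law[OF card k] by blast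
  define M where "M = real (k + 1) * radon_const k"
  have M: "M > 0" using radon_const_pos by (simp add: M_def)
  show ?thesis
  proof (intro exI[of _ "C * M powr r"] conjI ballI impI)
    show "C * M powr r > 0" using C M by simp
    fix F :: "real \<Rightarrow> real" assume F[measurable]: "F \<in> borel_measurable borel"
    define \<Psi> where "\<Psi> \<tau> = (if 0 < \<tau> then ennreal ((M * enn2real (radon_profile k F \<tau>)) powr r * (1 - \<tau>) powr (\<beta>1 / 2)
        * \<tau> powr (\<beta>2 / 2)) else 0)" for \<tau>
    have [measurable]: "\<Psi> \<in> borel_measurable borel" unfolding \<Psi>_def by measurable
    have "(\<integral>\<^sup>+v. (if dim (span (v ` {..k})) = k + 1 then \<Psi> (plane_cos2 a k v) else 0) \<partial>plane_measure k)
       = ennreal C * (\<integral>\<^sup>+\<tau>\<in>{0<..<1}. \<Psi> \<tau> * ennreal (cone_weight ((real k + 1) / 2) ((real n - real k) / 2) \<tau>) \<partial>lborel)"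
      by (rule C(2)[rule_format]) measurable
    also have "(\<integral>\<^sup>+\<tau>\<in>{0<..<1}. \<Psi> \<tau> * ennreal (cone_weight ((real k + 1) / 2) ((real n - real k) / 2) \<tau>) \<partial>lborel)
       = (\<integral>\<^sup>+\<tau>. ennreal (M powr r) * (ennreal (enn2real (radon_profile k F \<tau>) powr r
           * cone_weight ((\<beta>2 + real k + 1) / 2) ((\<beta>1 + real n - real k) / 2) \<tau>) * indicator {0<..<1} \<tau>) \<partial>lborel)"
    proof (rule nn_integral_cong, goal_cases)
      case (1 \<tau>)
      have e: "(\<beta>2 + real k + 1) / 2 - 1 = \<beta>2 / 2 + ((real k + 1) / 2 - 1)" 
          "(\<beta>1 + real n - real k) / 2 - 1 = \<beta>1 / 2 + ((real n - real k) / 2 - 1)" by (auto simp: field_simps)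
      show ?case unfolding \<Psi>_def cone_weight_def e powr_add using M
        by (auto simp: indicator_def ennreal_mult[symmetric] powr_mult mult_ac)
    qed
    also have "\<dots> = ennreal (M powr r) * profile_weighted n k r \<beta>1 \<beta>2 F"
      unfolding profile_weighted_def by (rule nn_integral_cmult) measurable
    also have "ennreal C * \<dots> = ennreal (C * M powr r) * profile_weighted n k r \<beta>1 \<beta>2 F"
      using C by (simp add: ennreal_mult mult.assoc)
    finally have law: "(\<integral>\<^sup>+v. (if dim (span (v ` {..k})) = k + 1 then \<Psi> (plane_cos2 a k v) else 0) \<partial>plane_measure k)
       = ennreal (C * M powr r) * profile_weighted n k r \<beta>1 \<beta>2 F" .
    have int: "(if xi_dist a (span (v ` {..k})) < pi / 2 then
        ennreal (\<bar>R\<bar> powr r * sin (xi_dist a (span (v ` {..k}))) powr \<beta>1 * cos (xi_dist a (span (v ` {..k}))) powr \<beta>2)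
            else 0)
       = (if 0 < plane_cos2 a k v then ennreal (\<bar>R\<bar> powr r * (1 - plane_cos2 a k v) powr (\<beta>1 / 2) * plane_cos2 a k v
           powr (\<beta>2 / 2)) else 0)"
      if "dim (span (v ` {..k})) = k + 1" for R and v :: "nat \<Rightarrow> real ^ 'm"
    proof -
      have s: "sqrt x powr \<gamma> = x powr (\<gamma> / 2)" if "0 \<le> x" for x \<gamma> :: real
        using that by (simp add: powr_half_sqrt[symmetric] powr_powr)
      show ?thesis unfolding xi_dist_less_iff[OF that] using plane_cos2_range[OF that, of a] by (simp add: s)
    qed
    show "X F \<le> ennreal (C * M powr r) * profile_weighted n k r \<beta>1 \<beta>2 F"
      unfolding law[symmetric] X_def Xi_integral_def
    proof (rule nn_integral_mono, goal_cases)
      case (1 v)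
      show ?case
      proof (cases "dim (span (v ` {..k})) = k + 1")
        case True
        have "\<bar>radon k (\<lambda>x. F \<bar>x $ a\<bar>) (span (v ` {..k}))\<bar> powr r \<le> (M * enn2real (radon_profile k F (plane_cos2 a k
            v))) powr r"
          unfolding M_def using r by (intro powr_mono2 radon_profile_bound(2)[OF True k(1) F]) auto
        then show ?thesis unfolding int[OF True] \<Psi>_def by (auto intro!: ennreal_leI mult_right_mono)
      qed simp
    qed
    show "X F = ennreal (C * M powr r) * profile_weighted n k r \<beta>1 \<beta>2 F"
      if "(\<forall>x. 0 \<le> F x) \<and> (\<forall>\<tau>. radon_profile k F \<tau> < \<infinity>)"
      unfolding law[symmetric] X_def Xi_integral_def
    proof (rule nn_integral_cong, goal_cases)
      case (1 v)
      show ?case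
      proof (cases "dim (span (v ` {..k})) = k + 1")
        case True
        have "\<bar>radon k (\<lambda>x. F \<bar>x $ a\<bar>) (span (v ` {..k}))\<bar> = M * enn2real (radon_profile k F (plane_cos2 a k v))"
          unfolding M_def using that M by (subst radon_profile_bound(3)[OF True k(1) F]) (auto simp: M_def)
        then show ?thesis unfolding int[OF True] \<Psi>_def by simp
      qed simp
    qed
  qed
qed

text \<open>The law of tau has a density, so a null set of values tau pulls back to a null set of
  frames; this is applied to the indicator of an infinite profile.\<close>

lemma AE_radon_integrable:
  fixes a :: "'m :: finite"
  assumes card: "CARD('m) = n + 1" and k: "1 \<le> k" "k \<le> n - 1" and F[measurable]: "F \<in> borel_measurable borel"
    and fin: "AE \<tau> in lborel. \<tau> \<in> {0<..<1} \<longrightarrow> radon_profile k F \<tau> < \<infinity>"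
  shows "AE v in plane_measure k. dim (span (v ` {..k})) = k + 1
              \<longrightarrow> xi_dist a (span (v ` {..k})) < pi / 2
              \<longrightarrow> radon_integrable k (\<lambda>x. F \<bar>x $ a\<bar>) (span (v ` {..k}))"
proof -
  obtain C where C: "C > 0" "\<forall>\<Phi>\<in>borel_measurable borel.
     (\<integral>\<^sup>+v. (if dim (span (v ` {..k})) = k + 1 then \<Phi> (plane_cos2 a k v) else 0) \<partial>plane_measure k)
     = ennreal C * (\<integral>\<^sup>+\<tau>\<in>{0<..<1}. \<Phi> \<tau> * ennreal (cone_weight ((real k + 1) / 2) ((real n - real k) / 2) \<tau>) \<partial>lborel)"
    using plane_law[OF card k] by blast
  define \<Phi> where "\<Phi> \<tau> = (if radon_profile k F \<tau> = \<infinity> then 1 else 0 :: ennreal)" for \<tau>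
  have \<Phi>[measurable]: "\<Phi> \<in> borel_measurable borel" unfolding \<Phi>_def by measurable
  have "(\<integral>\<^sup>+\<tau>\<in>{0<..<1}. \<Phi> \<tau> * ennreal (cone_weight ((real k + 1) / 2) ((real n - real k) / 2) \<tau>) \<partial>lborel)
      = (\<integral>\<^sup>+(\<tau> :: real). 0 \<partial>lborel)"
  proof (rule nn_integral_cong_AE)
    show "AE \<tau> in lborel. \<Phi> \<tau> * ennreal (cone_weight ((real k + 1) / 2) ((real n - real k) / 2) \<tau>)
        * indicator {0<..<1} \<tau> = 0"
      using fin by eventually_elim (auto simp: \<Phi>_def indicator_def)
  qed
  then have "(\<integral>\<^sup>+v. (if dim (span (v ` {..k})) = k + 1 then \<Phi> (plane_cos2 a k v) else 0) \<partial>plane_measure k) = 0"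
    using C(2)[rule_format, OF \<Phi>] by simp
  then have "AE v in plane_measure k. (if dim (span (v ` {..k})) = k + 1 then \<Phi> (plane_cos2 a k v) else 0) = 0"
    by (subst (asm) nn_integral_0_iff_AE) measurable
  then show ?thesis
  proof eventually_elim
    case (elim v)
    then show ?case using radon_profile_bound(1)[OF _ k(1) F, of v a]
      by (auto simp: \<Phi>_def less_top simp del: gs_residual.simps split: if_splits)
  qed
qed

lemma radon_boundI:
  fixes a :: "'m :: finite"
  assumes card: "CARD('m) = n + 1" and k: "1 \<le> k" "k \<le> n - 1" and p: "p > 0" and r: "r > 0"
    and C: "\<And>F. F \<in> borel_measurable borel \<Longrightarrow> sphere_weighted n p \<alpha>1 \<alpha>2 F < \<infinity> \<Longrightarrow>
        (AE \<tau> in lborel. \<tau> \<in> {0<..<1} \<longrightarrow> radon_profile k F \<tau> < \<infinity>) \<and>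
        profile_weighted n k r \<beta>1 \<beta>2 F \<le> ennreal (C * enn2real (sphere_weighted n p \<alpha>1 \<alpha>2 F) powr (r / p))"
    and C0: "C \<ge> 0"
  shows "radon_bound a k p r \<alpha>1 \<alpha>2 \<beta>1 \<beta>2"
proof -
  define X where "X F = Xi_integral k (\<lambda>V :: (real ^ 'm) set. if xi_dist a V < pi / 2 then
        ennreal (\<bar>radon k (\<lambda>x. F \<bar>x $ a\<bar>) V\<bar> powr r * sin (xi_dist a V) powr \<beta>1 * cos (xi_dist a V) powr \<beta>2) else
            0)" for F
  obtain D where D: "D > 0" "\<forall>F\<in>borel_measurable borel. X F \<le> ennreal D * profile_weighted n k r \<beta>1 \<beta>2 F"
    using Xi_integral_radon[OF card k r, of a \<beta>1 \<beta>2] unfolding X_def by blast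
  have n: "n \<ge> 1" using k by auto
  define S where "S = real (n + 1) * radon_const n"
  have S: "S > 0" using radon_const_pos by (simp add: S_def)
  show ?thesis
    unfolding radon_bound_def
  proof (intro exI[of _ "(D * C) powr (1 / r) / S powr (1 / p)"] allI impI conjI)
    fix F :: "real \<Rightarrow> real" assume F: "F \<in> borel_measurable borel"
      and fin: "normS p \<alpha>1 \<alpha>2 a (\<lambda>x. F \<bar>x $ a\<bar>) < \<infinity>"
    define I where "I = sphere_weighted n p \<alpha>1 \<alpha>2 F"
    have nS: "normS p \<alpha>1 \<alpha>2 a (\<lambda>x. F \<bar>x $ a\<bar>) = Lnorm p (ennreal S * I)"
      unfolding normS_def I_def sphere_weighted_def S_def by (subst sphere_integral_weighted[OF card n F]) simp
    have "ennreal S * I < \<infinity>" using fin unfolding nS Lnorm_def by (auto simp: less_top split: if_splits)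
    then have I: "I < \<infinity>" using S by (auto simp: ennreal_mult_less_top)
    define i where "i = enn2real I"
    have i: "I = ennreal i" "i \<ge> 0" using I by (auto simp: i_def)
    note CF = C[OF F I[unfolded I_def], folded I_def, folded i_def]
    show "AE v in plane_measure k. dim (span (v ` {..k})) = k + 1
              \<longrightarrow> xi_dist a (span (v ` {..k})) < pi / 2
              \<longrightarrow> radon_integrable k (\<lambda>x. F \<bar>x $ a\<bar>) (span (v ` {..k}))"
      using AE_radon_integrable[OF card k F] CF by blast
    have "X F \<le> ennreal D * profile_weighted n k r \<beta>1 \<beta>2 F" using D F by blast
    also have "\<dots> \<le> ennreal D * ennreal (C * i powr (r / p))" using CF by (intro mult_left_mono) auto
    also have "\<dots> = ennreal (D * C * i powr (r / p))" using D C0 by (simp add: ennreal_mult[symmetric] mult.assoc)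
    finally have XF: "X F \<le> ennreal (D * C * i powr (r / p))" .
    then have Xfin: "X F \<noteq> \<infinity>" by (auto simp: top_unique)
    have "enn2real (X F) \<le> D * C * i powr (r / p)"
      using XF D C0 by (intro enn2real_leI) auto
    then have "enn2real (X F) powr (1 / r) \<le> (D * C * i powr (r / p)) powr (1 / r)"
      using r by (intro powr_mono2) auto
    also have "\<dots> = (D * C) powr (1 / r) * i powr (1 / p)"
      using D C0 r by (simp add: powr_mult powr_powr)
    also have "\<dots> = (D * C) powr (1 / r) / S powr (1 / p) * (S * i) powr (1 / p)"
      using S i by (simp add: powr_mult)
    finally have "ennreal (enn2real (X F) powr (1 / r)) \<le> ennreal ((D * C) powr (1 / r) / S powr (1 / p))
        * ennreal ((S * i) powr (1 / p))"
      by (simp add: ennreal_mult[symmetric] ennreal_leI)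
    moreover have "normXi r \<beta>1 \<beta>2 a k (radon k (\<lambda>x. F \<bar>x $ a\<bar>)) = ennreal (enn2real (X F) powr (1 / r))"
      unfolding normXi_def X_def[symmetric] Lnorm_def using Xfin by simp
    moreover have "normS p \<alpha>1 \<alpha>2 a (\<lambda>x. F \<bar>x $ a\<bar>) = ennreal ((S * i) powr (1 / p))"
      unfolding nS Lnorm_def i using S i by (simp add: ennreal_mult[symmetric])
    ultimately show "normXi r \<beta>1 \<beta>2 a k (radon k (\<lambda>x. F \<bar>x $ a\<bar>))
       \<le> ennreal ((D * C) powr (1 / r) / S powr (1 / p)) * normS p \<alpha>1 \<alpha>2 a (\<lambda>x. F \<bar>x $ a\<bar>)" by simp
  qed
qed

text \<open>For 0 <= F <= 1 every profile is bounded by a Beta integral, hence finite, and the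
  equality case of \<open>Xi_integral_radon\<close> applies. Indicators are all that the necessity
  proof needs.\<close>

lemma radon_boundD:
  fixes a :: "'m :: finite"
  assumes card: "CARD('m) = n + 1" and k: "1 \<le> k" "k \<le> n - 1" and p: "p > 0" and r: "r > 0"
    and bound: "radon_bound a k p r \<alpha>1 \<alpha>2 \<beta>1 \<beta>2"
  shows "\<exists>C\<ge>0. \<forall>F\<in>borel_measurable borel. (\<forall>x. 0 \<le> F x \<and> F x \<le> 1) \<longrightarrow> sphere_weighted n p \<alpha>1 \<alpha>2 F < \<infinity> \<longrightarrow>
      profile_weighted n k r \<beta>1 \<beta>2 F \<le> ennreal (C * enn2real (sphere_weighted n p \<alpha>1 \<alpha>2 F) powr (r / p))"
proof -
  define X where "X F = Xi_integral k (\<lambda>V :: (real ^ 'm) set. if xi_dist a V < pi / 2 then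
        ennreal (\<bar>radon k (\<lambda>x. F \<bar>x $ a\<bar>) V\<bar> powr r * sin (xi_dist a V) powr \<beta>1 * cos (xi_dist a V) powr \<beta>2) else
            0)" for F
  obtain D where D: "D > 0" "\<forall>F\<in>borel_measurable borel.
     (\<forall>x. 0 \<le> F x) \<and> (\<forall>\<tau>. radon_profile k F \<tau> < \<infinity>) \<longrightarrow> X F = ennreal D * profile_weighted n k r \<beta>1 \<beta>2 F"
    using Xi_integral_radon[OF card k r, of a \<beta>1 \<beta>2] unfolding X_def by blast
  have n: "n \<ge> 1" using k by auto
  define S where "S = real (n + 1) * radon_const n"
  have S: "S > 0" using radon_const_pos by (simp add: S_def)
  obtain B0 where B0: "\<forall>F::real \<Rightarrow> real. F \<in> borel_measurable borel \<longrightarrow>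
        normS p \<alpha>1 \<alpha>2 a (\<lambda>x. F \<bar>x $ a\<bar>) < \<infinity> \<longrightarrow> normXi r \<beta>1 \<beta>2 a k (radon k (\<lambda>x. F \<bar>x $ a\<bar>))
              \<le> ennreal B0 * normS p \<alpha>1 \<alpha>2 a (\<lambda>x. F \<bar>x $ a\<bar>)"
    using bound unfolding radon_bound_def by blast
  \<comment> \<open>The constant in \<open>radon_bound\<close> may be any real number;
    \<open>ennreal\<close> sends negative values to 0, so it can be replaced by its positive
    part.\<close>
  define B where "B = max B0 0"
  have B: "B \<ge> 0" "ennreal B0 = ennreal B" by (auto simp: B_def max_def ennreal_neg)
  show ?thesis
  proof (intro exI[of _ "(B * S powr (1 / p)) powr r / D"] conjI ballI impI)
    show "(B * S powr (1 / p)) powr r / D \<ge> 0" using D by simp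
    fix F :: "real \<Rightarrow> real" assume F: "F \<in> borel_measurable borel" and F01: "\<forall>x. 0 \<le> F x \<and> F x \<le> 1"
      and fin: "sphere_weighted n p \<alpha>1 \<alpha>2 F < \<infinity>"
    define I where "I = sphere_weighted n p \<alpha>1 \<alpha>2 F"
    define i where "i = enn2real I"
    have i: "I = ennreal i" "i \<ge> 0" using fin by (auto simp: i_def I_def)
    have nS: "normS p \<alpha>1 \<alpha>2 a (\<lambda>x. F \<bar>x $ a\<bar>) = ennreal ((S * i) powr (1 / p))"
    proof -
      have "normS p \<alpha>1 \<alpha>2 a (\<lambda>x. F \<bar>x $ a\<bar>) = Lnorm p (ennreal S * I)"
        unfolding normS_def I_def sphere_weighted_def S_def by (subst sphere_integral_weighted[OF card n F]) simp
      then show ?thesis unfolding Lnorm_def i using S i by (simp add: ennreal_mult[symmetric])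
    qed
    have "radon_profile k F \<tau> < \<infinity>" for \<tau>
    proof -
      have "radon_profile k F \<tau> \<le> (\<integral>\<^sup>+\<sigma>\<in>{0<..<1}. ennreal (\<sigma> powr (1 / 2 - 1) * (1 - \<sigma>) powr (real k / 2 - 1))
          \<partial>lborel)"
        unfolding radon_profile_def
        by (rule nn_integral_mono)
           (use F01 in \<open>auto simp: indicator_def ennreal_mult[symmetric] intro!: ennreal_leI mult_left_le_one_le\<close>)
      also have "\<dots> = ennreal (Beta (1 / 2) (real k / 2))" by (rule nn_integral_Beta) (use k in auto)
      finally show ?thesis using le_less_trans by fastforce
    qed
    then have XF: "X F = ennreal D * profile_weighted n k r \<beta>1 \<beta>2 F" using D F F01 by blast
    have "Lnorm r (X F) \<le> ennreal B * ennreal ((S * i) powr (1 / p))"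
      using B0[rule_format, OF F] unfolding nS normXi_def X_def[symmetric] B by simp
    also have "\<dots> = ennreal (B * S powr (1 / p) * i powr (1 / p))"
      using B S i by (simp add: ennreal_mult[symmetric] powr_mult mult.assoc)
    finally have L: "Lnorm r (X F) \<le> ennreal (B * S powr (1 / p) * i powr (1 / p))" .
    then have Xfin: "X F \<noteq> \<infinity>" unfolding Lnorm_def by (auto simp: top_unique)
    define x where "x = enn2real (X F)"
    have x: "X F = ennreal x" "x \<ge> 0" using Xfin by (auto simp: x_def less_top)
    have "x powr (1 / r) \<le> B * S powr (1 / p) * i powr (1 / p)"
      using L B x(2) unfolding Lnorm_def x(1) by simp
    then have "(x powr (1 / r)) powr r \<le> (B * S powr (1 / p) * i powr (1 / p)) powr r"
      using r by (intro powr_mono2) auto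
    then have le: "x \<le> (B * S powr (1 / p)) powr r * i powr (r / p)"
      using r x B by (simp add: powr_powr powr_mult)
    define P where "P = profile_weighted n k r \<beta>1 \<beta>2 F"
    have "P = ennreal (1 / D) * X F" using D XF by (simp add: P_def mult.assoc[symmetric] ennreal_mult[symmetric])
    also have "\<dots> = ennreal (x / D)" using D x by (simp add: ennreal_mult[symmetric])
    also have "\<dots> \<le> ennreal ((B * S powr (1 / p)) powr r / D * i powr (r / p))"
      using le D by (intro ennreal_leI) (simp add: field_simps)
    finally show "profile_weighted n k r \<beta>1 \<beta>2 F \<le> ennreal ((B * S powr (1 / p)) powr r / D
        * enn2real (sphere_weighted n p \<alpha>1 \<alpha>2 F) powr (r / p))"
      unfolding P_def i_def I_def .
  qed
qed

section \<open>Convolution inequalities\<close>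

text \<open>Let S be the weighted mean. Averaging the tangent-line bounds ln x <= ln S + x/S - 1 at
  u, v and w leaves exactly ln S.\<close>

lemma weighted_am_gm3:
  fixes u v w :: real
  assumes "u > 0" "v > 0" "w > 0" "\<alpha> \<ge> 0" "\<beta> \<ge> 0" "\<gamma> \<ge> 0" "\<alpha> + \<beta> + \<gamma> = 1"
  shows "u powr \<alpha> * v powr \<beta> * w powr \<gamma> \<le> \<alpha> * u + \<beta> * v + \<gamma> * w"
proof -
  define S where "S = \<alpha> * u + \<beta> * v + \<gamma> * w"
  have "\<alpha> > 0 \<or> \<beta> > 0 \<or> \<gamma> > 0" using assms by linarith
  then have "\<alpha> * u > 0 \<or> \<beta> * v > 0 \<or> \<gamma> * w > 0" using assms by auto
  moreover have "\<alpha> * u \<ge> 0" "\<beta> * v \<ge> 0" "\<gamma> * w \<ge> 0" using assms by auto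
  ultimately have S: "S > 0" unfolding S_def by linarith
  have l: "ln x \<le> ln S + x / S - 1" if "x > 0" for x
    using ln_le_minus_one[of "x / S"] that S by (simp add: ln_div)
  have "\<alpha> * ln u + \<beta> * ln v + \<gamma> * ln w \<le> \<alpha> * (ln S + u / S - 1) + \<beta> * (ln S + v / S - 1) + \<gamma> * (ln S + w / S - 1)"
    by (intro add_mono mult_left_mono l) (use assms in auto)
  also have "\<dots> = (\<alpha> + \<beta> + \<gamma>) * (ln S - 1) + (\<alpha> * u + \<beta> * v + \<gamma> * w) / S"
    by (simp add: algebra_simps add_divide_distrib)
  also have "\<dots> = (\<alpha> + \<beta> + \<gamma>) * (ln S - 1) + S / S" by (simp only: S_def)
  also have "\<dots> = ln S" using S assms by simp
  finally have "exp (\<alpha> * ln u + \<beta> * ln v + \<gamma> * ln w) \<le> S"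
    using S by (metis exp_le_cancel_iff exp_ln)
  moreover have "u powr \<alpha> * v powr \<beta> * w powr \<gamma> = exp (\<alpha> * ln u + \<beta> * ln v + \<gamma> * ln w)"
    using assms by (simp add: powr_def exp_add)
  ultimately show ?thesis by (simp add: S_def)
qed

text \<open>Generalised Young inequality for a positive kernel: write
  \<open>K \<phi> = (K\<^sup>q \<phi>\<^sup>p)\<^bsup>1/r\<^esup> (K\<^sup>q)\<^bsup>1 - 1/p\<^esup> (\<phi>\<^sup>p)\<^bsup>1/p - 1/r\<^esup>\<close> and apply the weighted AM-GM inequality to the
  normalised factors.\<close>

lemma kernel_young:
  fixes K :: "real \<Rightarrow> real \<Rightarrow> real" and \<phi> :: "real \<Rightarrow> real"
  assumes K[measurable]: "case_prod K \<in> borel_measurable (borel \<Otimes>\<^sub>M borel)" and K0: "\<And>\<eta> \<xi>. 0 \<le> K \<eta> \<xi>"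
    and \<phi>[measurable]: "\<phi> \<in> borel_measurable borel" and \<phi>0: "\<And>\<xi>. 0 \<le> \<phi> \<xi>"
    and p: "1 \<le> p" "p \<le> r" and q: "q > 0" "1 / q = 1 + 1 / r - 1 / p"
    and A: "A > 0" "\<And>\<xi>. (\<integral>\<^sup>+\<eta>. ennreal (K \<eta> \<xi> powr q) \<partial>lborel) \<le> ennreal A"
    and A': "p = 1 \<or> (\<forall>\<eta>. (\<integral>\<^sup>+\<xi>. ennreal (K \<eta> \<xi> powr q) \<partial>lborel) \<le> ennreal A)"
    and N: "(\<integral>\<^sup>+\<xi>. ennreal (\<phi> \<xi> powr p) \<partial>lborel) = ennreal N" "N \<ge> 0"
  defines "\<psi> \<equiv> \<lambda>\<eta>. \<integral>\<^sup>+\<xi>. ennreal (K \<eta> \<xi> * \<phi> \<xi>) \<partial>lborel"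
  shows "AE \<eta> in lborel. \<psi> \<eta> < \<infinity>"
    and "(\<integral>\<^sup>+\<eta>. ennreal (enn2real (\<psi> \<eta>) powr r) \<partial>lborel) \<le> ennreal (A powr (r / q) * N powr (r / p))"
proof -
  have r: "r > 0" using p by linarith
  \<comment> \<open>The exponents 1/r, b and c add up to 1, and \<open>qe\<close> and
    \<open>pe\<close> say that they reassemble K and phi to the first power. Since b = 0 for p = 1,
    the integral of K^q over xi enters only for p > 1; this is the disjunction in the
    hypothesis.\<close>
  define b where "b = 1 - 1 / p"
  define c where "c = 1 / p - 1 / r"
  have b: "b \<ge> 0" "b = 0 \<longleftrightarrow> p = 1" using p by (auto simp: b_def)
  have c: "c \<ge> 0" using p by (simp add: c_def frac_le)
  have sum: "1 / r + b + c = 1" by (simp add: b_def c_def)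
  have qe: "q * (1 / r) + q * b = 1" and pe: "p * (1 / r) + p * c = 1"
    using p q r by (auto simp: b_def c_def field_simps)
  \<comment> \<open>By Fubini the integral of \<open>X\<close> is at most A N. This gives finiteness
    almost everywhere and, at the end, the r-th power bound.\<close>
  define X where "X \<eta> = (\<integral>\<^sup>+\<xi>. ennreal (K \<eta> \<xi> powr q * \<phi> \<xi> powr p) \<partial>lborel)" for \<eta>
  have [measurable]: "X \<in> borel_measurable borel" unfolding X_def by measurable
  have [measurable]: "\<psi> \<in> borel_measurable borel" unfolding \<psi>_def by measurable
  have "(\<integral>\<^sup>+\<eta>. X \<eta> \<partial>lborel) = (\<integral>\<^sup>+\<xi>. (\<integral>\<^sup>+\<eta>. ennreal (K \<eta> \<xi> powr q * \<phi> \<xi> powr p) \<partial>lborel) \<partial>lborel)"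
    unfolding X_def by (rule lborel_pair.Fubini') measurable
  also have "\<dots> = (\<integral>\<^sup>+\<xi>. (\<integral>\<^sup>+\<eta>. ennreal (K \<eta> \<xi> powr q) \<partial>lborel) * ennreal (\<phi> \<xi> powr p) \<partial>lborel)"
    by (simp add: ennreal_mult nn_integral_multc)
  also have "\<dots> \<le> (\<integral>\<^sup>+\<xi>. ennreal A * ennreal (\<phi> \<xi> powr p) \<partial>lborel)"
    by (intro nn_integral_mono mult_right_mono A) auto
  also have "\<dots> = ennreal (A * N)" using A N by (simp add: nn_integral_cmult ennreal_mult)
  finally have XN: "(\<integral>\<^sup>+\<eta>. X \<eta> \<partial>lborel) \<le> ennreal (A * N)" .
  then have "(\<integral>\<^sup>+\<eta>. X \<eta> \<partial>lborel) \<noteq> \<infinity>" by (auto simp: top_unique)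
  then have AEX: "AE \<eta> in lborel. X \<eta> \<noteq> \<infinity>" by (intro nn_integral_PInf_AE) auto
  have main: "\<psi> \<eta> \<le> ennreal (enn2real (X \<eta>) powr (1 / r) * A powr b * N powr c)" if fin: "X \<eta> \<noteq> \<infinity>" for \<eta>
  proof (cases "N = 0 \<or> X \<eta> = 0")
    case True
    have "AE \<xi> in lborel. ennreal (K \<eta> \<xi> * \<phi> \<xi>) = 0"
    proof (cases "N = 0")
      case True
      then have "(\<integral>\<^sup>+\<xi>. ennreal (\<phi> \<xi> powr p) \<partial>lborel) = 0" using N by simp
      then have "AE \<xi> in lborel. ennreal (\<phi> \<xi> powr p) = 0" by (subst (asm) nn_integral_0_iff_AE) auto
      then show ?thesis by eventually_elim (auto simp: ennreal_eq_0_iff)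
    next
      case False
      then have "X \<eta> = 0" using True by simp
      then have "AE \<xi> in lborel. ennreal (K \<eta> \<xi> powr q * \<phi> \<xi> powr p) = 0"
        unfolding X_def by (subst (asm) nn_integral_0_iff_AE) auto
      then show ?thesis by eventually_elim (auto simp: ennreal_eq_0_iff mult_le_0_iff)
    qed
    then have "\<psi> \<eta> = 0" unfolding \<psi>_def by (subst nn_integral_0_iff_AE) auto
    then show ?thesis by simp
  next
    case False
    define x where "x = enn2real (X \<eta>)"
    have x: "X \<eta> = ennreal x" "x > 0" using False fin
      by (auto simp: x_def less_top enn2real_positive_iff zero_less_iff_neq_zero)
    have N0: "N > 0" using False N by simp
    \<comment> \<open>The value of the bound once each factor is normalised by its own integral (x,
      A and N). The case in which x or N vanishes was removed because of these divisions.\<close>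
    define Z where "Z = x powr (1 / r) * A powr b * N powr c"
    have Z: "Z \<ge> 0" by (simp add: Z_def)
    have pt: "K \<eta> \<xi> * \<phi> \<xi> \<le> Z * (1 / r * (K \<eta> \<xi> powr q * \<phi> \<xi> powr p / x) + b * (K \<eta> \<xi> powr q / A) + c * (\<phi> \<xi> powr p /
        N))" for \<xi>
    proof (cases "K \<eta> \<xi> = 0 \<or> \<phi> \<xi> = 0")
      case True
      have "0 \<le> Z * (1 / r * (K \<eta> \<xi> powr q * \<phi> \<xi> powr p / x) + b * (K \<eta> \<xi> powr q / A) + c * (\<phi> \<xi> powr p / N))"
        using Z r x A N0 b c by (intro mult_nonneg_nonneg add_nonneg_nonneg divide_nonneg_nonneg) auto
      then show ?thesis using True by auto
    next
      case False
      then have pos: "K \<eta> \<xi> > 0" "\<phi> \<xi> > 0" using K0[of \<eta> \<xi>] \<phi>0[of \<xi>] by auto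
      let ?u = "K \<eta> \<xi> powr q * \<phi> \<xi> powr p / x" and ?v = "K \<eta> \<xi> powr q / A" and ?w = "\<phi> \<xi> powr p / N"
      have "?u powr (1 / r) * ?v powr b * ?w powr c \<le> 1 / r * ?u + b * ?v + c * ?w"
        using pos x A N0 r b c sum by (intro weighted_am_gm3) auto
      then have "Z * (?u powr (1 / r) * ?v powr b * ?w powr c) \<le> Z * (1 / r * ?u + b * ?v + c * ?w)"
        using Z by (rule mult_left_mono)
      moreover have "Z * (?u powr (1 / r) * ?v powr b * ?w powr c) = K \<eta> \<xi> * \<phi> \<xi>"
      proof -
        have "Z * (?u powr (1 / r) * ?v powr b * ?w powr c) =
           (K \<eta> \<xi> powr q) powr (1 / r) * (K \<eta> \<xi> powr q) powr b * ((\<phi> \<xi> powr p) powr (1 / r) * (\<phi> \<xi> powr p) powr c)"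
          using x A N0 pos unfolding Z_def by (simp add: powr_divide powr_mult field_simps)
        also have "\<dots> = K \<eta> \<xi> powr (q * (1 / r) + q * b) * \<phi> \<xi> powr (p * (1 / r) + p * c)"
          by (simp only: powr_powr powr_add)
        finally show ?thesis unfolding qe pe using pos by simp
      qed
      ultimately show ?thesis by simp
    qed
    have "\<psi> \<eta> \<le> (\<integral>\<^sup>+\<xi>. ennreal (Z / (r * x)) * ennreal (K \<eta> \<xi> powr q * \<phi> \<xi> powr p) + ennreal (Z * b / A)
        * ennreal (K \<eta> \<xi> powr q)
          + ennreal (Z * c / N) * ennreal (\<phi> \<xi> powr p) \<partial>lborel)"
      unfolding \<psi>_def
    proof (rule nn_integral_mono, goal_cases)
      case (1 \<xi>)
      have "ennreal (K \<eta> \<xi> * \<phi> \<xi>) \<le> ennreal (Z / (r * x) * (K \<eta> \<xi> powr q * \<phi> \<xi> powr p) + Z * b / A * (K \<eta> \<xi> powr q)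
          + Z * c / N * (\<phi> \<xi> powr p))"
        using pt[of \<xi>] by (intro ennreal_leI) (simp add: algebra_simps)
      then show ?case using Z r x A N0 b c by (simp add: ennreal_mult[symmetric] ennreal_plus[symmetric] del:
          ennreal_plus)
    qed
    also have "\<dots> = ennreal (Z / (r * x)) * X \<eta> + ennreal (Z * b / A) * (\<integral>\<^sup>+\<xi>. ennreal (K \<eta> \<xi> powr q) \<partial>lborel)
          + ennreal (Z * c / N) * ennreal N"
      unfolding X_def N(1)[symmetric] by (simp add: nn_integral_add nn_integral_cmult)
    also have "ennreal (Z * b / A) * (\<integral>\<^sup>+\<xi>. ennreal (K \<eta> \<xi> powr q) \<partial>lborel) \<le> ennreal (Z * b / A) * ennreal A"
      using A' b by (cases "p = 1") (auto intro!: mult_left_mono)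
    also have "ennreal (Z / (r * x)) * X \<eta> + ennreal (Z * b / A) * ennreal A + ennreal (Z * c / N) * ennreal N
       = ennreal (Z * (1 / r + b + c))"
      using Z r x A N0 b c by (simp add: ennreal_mult[symmetric] ennreal_plus[symmetric] field_simps del:
          ennreal_plus)
    finally show ?thesis unfolding sum by (simp add: Z_def x_def add_right_mono)
  qed
  show "AE \<eta> in lborel. \<psi> \<eta> < \<infinity>"
    using AEX by eventually_elim (rule le_less_trans[OF main], auto)
  have "(\<integral>\<^sup>+\<eta>. ennreal (enn2real (\<psi> \<eta>) powr r) \<partial>lborel) \<le> (\<integral>\<^sup>+\<eta>. ennreal ((A powr b * N powr c) powr r) * X \<eta> \<partial>lborel)"
  proof (rule nn_integral_mono_AE, use AEX in eventually_elim)
    fix \<eta> assume fin: "X \<eta> \<noteq> \<infinity>"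
    define x where "x = enn2real (X \<eta>)"
    have x: "X \<eta> = ennreal x" "x \<ge> 0" using fin by (auto simp: x_def less_top)
    have "enn2real (\<psi> \<eta>) \<le> x powr (1 / r) * A powr b * N powr c"
      using main[OF fin] by (intro enn2real_leI) (auto simp: x_def)
    then have "enn2real (\<psi> \<eta>) powr r \<le> (x powr (1 / r) * A powr b * N powr c) powr r"
      using r by (intro powr_mono2) auto
    also have "\<dots> = (A powr b * N powr c) powr r * x" using x r by (simp add: powr_mult powr_powr)
    finally show "ennreal (enn2real (\<psi> \<eta>) powr r) \<le> ennreal ((A powr b * N powr c) powr r) * X \<eta>"
      unfolding x by (simp add: ennreal_mult[symmetric] x ennreal_leI)
  qed
  also have "\<dots> = ennreal ((A powr b * N powr c) powr r) * (\<integral>\<^sup>+\<eta>. X \<eta> \<partial>lborel)" by (rule nn_integral_cmult) measurable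
  also have "\<dots> \<le> ennreal ((A powr b * N powr c) powr r) * ennreal (A * N)" by (rule mult_left_mono[OF XN]) simp
  also have "\<dots> = ennreal (A powr (r / q) * N powr (r / p))"
  proof -
    have e: "r / q = b * r + 1" "r / p = c * r + 1" using q p r unfolding b_def c_def by (auto simp: field_simps)
    have "(A powr b * N powr c) powr r * (A * N) = A powr (r / q) * N powr (r / p)"
      unfolding e using A N by (auto simp: powr_mult powr_powr powr_add)
    then show ?thesis using A N by (simp add: ennreal_mult[symmetric])
  qed
  finally show "(\<integral>\<^sup>+\<eta>. ennreal (enn2real (\<psi> \<eta>) powr r) \<partial>lborel) \<le> ennreal (A powr (r / q) * N powr (r / p))" .
qed

section \<open>Power integrals and the endpoint inequality of order 1/2\<close>

lemma nn_integral_powr_from_0: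
  assumes "s > 0" "u \<ge> 0"
  shows "(\<integral>\<^sup>+z\<in>{0<..<u}. ennreal (z powr (s - 1)) \<partial>lborel) = ennreal (u powr s / s)"
proof -
  have "((\<lambda>z. z powr (s - 1)) has_integral (u powr (s - 1 + 1) / (s - 1 + 1))) {0..u}"
    using assms by (intro has_integral_powr_from_0) auto
  then have "((\<lambda>z. z powr (s - 1)) has_integral (u powr s / s)) {0<..<u}" by (simp add: has_integral_Icc_iff_Ioo)
  then have "(\<integral>\<^sup>+z. ennreal (indicator {0<..<u} z * z powr (s - 1)) \<partial>lborel) = ennreal (u powr s / s)"
    by (intro nn_integral_has_integral_lebesgue) auto
  then show ?thesis
    by (rule trans[rotated]) (auto intro!: nn_integral_cong simp: indicator_def)
qed

lemma nn_integral_powr_to_inf: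
  assumes "s > 0" "u > 0"
  shows "(\<integral>\<^sup>+z\<in>{u..}. ennreal (z powr (- s - 1)) \<partial>lborel) = ennreal (u powr (- s) / s)"
proof -
  have "((\<lambda>z. z powr (- s - 1)) has_integral (- (u powr (- s - 1 + 1)) / (- s - 1 + 1))) {u..}"
    using assms by (intro has_integral_powr_to_inf) auto
  then have "(\<integral>\<^sup>+z. ennreal (indicator {u..} z * z powr (- s - 1)) \<partial>lborel)
      = ennreal (- (u powr (- s - 1 + 1)) / (- s - 1 + 1))"
    by (intro nn_integral_has_integral_lebesgue) auto
  then have "(\<integral>\<^sup>+z. ennreal (indicator {u..} z * z powr (- s - 1)) \<partial>lborel) = ennreal (u powr (- s) / s)" by simp
  then show ?thesis
    by (rule trans[rotated]) (auto intro!: nn_integral_cong simp: indicator_def)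
qed

text \<open>The layer cake formula for a single value y. The second claim later turns a finite
  integral over levels into finiteness of the potential almost everywhere.\<close>

lemma nn_integral_layer_cake:
  assumes r: "r > 0"
  shows "y < \<infinity> \<Longrightarrow> (\<integral>\<^sup>+t. (if 0 < t \<and> ennreal t < y then ennreal (r * t powr (r - 1)) else 0) \<partial>lborel)
      = ennreal (enn2real y powr r)"
    and "(\<integral>\<^sup>+t. (if 0 < t \<and> ennreal t < y then ennreal (r * t powr (r - 1)) else 0) \<partial>lborel) < \<infinity> \<Longrightarrow> y < \<infinity>"
proof -
  have int: "(\<integral>\<^sup>+t\<in>{0<..<u}. ennreal (r * t powr (r - 1)) \<partial>lborel) = ennreal (u powr r)" if "u \<ge> 0" for u
  proof -
    have "(\<integral>\<^sup>+t\<in>{0<..<u}. ennreal (r * t powr (r - 1)) \<partial>lborel) = ennreal r * (\<integral>\<^sup>+t\<in>{0<..<u}. ennreal (t powr (r - 1))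
        \<partial>lborel)"
      using r by (subst nn_integral_cmult[symmetric]) (auto simp: ennreal_mult mult.assoc)
    then show ?thesis using r that by (simp add: nn_integral_powr_from_0 ennreal_mult[symmetric])
  qed
  show "(\<integral>\<^sup>+t. (if 0 < t \<and> ennreal t < y then ennreal (r * t powr (r - 1)) else 0) \<partial>lborel)
      = ennreal (enn2real y powr r)"
    if "y < \<infinity>"
  proof -
    define u where "u = enn2real y"
    have u: "y = ennreal u" "u \<ge> 0" using that by (auto simp: u_def)
    have "(\<integral>\<^sup>+t. (if 0 < t \<and> ennreal t < y then ennreal (r * t powr (r - 1)) else 0) \<partial>lborel)
        = (\<integral>\<^sup>+t\<in>{0<..<u}. ennreal (r * t powr (r - 1)) \<partial>lborel)"
      by (intro nn_integral_cong) (auto simp: u indicator_def ennreal_less_iff)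
    then show ?thesis using int u by simp
  qed
  show "y < \<infinity>" if fin: "(\<integral>\<^sup>+t. (if 0 < t \<and> ennreal t < y then ennreal (r * t powr (r - 1)) else 0) \<partial>lborel) < \<infinity>"
  proof (rule ccontr)
    assume "\<not> y < \<infinity>"
    then have y: "y = \<infinity>" by (simp add: not_less top_unique)
    define l where "l = enn2real (\<integral>\<^sup>+t. (if 0 < t \<and> ennreal t < y then ennreal (r * t powr (r - 1)) else 0) \<partial>lborel)"
    have l: "(\<integral>\<^sup>+t. (if 0 < t \<and> ennreal t < y then ennreal (r * t powr (r - 1)) else 0) \<partial>lborel) = ennreal l" "l \<ge> 0"
      using fin by (auto simp: l_def)
    define u where "u = (l + 1) powr (1 / r)"
    have "ennreal (u powr r) \<le> ennreal l"
      unfolding l(1)[symmetric] int[of u, unfolded u_def, OF powr_ge_zero, folded u_def, symmetric]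
      by (intro nn_integral_mono) (auto simp: y indicator_def)
    then have "u powr r \<le> l" using l by simp
    moreover have "u powr r = l + 1" using l r by (simp add: u_def powr_powr)
    ultimately show False by simp
  qed
qed

definition half_kernel :: "real \<Rightarrow> real" where
  "half_kernel z = (if 0 < z then z powr (- 1 / 2) else 0)"

lemma half_kernel_measurable [measurable]: "half_kernel \<in> borel_measurable borel"
  unfolding half_kernel_def by measurable

lemma nn_integral_reflect_real:
  fixes g :: "real \<Rightarrow> ennreal"
  assumes [measurable]: "g \<in> borel_measurable borel"
  shows "(\<integral>\<^sup>+\<xi>. g (\<eta> - \<xi>) \<partial>lborel) = (\<integral>\<^sup>+z. g z \<partial>lborel)"
    "(\<integral>\<^sup>+\<eta>. g (\<eta> - \<xi>) \<partial>lborel) = (\<integral>\<^sup>+z. g z \<partial>lborel)"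
  using nn_integral_real_affine[of g "-1" \<eta>] nn_integral_real_affine[of g 1 "-\<xi>"]
  by (auto simp: add.commute)

text \<open>The endpoint of Young's inequality for the kernel \<open>z\<^bsup>-1/2\<^esup>\<close>. At level \<open>t\<close>, cut the kernel at distance
  \<open>\<rho>(t)\<close> and \<open>\<phi>\<close> at height \<open>a(t)\<close> such that the far part and the part with \<open>\<phi> \<le> a(t)\<close> are at most
  \<open>3t/4\<close>; Chebyshev's inequality handles what remains, and integrating the resulting bound
  \<open>|{\<psi> > t}| \<le> a(t)\<^sup>-\<^sup>1 \<integral>\<^bsub>\<phi> > a(t)\<^esub> \<phi>\<close> in \<open>t\<close> gives the claim.\<close>

lemma fractional_half_normalized:
  fixes p r :: real
  assumes p: "1 < p" and r: "r > 0" "1 / p - 1 / r = 1 / 2"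
  shows "\<exists>C>0. \<forall>\<phi>\<in>borel_measurable borel. (\<forall>\<xi>. 0 \<le> \<phi> \<xi>) \<longrightarrow> (\<integral>\<^sup>+\<xi>. ennreal (\<phi> \<xi> powr p) \<partial>lborel) \<le> 1 \<longrightarrow>
     (AE \<eta> in lborel. (\<integral>\<^sup>+\<xi>. ennreal (half_kernel (\<eta> - \<xi>) * \<phi> \<xi>) \<partial>lborel) < \<infinity>) \<and>
     (\<integral>\<^sup>+\<eta>. ennreal (enn2real (\<integral>\<^sup>+\<xi>. ennreal (half_kernel (\<eta> - \<xi>) * \<phi> \<xi>) \<partial>lborel) powr r) \<partial>lborel) \<le> ennreal C"
proof -
  \<comment> \<open>The conjugate exponent. From 1/p' = 1/2 - 1/r follows p' > 2, so the p'-th power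
    of the kernel, z^(-p'/2) = z^(-s-1), is integrable at infinity.\<close>
  define p' where "p' = p / (p - 1)"
  define s where "s = p' / 2 - 1"
  define C1 where "C1 = 1 + 1 / s"
  have conj: "1 / p + 1 / p' = 1" using p by (simp add: p'_def field_simps)
  have p'1: "p' > 1" using p by (simp add: p'_def field_simps)
  have ip': "1 / p' = 1 / 2 - 1 / r" using conj r by linarith
  then have "1 / p' < 1 / 2" using r by simp
  then have s: "s > 0" using p'1 by (simp add: s_def field_simps)
  have ps: "p' / r = s"
  proof -
    have "p' * (1 / p') = p' * (1 / 2 - 1 / r)" by (simp only: ip')
    then show ?thesis using p'1 by (simp add: s_def algebra_simps)
  qed
  have rp: "r / p = 1 + r / 2"
  proof -
    have "r * (1 / p) = r * (1 / 2 + 1 / r)" using r by (metis add.commute diff_add_cancel)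
    then show ?thesis using r by (simp add: algebra_simps)
  qed
  have C1: "C1 > 0" using s by (simp add: C1_def add_pos_pos)
  \<comment> \<open>Fixed by a(t) * 2 * rho(t)^(1/2) = t/4 with a(t) = c t^(r/p) and rho(t) = (2
    C1/t)^r. The powers of t agree because r/p = 1 + r/2.\<close>
  define c where "c = 1 / (8 * (2 * C1) powr (r / 2))"
  have c: "c > 0" using C1 by (simp add: c_def)
  define s' where "s' = r - r / p"
  have s': "s' > 0" using p r by (simp add: s'_def field_simps)
  \<comment> \<open>The factor of phi^p obtained by integrating (r/c) t^(s'-1) phi over 0 < t < T,
    where T = (phi/c)^(p/r) solves c T^(r/p) = phi.\<close>
  define C where "C = r / (c * s') * c powr (1 - p)"
  have C: "C > 0" using r c s' by (simp add: C_def)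
  have near: "(\<integral>\<^sup>+z. (if 0 < z \<and> z < \<rho> then ennreal (z powr (-1/2)) else 0) \<partial>lborel) = ennreal (2 * \<rho> powr (1/2))"
      if "\<rho> > 0" for \<rho>
  proof -
    have "(\<integral>\<^sup>+z. (if 0 < z \<and> z < \<rho> then ennreal (z powr (-1/2)) else 0) \<partial>lborel)
        = (\<integral>\<^sup>+z\<in>{0<..<\<rho>}. ennreal (z powr (1/2 - 1)) \<partial>lborel)"
      by (intro nn_integral_cong) (auto simp: indicator_def)
    then show ?thesis using nn_integral_powr_from_0[of "1/2" \<rho>] that by simp
  qed
  show ?thesis
  proof (rule exI[of _ C], intro conjI ballI impI)
    show "C > 0" by (rule C)
    fix \<phi> :: "real \<Rightarrow> real" assume \<phi>[measurable]: "\<phi> \<in> borel_measurable borel"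
      and \<phi>0: "\<forall>\<xi>. 0 \<le> \<phi> \<xi>" and N: "(\<integral>\<^sup>+\<xi>. ennreal (\<phi> \<xi> powr p) \<partial>lborel) \<le> 1"
    define \<psi> where "\<psi> \<eta> = (\<integral>\<^sup>+\<xi>. ennreal (half_kernel (\<eta> - \<xi>) * \<phi> \<xi>) \<partial>lborel)" for \<eta>
    have [measurable]: "\<psi> \<in> borel_measurable borel" unfolding \<psi>_def by measurable
    \<comment> \<open>Young's inequality for products, with the kernel scaled by rho^(1/r). As p'/r
      = s, the p'-th power of the scaled kernel has tail integral 1/s for every rho; together with
      the normalisation of phi this gives \<open>C1\<close> = 1 + 1/s.\<close>
    have far: "(\<integral>\<^sup>+\<xi>. (if \<rho> \<le> \<eta> - \<xi> then ennreal ((\<eta> - \<xi>) powr (-1/2) * \<phi> \<xi>) else 0) \<partial>lborel)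
        \<le> ennreal (C1 * \<rho> powr (- 1 / r))"
      if \<rho>: "\<rho> > 0" for \<rho> \<eta>
    proof -
      define g where "g z = (if \<rho> \<le> z then ennreal (\<rho> powr s * z powr (- s - 1)) else 0)" for z
      have [measurable]: "g \<in> borel_measurable borel" unfolding g_def by measurable
      have "(\<integral>\<^sup>+\<xi>. (if \<rho> \<le> \<eta> - \<xi> then ennreal ((\<eta> - \<xi>) powr (-1/2) * \<phi> \<xi>) else 0) \<partial>lborel)
         \<le> (\<integral>\<^sup>+\<xi>. ennreal (\<rho> powr (- 1 / r)) * (ennreal (\<phi> \<xi> powr p) + g (\<eta> - \<xi>)) \<partial>lborel)"
      proof (rule nn_integral_mono, goal_cases)
        case (1 \<xi>)
        show ?case
        proof (cases "\<rho> \<le> \<eta> - \<xi>")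
          case True
          define z where "z = \<eta> - \<xi>"
          have z: "z > 0" "\<rho> \<le> z" using True \<rho> by (auto simp: z_def)
          have "\<phi> \<xi> * (z powr (-1/2) * \<rho> powr (1 / r)) \<le> \<phi> \<xi> powr p / p + (z powr (-1/2) * \<rho> powr (1 / r)) powr p' /
              p'"
            using p p'1 conj \<phi>0 by (intro Youngs_inequality) auto
          also have "\<dots> \<le> \<phi> \<xi> powr p + (z powr (-1/2) * \<rho> powr (1 / r)) powr p'"
            using p p'1 by (intro add_mono) (auto simp: divide_le_eq mult_le_cancel_left1)
          also have "(z powr (-1/2) * \<rho> powr (1 / r)) powr p' = \<rho> powr s * z powr (- s - 1)"
          proof -
            have "- 1 / 2 * p' = - s - 1" by (simp add: s_def)
            moreover have "1 / r * p' = s" using ps by simp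
            ultimately show ?thesis by (simp only: powr_mult powr_powr mult.commute)
          qed
          finally have le1: "\<rho> powr (- 1 / r) * (\<phi> \<xi> * (z powr (-1/2) * \<rho> powr (1 / r)))
              \<le> \<rho> powr (- 1 / r) * (\<phi> \<xi> powr p + \<rho> powr s * z powr (- s - 1))"
            by (rule mult_left_mono) simp
          have eq: "\<rho> powr (- 1 / r) * (\<phi> \<xi> * (z powr (-1/2) * \<rho> powr (1 / r))) = z powr (-1/2) * \<phi> \<xi>"
            using \<rho> by (simp add: powr_minus field_simps)
          have "ennreal (z powr (-1/2) * \<phi> \<xi>) \<le> ennreal (\<rho> powr (- 1 / r) * (\<phi> \<xi> powr p + \<rho> powr s * z powr (- s -
              1)))"
            using ennreal_leI[OF le1] unfolding eq .
          then show ?thesis using True \<phi>0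
            by (simp add: g_def z_def[symmetric] ennreal_plus[symmetric] ennreal_mult[symmetric] del: ennreal_plus)
        qed simp
      qed
      also have "\<dots> = ennreal (\<rho> powr (- 1 / r)) * ((\<integral>\<^sup>+\<xi>. ennreal (\<phi> \<xi> powr p) \<partial>lborel) + (\<integral>\<^sup>+z. g z \<partial>lborel))"
        by (simp add: nn_integral_cmult nn_integral_add nn_integral_reflect_real(1)[of g])
      also have "(\<integral>\<^sup>+z. g z \<partial>lborel) = ennreal (\<rho> powr s) * (\<integral>\<^sup>+z\<in>{\<rho>..}. ennreal (z powr (- s - 1)) \<partial>lborel)"
        unfolding g_def
        by (subst nn_integral_cmult[symmetric]) (auto simp: indicator_def ennreal_mult intro!: nn_integral_cong)
      also have "\<dots> = ennreal (1 / s)"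
        unfolding nn_integral_powr_to_inf[OF s \<rho>] using \<rho> s by (simp add: ennreal_mult[symmetric] powr_minus)
      also have "ennreal (\<rho> powr (- 1 / r)) * ((\<integral>\<^sup>+\<xi>. ennreal (\<phi> \<xi> powr p) \<partial>lborel) + ennreal (1 / s))
          \<le> ennreal (\<rho> powr (- 1 / r)) * (1 + ennreal (1 / s))"
        by (intro mult_left_mono add_mono N) auto
      also have "\<dots> = ennreal (C1 * \<rho> powr (- 1 / r))"
        using s by (simp add: C1_def ennreal_mult mult.commute)
      finally show ?thesis .
    qed
    have level: "(\<integral>\<^sup>+\<eta>. (if ennreal t < \<psi> \<eta> then 1 else 0) \<partial>lborel)
        \<le> ennreal (1 / (c * t powr (r / p))) * (\<integral>\<^sup>+\<xi>. (if c * t powr (r / p) < \<phi> \<xi> then ennreal (\<phi> \<xi>) else 0) \<partial>lborel)"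
      if t: "t > 0" for t
    proof -
      \<comment> \<open>This cut makes the far part at most t/2.\<close>
      define \<rho> where "\<rho> = (2 * C1 / t) powr r"
      have \<rho>: "\<rho> > 0" using C1 t by (simp add: \<rho>_def)
      have \<rho>r: "C1 * \<rho> powr (- 1 / r) = t / 2"
        using C1 t r by (simp add: \<rho>_def powr_powr powr_minus field_simps)
      define a where "a = c * t powr (r / p)"
      have a: "a > 0" using c t by (simp add: a_def)
      have a\<rho>: "a * (2 * \<rho> powr (1 / 2)) = t / 4"
      proof -
        have "\<rho> powr (1 / 2) = (2 * C1) powr (r / 2) / t powr (r / 2)"
          using C1 t by (simp add: \<rho>_def powr_powr powr_divide)
        moreover have "t powr (r / p) = t * t powr (r / 2)" unfolding rp using t by (simp add: powr_add)
        ultimately show ?thesis using C1 t by (simp add: a_def c_def)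
      qed
      define h where "h z = (if 0 < z \<and> z < \<rho> then ennreal (z powr (-1/2)) else 0)" for z
      have [measurable]: "h \<in> borel_measurable borel" unfolding h_def by measurable
      have inth: "(\<integral>\<^sup>+z. h z \<partial>lborel) = ennreal (2 * \<rho> powr (1/2))" unfolding h_def by (rule near[OF \<rho>])
      define f where "f \<xi> = (if a < \<phi> \<xi> then ennreal (\<phi> \<xi>) else 0)" for \<xi>
      have [measurable]: "f \<in> borel_measurable borel" unfolding f_def by measurable
      define B where "B \<eta> = (\<integral>\<^sup>+\<xi>. h (\<eta> - \<xi>) * f \<xi> \<partial>lborel)" for \<eta>
      have [measurable]: "B \<in> borel_measurable borel" unfolding B_def by measurable
      have split: "\<psi> \<eta> \<le> ennreal (t / 2) + ennreal (t / 4) + B \<eta>" for \<eta>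
      proof -
        have "\<psi> \<eta> \<le> (\<integral>\<^sup>+\<xi>. (if \<rho> \<le> \<eta> - \<xi> then ennreal ((\<eta> - \<xi>) powr (-1/2) * \<phi> \<xi>) else 0) + ennreal a * h (\<eta> - \<xi>)
            + h (\<eta> - \<xi>) * f \<xi> \<partial>lborel)"
          unfolding \<psi>_def
        proof (rule nn_integral_mono, goal_cases)
          case (1 \<xi>)
          show ?case
          proof (cases "0 < \<eta> - \<xi> \<and> \<eta> - \<xi> < \<rho>")
            case True
            show ?thesis
            proof (cases "a < \<phi> \<xi>")
              case True
              then show ?thesis using \<open>0 < \<eta> - \<xi> \<and> \<eta> - \<xi> < \<rho>\<close> \<phi>0
                by (auto simp: half_kernel_def h_def f_def ennreal_mult[symmetric] intro: order_trans[OF _ le_add2]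
                    add_increasing)
            next
              case False
              then have "half_kernel (\<eta> - \<xi>) * \<phi> \<xi> \<le> a * (\<eta> - \<xi>) powr (-1/2)"
                using True by (simp add: half_kernel_def mult.commute[of a] mult_left_mono)
              then have "ennreal (half_kernel (\<eta> - \<xi>) * \<phi> \<xi>) \<le> ennreal a * h (\<eta> - \<xi>)"
                using True a by (simp add: h_def ennreal_mult[symmetric] ennreal_leI)
              then show ?thesis by (meson add_increasing add_increasing2 order_trans zero_le)
            qed
          next
            case False
            then show ?thesis using \<rho> by (auto simp: half_kernel_def add_increasing2)
          qed
        qed
        also have "\<dots> = (\<integral>\<^sup>+\<xi>. (if \<rho> \<le> \<eta> - \<xi> then ennreal ((\<eta> - \<xi>) powr (-1/2) * \<phi> \<xi>) else 0) \<partial>lborel)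
            + ennreal a * ennreal (2 * \<rho> powr (1/2)) + B \<eta>"
          unfolding inth[symmetric] B_def by (simp add: nn_integral_add nn_integral_cmult
              nn_integral_reflect_real(1)[of h])
        also have "ennreal a * ennreal (2 * \<rho> powr (1/2)) = ennreal (t / 4)"
          by (simp only: ennreal_mult'[OF less_imp_le[OF a], symmetric] a\<rho>)
        also have "(\<integral>\<^sup>+\<xi>. (if \<rho> \<le> \<eta> - \<xi> then ennreal ((\<eta> - \<xi>) powr (-1/2) * \<phi> \<xi>) else 0) \<partial>lborel) \<le> ennreal (t / 2)"
          using far[OF \<rho>, of \<eta>] unfolding \<rho>r .
        finally show ?thesis by (simp add: add_right_mono)
      qed
      \<comment> \<open>If psi exceeds t, the remaining part \<open>B\<close> is at least t/4, so
        the level set is controlled by 4/t times the integral of \<open>B\<close>.\<close>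
      have "(\<integral>\<^sup>+\<eta>. (if ennreal t < \<psi> \<eta> then 1 else 0) \<partial>lborel) \<le> (\<integral>\<^sup>+\<eta>. ennreal (4 / t) * B \<eta> \<partial>lborel)"
      proof (rule nn_integral_mono, goal_cases)
        case (1 \<eta>)
        have "ennreal (t / 4) \<le> B \<eta>" if "ennreal t < \<psi> \<eta>"
        proof (rule ccontr)
          assume "\<not> ennreal (t / 4) \<le> B \<eta>"
          then have "ennreal (t / 2) + ennreal (t / 4) + B \<eta> \<le> ennreal (t / 2) + ennreal (t / 4) + ennreal (t / 4)"
            by (intro add_mono) auto
          also have "\<dots> = ennreal t" using t by (simp add: ennreal_plus[symmetric] del: ennreal_plus)
          finally show False using split[of \<eta>] that by (meson leD order_trans)
        qed
        then have "ennreal (4 / t) * ennreal (t / 4) \<le> ennreal (4 / t) * B \<eta>" if "ennreal t < \<psi> \<eta>"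
          using that by (intro mult_left_mono) auto
        then show ?case using t by (auto simp: ennreal_mult[symmetric])
      qed
      also have "\<dots> = ennreal (4 / t) * (\<integral>\<^sup>+\<eta>. B \<eta> \<partial>lborel)" by (rule nn_integral_cmult) measurable
      also have "(\<integral>\<^sup>+\<eta>. B \<eta> \<partial>lborel) = (\<integral>\<^sup>+\<xi>. (\<integral>\<^sup>+\<eta>. h (\<eta> - \<xi>) * f \<xi> \<partial>lborel) \<partial>lborel)"
        unfolding B_def by (rule lborel_pair.Fubini') measurable
      also have "\<dots> = ennreal (2 * \<rho> powr (1/2)) * (\<integral>\<^sup>+\<xi>. f \<xi> \<partial>lborel)"
        by (simp add: nn_integral_multc nn_integral_reflect_real(2)[of h] inth nn_integral_cmult)
      also have "ennreal (4 / t) * (ennreal (2 * \<rho> powr (1/2)) * (\<integral>\<^sup>+\<xi>. f \<xi> \<partial>lborel))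
          = ennreal (1 / a) * (\<integral>\<^sup>+\<xi>. f \<xi> \<partial>lborel)"
      proof -
        have "4 / t * (2 * \<rho> powr (1/2)) = 1 / a" using a\<rho> a t by (simp add: field_simps)
        then show ?thesis using t by (simp add: mult.assoc[symmetric] ennreal_mult[symmetric])
      qed
      finally show ?thesis unfolding f_def a_def .
    qed
    \<comment> \<open>\<open>L\<close> keeps infinite values of psi visible, whereas
      \<open>enn2real\<close> would turn them into 0. Bounding its integral yields finiteness almost
      everywhere first and the estimate afterwards.\<close>
    define L where "L \<eta> = (\<integral>\<^sup>+t. (if 0 < t \<and> ennreal t < \<psi> \<eta> then ennreal (r * t powr (r - 1)) else 0) \<partial>lborel)" for \<eta>
    have [measurable]: "L \<in> borel_measurable borel" unfolding L_def by measurable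
    have "(\<integral>\<^sup>+\<eta>. L \<eta> \<partial>lborel) = (\<integral>\<^sup>+t. (\<integral>\<^sup>+\<eta>. (if 0 < t \<and> ennreal t < \<psi> \<eta> then ennreal (r * t powr (r - 1)) else 0)
        \<partial>lborel) \<partial>lborel)"
      unfolding L_def by (rule lborel_pair.Fubini') measurable
    also have "\<dots> \<le> (\<integral>\<^sup>+t. (\<integral>\<^sup>+\<xi>. (if 0 < t \<and> c * t powr (r / p) < \<phi> \<xi> then ennreal (r / c * t powr (s' - 1))
        * ennreal (\<phi> \<xi>) else 0) \<partial>lborel) \<partial>lborel)"
    proof (rule nn_integral_mono, goal_cases)
      case (1 t)
      show ?case
      proof (cases "0 < t")
        case True
        have "(\<integral>\<^sup>+\<eta>. (if 0 < t \<and> ennreal t < \<psi> \<eta> then ennreal (r * t powr (r - 1)) else 0) \<partial>lborel)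
           = ennreal (r * t powr (r - 1)) * (\<integral>\<^sup>+\<eta>. (if ennreal t < \<psi> \<eta> then 1 else 0) \<partial>lborel)"
          using True by (subst nn_integral_cmult[symmetric]) (auto intro!: nn_integral_cong)
        also have "\<dots> \<le> ennreal (r * t powr (r - 1)) * (ennreal (1 / (c * t powr (r / p))) * (\<integral>\<^sup>+\<xi>. (if c
            * t powr (r / p) < \<phi> \<xi> then ennreal (\<phi> \<xi>) else 0) \<partial>lborel))"
          by (intro mult_left_mono level True) simp
        also have "\<dots> = ennreal (r * t powr (r - 1) * (1 / (c * t powr (r / p)))) * (\<integral>\<^sup>+\<xi>. (if c * t powr (r / p)
            < \<phi> \<xi> then ennreal (\<phi> \<xi>) else 0) \<partial>lborel)"
          using r c by (simp add: ennreal_mult[symmetric] mult.assoc[symmetric])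
        also have "r * t powr (r - 1) * (1 / (c * t powr (r / p))) = r / c * t powr (s' - 1)"
        proof -
          have "t powr (s' - 1) = t powr (r - 1 - r / p)" by (simp add: s'_def algebra_simps)
          then show ?thesis by (simp add: powr_diff)
        qed
        also have "ennreal (r / c * t powr (s' - 1)) * (\<integral>\<^sup>+\<xi>. (if c * t powr (r / p)
            < \<phi> \<xi> then ennreal (\<phi> \<xi>) else 0) \<partial>lborel)
           = (\<integral>\<^sup>+\<xi>. (if 0 < t \<and> c * t powr (r / p) < \<phi> \<xi> then ennreal (r / c * t powr (s' - 1)) * ennreal (\<phi> \<xi>) else 0)
               \<partial>lborel)"
          using True by (subst nn_integral_cmult[symmetric]) (auto intro!: nn_integral_cong)
        finally show ?thesis .
      qed simp
    qed
    also have "\<dots> = (\<integral>\<^sup>+\<xi>. (\<integral>\<^sup>+t. (if 0 < t \<and> c * t powr (r / p) < \<phi> \<xi> then ennreal (r / c * t powr (s' - 1))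
        * ennreal (\<phi> \<xi>) else 0) \<partial>lborel) \<partial>lborel)"
      by (rule lborel_pair.Fubini') measurable
    also have "\<dots> = (\<integral>\<^sup>+\<xi>. ennreal C * ennreal (\<phi> \<xi> powr p) \<partial>lborel)"
    proof (rule nn_integral_cong, goal_cases)
      case (1 \<xi>)
      define T where "T = (\<phi> \<xi> / c) powr (p / r)"
      have iff: "c * t powr (r / p) < \<phi> \<xi> \<longleftrightarrow> t < T" if "0 < t" for t
      proof -
        have "c * t powr (r / p) < \<phi> \<xi> \<longleftrightarrow> t powr (r / p) < \<phi> \<xi> / c" using c by (simp add: field_simps)
        also have "\<dots> \<longleftrightarrow> (t powr (r / p)) powr (p / r) < T"
        proof
          assume "t powr (r / p) < \<phi> \<xi> / c"
          then show "(t powr (r / p)) powr (p / r) < T" unfolding T_def using p r by (intro powr_less_mono2) auto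
        next
          assume *: "(t powr (r / p)) powr (p / r) < T"
          show "t powr (r / p) < \<phi> \<xi> / c"
          proof (rule ccontr)
            assume "\<not> t powr (r / p) < \<phi> \<xi> / c"
            then have "T \<le> (t powr (r / p)) powr (p / r)" unfolding T_def using p r c \<phi>0 by (intro powr_mono2) auto
            with * show False by simp
          qed
        qed
        also have "(t powr (r / p)) powr (p / r) = t" using p r that by (simp add: powr_powr)
        finally show ?thesis .
      qed
      have "(\<integral>\<^sup>+t. (if 0 < t \<and> c * t powr (r / p) < \<phi> \<xi> then ennreal (r / c * t powr (s' - 1)) * ennreal (\<phi> \<xi>) else 0)
          \<partial>lborel)
         = (\<integral>\<^sup>+t. ennreal (r / c * \<phi> \<xi>) * (ennreal (t powr (s' - 1)) * indicator {0<..<T} t) \<partial>lborel)"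
        using r c \<phi>0 by (intro nn_integral_cong) (auto simp: iff indicator_def ennreal_mult[symmetric] mult_ac)
      also have "\<dots> = ennreal (r / c * \<phi> \<xi>) * ennreal (T powr s' / s')"
        using nn_integral_powr_from_0[OF s', of T] by (subst nn_integral_cmult) (auto simp: T_def)
      also have "\<dots> = ennreal (C * \<phi> \<xi> powr p)"
      proof -
        have "p / r * s' = p - 1" using p r by (simp add: s'_def field_simps)
        then have Ts: "T powr s' = \<phi> \<xi> powr (p - 1) / c powr (p - 1)"
          using c \<phi>0 by (simp add: T_def powr_powr powr_divide)
        have ph: "\<phi> \<xi> powr p = \<phi> \<xi> * \<phi> \<xi> powr (p - 1)"
        proof (cases "\<phi> \<xi> = 0")
          case False
          then have "\<phi> \<xi> > 0" using \<phi>0 by (simp add: less_le)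
          then show ?thesis by (simp add: powr_diff)
        qed simp
        have "c powr (1 - p) = 1 / c powr (p - 1)" by (simp add: powr_minus_divide[symmetric])
        then have "r / c * \<phi> \<xi> * (T powr s' / s') = C * \<phi> \<xi> powr p"
          unfolding Ts C_def ph by (simp add: mult_ac)
        then show ?thesis using r c \<phi>0 s' by (simp add: ennreal_mult[symmetric])
      qed
      finally show ?case using C by (simp add: ennreal_mult)
    qed
    also have "\<dots> = ennreal C * (\<integral>\<^sup>+\<xi>. ennreal (\<phi> \<xi> powr p) \<partial>lborel)" by (rule nn_integral_cmult) measurable
    also have "\<dots> \<le> ennreal C * 1" by (rule mult_left_mono[OF N]) simp
    finally have LC: "(\<integral>\<^sup>+\<eta>. L \<eta> \<partial>lborel) \<le> ennreal C" by simp
    then have "(\<integral>\<^sup>+\<eta>. L \<eta> \<partial>lborel) \<noteq> \<infinity>" by (auto simp: top_unique)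
    then have "AE \<eta> in lborel. L \<eta> \<noteq> \<infinity>" by (intro nn_integral_PInf_AE) auto
    then have fin: "AE \<eta> in lborel. \<psi> \<eta> < \<infinity>"
    proof eventually_elim
      case (elim \<eta>)
      then show ?case using nn_integral_layer_cake(2)[OF r(1), of "\<psi> \<eta>"] unfolding L_def by (simp add: less_top)
    qed
    then show "AE \<eta> in lborel. (\<integral>\<^sup>+\<xi>. ennreal (half_kernel (\<eta> - \<xi>) * \<phi> \<xi>) \<partial>lborel) < \<infinity>" unfolding \<psi>_def .
    have "(\<integral>\<^sup>+\<eta>. ennreal (enn2real (\<psi> \<eta>) powr r) \<partial>lborel) = (\<integral>\<^sup>+\<eta>. L \<eta> \<partial>lborel)"
    proof (rule nn_integral_cong_AE, use fin in eventually_elim)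
      fix \<eta> assume "\<psi> \<eta> < \<infinity>"
      then show "ennreal (enn2real (\<psi> \<eta>) powr r) = L \<eta>"
        unfolding L_def by (rule nn_integral_layer_cake(1)[OF r(1), symmetric])
    qed
    with LC show "(\<integral>\<^sup>+\<eta>. ennreal (enn2real (\<integral>\<^sup>+\<xi>. ennreal (half_kernel (\<eta> - \<xi>) * \<phi> \<xi>) \<partial>lborel) powr r) \<partial>lborel)
        \<le> ennreal C"
      unfolding \<psi>_def by simp
  qed
qed

text \<open>Both sides are homogeneous, so dividing phi by N^(1/p) reduces to the normalised case;
  for N = 0 the function vanishes almost everywhere.\<close>

lemma fractional_half:
  fixes p r :: real
  assumes p: "1 < p" and r: "r > 0" "1 / p - 1 / r = 1 / 2"
  shows "\<exists>C>0. \<forall>\<phi>\<in>borel_measurable borel. \<forall>N. (\<forall>\<xi>. 0 \<le> \<phi> \<xi>) \<longrightarrow> 0 \<le> N \<longrightarrow> (\<integral>\<^sup>+\<xi>. ennreal (\<phi> \<xi> powr p) \<partial>lborel)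
      = ennreal N \<longrightarrow>
     (AE \<eta> in lborel. (\<integral>\<^sup>+\<xi>. ennreal (half_kernel (\<eta> - \<xi>) * \<phi> \<xi>) \<partial>lborel) < \<infinity>) \<and>
     (\<integral>\<^sup>+\<eta>. ennreal (enn2real (\<integral>\<^sup>+\<xi>. ennreal (half_kernel (\<eta> - \<xi>) * \<phi> \<xi>) \<partial>lborel) powr r) \<partial>lborel)
         \<le> ennreal (C * N powr (r / p))"
proof -
  obtain C where C: "C > 0" "\<forall>\<phi>\<in>borel_measurable borel. (\<forall>\<xi>. 0 \<le> \<phi> \<xi>) \<longrightarrow> (\<integral>\<^sup>+\<xi>. ennreal (\<phi> \<xi> powr p) \<partial>lborel) \<le> 1 \<longrightarrow>
     (AE \<eta> in lborel. (\<integral>\<^sup>+\<xi>. ennreal (half_kernel (\<eta> - \<xi>) * \<phi> \<xi>) \<partial>lborel) < \<infinity>) \<and>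
     (\<integral>\<^sup>+\<eta>. ennreal (enn2real (\<integral>\<^sup>+\<xi>. ennreal (half_kernel (\<eta> - \<xi>) * \<phi> \<xi>) \<partial>lborel) powr r) \<partial>lborel) \<le> ennreal C"
    using fractional_half_normalized[OF assms] by blast
  show ?thesis
  proof (rule exI[of _ C], intro conjI[OF C(1)] ballI allI impI)
    fix \<phi> :: "real \<Rightarrow> real" and N assume \<phi>[measurable]: "\<phi> \<in> borel_measurable borel"
      and \<phi>0: "\<forall>\<xi>. 0 \<le> \<phi> \<xi>" and N: "0 \<le> N" "(\<integral>\<^sup>+\<xi>. ennreal (\<phi> \<xi> powr p) \<partial>lborel) = ennreal N"
    show "(AE \<eta> in lborel. (\<integral>\<^sup>+\<xi>. ennreal (half_kernel (\<eta> - \<xi>) * \<phi> \<xi>) \<partial>lborel) < \<infinity>) \<and>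
     (\<integral>\<^sup>+\<eta>. ennreal (enn2real (\<integral>\<^sup>+\<xi>. ennreal (half_kernel (\<eta> - \<xi>) * \<phi> \<xi>) \<partial>lborel) powr r) \<partial>lborel)
         \<le> ennreal (C * N powr (r / p))"
    proof (cases "N = 0")
      case True
      then have "(\<integral>\<^sup>+\<xi>. ennreal (\<phi> \<xi> powr p) \<partial>lborel) = 0" using N by simp
      then have "AE \<xi> in lborel. ennreal (\<phi> \<xi> powr p) = 0" by (subst (asm) nn_integral_0_iff_AE) auto
      then have ae: "AE \<xi> in lborel. \<phi> \<xi> = 0" by eventually_elim (auto simp: ennreal_eq_0_iff)
      have "(\<integral>\<^sup>+\<xi>. ennreal (half_kernel (\<eta> - \<xi>) * \<phi> \<xi>) \<partial>lborel) = (\<integral>\<^sup>+(\<xi> :: real). 0 \<partial>lborel)" for \<eta>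
        by (rule nn_integral_cong_AE, use ae in eventually_elim) simp
      then show ?thesis by simp
    next
      case False
      then have N0: "N > 0" using N by simp
      define m where "m = N powr (1 / p)"
      have m: "m > 0" using N0 by (simp add: m_def)
      have mp: "m powr p = N" using N0 p by (simp add: m_def powr_powr)
      define \<phi>' where "\<phi>' \<xi> = \<phi> \<xi> / m" for \<xi>
      have [measurable]: "\<phi>' \<in> borel_measurable borel" unfolding \<phi>'_def by measurable
      have "(\<integral>\<^sup>+\<xi>. ennreal (\<phi>' \<xi> powr p) \<partial>lborel) = (\<integral>\<^sup>+\<xi>. ennreal (1 / N) * ennreal (\<phi> \<xi> powr p) \<partial>lborel)"
        unfolding \<phi>'_def using m \<phi>0 N0 by (intro nn_integral_cong) (simp add: powr_divide mp ennreal_mult[symmetric])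
      also have "\<dots> = ennreal (1 / N) * ennreal N" unfolding N(2)[symmetric] by (rule nn_integral_cmult) measurable
      also have "\<dots> = 1" using N0 by (simp add: ennreal_mult[symmetric])
      finally have one: "(\<integral>\<^sup>+\<xi>. ennreal (\<phi>' \<xi> powr p) \<partial>lborel) \<le> 1" by simp
      have scale: "(\<integral>\<^sup>+\<xi>. ennreal (half_kernel (\<eta> - \<xi>) * \<phi> \<xi>) \<partial>lborel) = ennreal m * (\<integral>\<^sup>+\<xi>. ennreal (half_kernel (\<eta> - \<xi>)
          * \<phi>' \<xi>) \<partial>lborel)" for \<eta>
        using m by (subst nn_integral_cmult[symmetric]) (auto intro!: nn_integral_cong simp: \<phi>'_def
            ennreal_mult'[symmetric])
      have *: "(AE \<eta> in lborel. (\<integral>\<^sup>+\<xi>. ennreal (half_kernel (\<eta> - \<xi>) * \<phi>' \<xi>) \<partial>lborel) < \<infinity>)"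
        "(\<integral>\<^sup>+\<eta>. ennreal (enn2real (\<integral>\<^sup>+\<xi>. ennreal (half_kernel (\<eta> - \<xi>) * \<phi>' \<xi>) \<partial>lborel) powr r) \<partial>lborel) \<le> ennreal C"
        using C(2)[rule_format, of \<phi>', OF _ _ one] m \<phi>0 by (auto simp: \<phi>'_def)
      show ?thesis
      proof
        show "AE \<eta> in lborel. (\<integral>\<^sup>+\<xi>. ennreal (half_kernel (\<eta> - \<xi>) * \<phi> \<xi>) \<partial>lborel) < \<infinity>"
          using *(1) unfolding scale by eventually_elim (auto simp: ennreal_mult_less_top)
        have "(\<integral>\<^sup>+\<eta>. ennreal (enn2real (\<integral>\<^sup>+\<xi>. ennreal (half_kernel (\<eta> - \<xi>) * \<phi> \<xi>) \<partial>lborel) powr r) \<partial>lborel)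
           = (\<integral>\<^sup>+\<eta>. ennreal (m powr r) * ennreal (enn2real (\<integral>\<^sup>+\<xi>. ennreal (half_kernel (\<eta> - \<xi>) * \<phi>' \<xi>) \<partial>lborel) powr r)
               \<partial>lborel)"
          unfolding scale using m by (intro nn_integral_cong) (simp add: enn2real_mult powr_mult
              ennreal_mult[symmetric])
        also have "\<dots> = ennreal (m powr r) * (\<integral>\<^sup>+\<eta>. ennreal (enn2real (\<integral>\<^sup>+\<xi>. ennreal (half_kernel (\<eta> - \<xi>)
            * \<phi>' \<xi>) \<partial>lborel) powr r) \<partial>lborel)"
          by (rule nn_integral_cmult) measurable
        also have "\<dots> \<le> ennreal (m powr r) * ennreal C" by (rule mult_left_mono[OF *(2)]) simp
        also have "\<dots> = ennreal (C * N powr (r / p))" using C by (simp add: ennreal_mult[symmetric] m_def powr_powr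
            mult.commute)
        finally show "(\<integral>\<^sup>+\<eta>. ennreal (enn2real (\<integral>\<^sup>+\<xi>. ennreal (half_kernel (\<eta> - \<xi>) * \<phi> \<xi>) \<partial>lborel) powr r) \<partial>lborel)
            \<le> ennreal (C * N powr (r / p))" .
      qed
    qed
  qed
qed

section \<open>Sufficiency\<close>

lemma logistic_ratio: "logistic \<xi> / (1 - logistic \<xi>) = exp \<xi>"
  by (simp add: one_minus_logistic) (simp add: logistic_def add_pos_pos less_imp_neq[symmetric])

lemma logistic_cross_ratio:
  "logistic \<xi> / logistic \<eta> * ((1 - logistic \<eta>) / (1 - logistic \<xi>)) = exp (\<xi> - \<eta>)"
proof -
  have "logistic \<xi> / logistic \<eta> * ((1 - logistic \<eta>) / (1 - logistic \<xi>))
     = (logistic \<xi> / (1 - logistic \<xi>)) / (logistic \<eta> / (1 - logistic \<eta>))" by simp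
  then show ?thesis unfolding logistic_ratio by (simp add: exp_diff)
qed

text \<open>Separates the singular factor 1 - sigma/tau of the Radon kernel into a function of the
  difference eta - xi and a weight at the endpoint 1.\<close>

lemma one_minus_logistic_quotient:
  "1 - logistic \<xi> / logistic \<eta> = (1 - exp (\<xi> - \<eta>)) * (1 - logistic \<xi>)"
proof -
  have nz: "1 + exp x \<noteq> 0" for x :: real by (smt (verit) exp_gt_zero)
  have "logistic \<xi> / logistic \<eta> = exp (\<xi> - \<eta>) * (1 + exp \<eta>) / (1 + exp \<xi>)"
    by (simp add: logistic_def exp_diff)
  also have "\<dots> = (exp (\<xi> - \<eta>) + exp \<xi>) / (1 + exp \<xi>)"
    by (simp add: distrib_left exp_add[symmetric])
  finally have q: "logistic \<xi> / logistic \<eta> = (exp (\<xi> - \<eta>) + exp \<xi>) / (1 + exp \<xi>)" .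
  show ?thesis unfolding one_minus_logistic q using nz[of \<xi>] by (simp add: field_simps)
qed

text \<open>The Radon kernel in logistic coordinates, multiplied by the target weight (exponents
  gamma', b) and divided by the source weight (exponents gamma, a), so that both norms on the line
  are unweighted. The exponent 1/2 and the factor \<open>1 - logistic \<xi>\<close> already include
  the Jacobian.\<close>

definition log_kernel :: "nat \<Rightarrow> real \<Rightarrow> real \<Rightarrow> real \<Rightarrow> real \<Rightarrow> real \<Rightarrow> real \<Rightarrow> real" where
  "log_kernel k \<gamma> \<gamma>' a b \<eta> \<xi> = (if \<xi> < \<eta> then
     logistic \<eta> powr \<gamma>' * (1 - logistic \<eta>) powr b *
     ((logistic \<xi> / logistic \<eta>) powr (1 / 2) * (1 - logistic \<xi> / logistic \<eta>) powr (real k / 2 - 1) * (1 - logistic \<xi>))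
         /
     (logistic \<xi> powr \<gamma> * (1 - logistic \<xi>) powr a) else 0)"

lemma log_kernel_measurable [measurable]:
  "case_prod (log_kernel k \<gamma> \<gamma>' a b) \<in> borel_measurable (borel \<Otimes>\<^sub>M borel)"
  unfolding log_kernel_def by measurable

lemma log_kernel_nonneg: "0 \<le> log_kernel k \<gamma> \<gamma>' a b \<eta> \<xi>"
  unfolding log_kernel_def by (auto simp: less_imp_le)

definition log_density :: "real \<Rightarrow> real \<Rightarrow> (real \<Rightarrow> real) \<Rightarrow> real \<Rightarrow> real" where
  "log_density \<gamma> a F \<xi> = \<bar>F (sqrt (logistic \<xi>))\<bar> * (logistic \<xi> powr \<gamma> * (1 - logistic \<xi>) powr a)"

lemma log_density_measurable [measurable]:
  assumes [measurable]: "F \<in> borel_measurable borel"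
  shows "log_density \<gamma> a F \<in> borel_measurable borel"
  unfolding log_density_def by measurable

lemma log_density_nonneg: "0 \<le> log_density \<gamma> a F \<xi>"
  unfolding log_density_def by simp

lemma radon_profile_logistic:
  assumes [measurable]: "F \<in> borel_measurable borel"
  shows "ennreal (logistic \<eta> powr \<gamma>' * (1 - logistic \<eta>) powr b) * radon_profile k F (logistic \<eta>)
     = (\<integral>\<^sup>+\<xi>. ennreal (log_kernel k \<gamma> \<gamma>' a b \<eta> \<xi> * log_density \<gamma> a F \<xi>) \<partial>lborel)"
proof -
  define T where "T = logistic \<eta>"
  have T: "0 < T" "T < 1" by (simp_all add: T_def)
  define f where "f x = (if x < T then ennreal \<bar>F (sqrt x)\<bar> * ennreal ((x / T) powr (1 / 2 - 1) * (1 - x / T) powr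
      (real k / 2 - 1) / T) else 0)" for x
  have [measurable]: "f \<in> borel_measurable borel" unfolding f_def by measurable
  have "radon_profile k F T = (\<integral>\<^sup>+\<sigma>\<in>{0<..<1}. f (T * \<sigma>) * ennreal T \<partial>lborel)"
    unfolding radon_profile_def f_def using T
    by (intro nn_integral_cong) (auto simp: indicator_def mult.assoc ennreal_mult[symmetric] mult_less_cancel_left1)
  also have "\<dots> = (\<integral>\<^sup>+x\<in>{0<..<T}. f x \<partial>lborel)"
    by (rule nn_integral_scale_real[symmetric]) (use T in auto)
  also have "\<dots> = (\<integral>\<^sup>+x\<in>{0<..<1}. f x \<partial>lborel)"
    using T by (intro nn_integral_cong) (auto simp: indicator_def f_def)
  also have "\<dots> = (\<integral>\<^sup>+\<xi>. f (logistic \<xi>) * ennreal (logistic \<xi> * (1 - logistic \<xi>)) \<partial>lborel)"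
    by (rule nn_integral_logistic) measurable
  finally have "ennreal (T powr \<gamma>' * (1 - T) powr b) * radon_profile k F T
      = (\<integral>\<^sup>+\<xi>. ennreal (T powr \<gamma>' * (1 - T) powr b) * (f (logistic \<xi>) * ennreal (logistic \<xi> * (1 - logistic \<xi>)))
          \<partial>lborel)"
    by (simp add: nn_integral_cmult)
  also have "\<dots> = (\<integral>\<^sup>+\<xi>. ennreal (log_kernel k \<gamma> \<gamma>' a b \<eta> \<xi> * log_density \<gamma> a F \<xi>) \<partial>lborel)"
  proof (rule nn_integral_cong, goal_cases)
    case (1 \<xi>)
    define L where "L = logistic \<xi>"
    have L: "0 < L" "L < 1" by (simp_all add: L_def)
    show ?case
    proof (cases "\<xi> < \<eta>")
      case True
      then have LT: "L < T" by (simp add: L_def T_def)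
      \<comment> \<open>The Jacobian factor L, together with the 1/T from rescaling, raises the
        exponent of L/T from -1/2 to 1/2.\<close>
      have half: "(L / T) powr (1 / 2 - 1) / T * L = (L / T) powr (1 / 2)"
      proof -
        have "(L / T) powr (1 / 2) = (L / T) powr (1 / 2 - 1 + 1)" by simp
        also have "\<dots> = (L / T) powr (1 / 2 - 1) * (L / T)" using L T by (subst powr_add) simp
        finally show ?thesis by simp
      qed
      have "(L / T) powr (1 / 2 - 1) * (1 - L / T) powr (real k / 2 - 1) / T * (L * (1 - L))
          = (L / T) powr (1 / 2) * (1 - L / T) powr (real k / 2 - 1) * (1 - L)"
        unfolding half[symmetric] by simp
      moreover have "log_kernel k \<gamma> \<gamma>' a b \<eta> \<xi> * log_density \<gamma> a F \<xi>
        = T powr \<gamma>' * (1 - T) powr b * (\<bar>F (sqrt L)\<bar> * ((L / T) powr (1 / 2) * (1 - L / T) powr (real k / 2 - 1) * (1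
            - L)))"
        using True L unfolding log_kernel_def log_density_def L_def[symmetric] T_def[symmetric] by simp
      moreover have "f L * ennreal (L * (1 - L)) = ennreal (\<bar>F (sqrt L)\<bar> * ((L / T) powr (1 / 2 - 1)
          * (1 - L / T) powr (real k / 2 - 1) / T * (L * (1 - L))))"
        using LT L T by (simp add: f_def ennreal_mult[symmetric] mult.assoc)
      ultimately show ?thesis unfolding L_def[symmetric] using L T by (simp add: ennreal_mult)
    next
      case False
      then show ?thesis by (auto simp: log_kernel_def f_def T_def)
    qed
  qed
  finally show ?thesis unfolding T_def .
qed

lemma sphere_weighted_logistic:
  assumes [measurable]: "F \<in> borel_measurable borel" and p: "p > 0"
  shows "sphere_weighted n p \<alpha>1 \<alpha>2 F
    = (\<integral>\<^sup>+\<xi>. ennreal (log_density ((\<alpha>2 + 1) / (2 * p)) ((\<alpha>1 + real n) / (2 * p)) F \<xi> powr p) \<partial>lborel)"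
  unfolding sphere_weighted_def
proof (subst nn_integral_logistic, measurable, rule nn_integral_cong, goal_cases)
  case (1 \<xi>)
  define L where "L = logistic \<xi>"
  have L: "0 < L" "L < 1" by (simp_all add: L_def)
  have "cone_weight u v L * (L * (1 - L)) = L powr u * (1 - L) powr v" for u v
    unfolding cone_weight_def using L by (simp add: powr_diff)
  moreover have "(L powr (u / (2 * p)) * (1 - L) powr (v / (2 * p))) powr p = L powr (u / 2) * (1 - L) powr (v / 2)"
      for u v
    using L p by (simp add: powr_mult powr_powr)
  ultimately show ?case
    using L by (simp add: log_density_def L_def[symmetric] powr_mult ennreal_mult[symmetric] mult.assoc)
qed

lemma profile_weighted_logistic:
  fixes \<beta>1 \<beta>2 :: real and n k :: nat
  assumes [measurable]: "F \<in> borel_measurable borel" and r: "r > 0"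
  defines "\<gamma>' \<equiv> (\<beta>2 + real k + 1) / (2 * r)" and "b \<equiv> (\<beta>1 + real n - real k) / (2 * r)"
  shows "profile_weighted n k r \<beta>1 \<beta>2 F
    = (\<integral>\<^sup>+\<eta>. ennreal (enn2real (\<integral>\<^sup>+\<xi>. ennreal (log_kernel k \<gamma> \<gamma>' a b \<eta> \<xi> * log_density \<gamma> a F \<xi>) \<partial>lborel) powr r)
        \<partial>lborel)"
  unfolding profile_weighted_def radon_profile_logistic[OF assms(1), symmetric]
proof (subst nn_integral_logistic, measurable, rule nn_integral_cong, goal_cases)
  case (1 \<eta>)
  define L where "L = logistic \<eta>"
  have L: "0 < L" "L < 1" by (simp_all add: L_def)
  have "cone_weight u v L * (L * (1 - L)) = L powr u * (1 - L) powr v" for u v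
    unfolding cone_weight_def using L by (simp add: powr_diff)
  moreover have "(L powr \<gamma>' * (1 - L) powr b) powr r = L powr ((\<beta>2 + real k + 1) / 2) * (1 - L) powr ((\<beta>1
      + real n - real k) / 2)"
    using L r by (simp add: \<gamma>'_def b_def powr_mult powr_powr)
  ultimately show ?case
    using L by (simp add: L_def[symmetric] enn2real_mult powr_mult ennreal_mult[symmetric] mult_ac)
qed

text \<open>The exact product formula contains (1-tau)^b (1-sigma)^(k/2-a). Because a - b <= k/2,
  which is the second condition of (N), the exponent k/2 - a can be lowered to -b.\<close>

lemma log_kernel_le:
  assumes lt: "\<xi> < \<eta>" and ab: "a - b \<le> real k / 2"
  shows "log_kernel k \<gamma> \<gamma>' a b \<eta> \<xi> \<le> logistic \<eta> powr (\<gamma>' - \<gamma>) * (logistic \<xi> / logistic \<eta>) powr (1 / 2 - \<gamma>)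
     * ((1 - logistic \<eta>) / (1 - logistic \<xi>)) powr b * (1 - exp (\<xi> - \<eta>)) powr (real k / 2 - 1)"
proof -
  define L T E where "L = logistic \<xi>" and "T = logistic \<eta>" and "E = 1 - exp (\<xi> - \<eta>)"
  have L: "0 < L" "L < 1" and T: "0 < T" "T < 1" and E: "0 < E" using lt by (simp_all add: L_def T_def E_def)
  have q: "1 - L / T = E * (1 - L)" unfolding L_def T_def E_def by (rule one_minus_logistic_quotient)
  have "log_kernel k \<gamma> \<gamma>' a b \<eta> \<xi> = T powr \<gamma>' * (1 - T) powr b *
     ((L / T) powr (1 / 2) * (E * (1 - L)) powr (real k / 2 - 1) * (1 - L)) / (L powr \<gamma> * (1 - L) powr a)"
    using lt q unfolding log_kernel_def L_def[symmetric] T_def[symmetric] by simp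
  also have "\<dots> = T powr (\<gamma>' - \<gamma>) * (L / T) powr (1 / 2 - \<gamma>) * ((1 - T) powr b * (1 - L) powr (real k / 2 - a))
      * E powr (real k / 2 - 1)"
  proof -
    have "(1 - L) powr (real k / 2 - a) = (1 - L) powr (real k / 2 - 1) * (1 - L) / (1 - L) powr a"
      using L by (simp add: powr_diff)
    moreover have "T powr \<gamma>' / L powr \<gamma> * (L / T) powr (1 / 2) = T powr (\<gamma>' - \<gamma>) * (L / T) powr (1 / 2 - \<gamma>)"
      using L T by (simp add: powr_diff powr_divide)
    moreover have "T powr \<gamma>' * (1 - T) powr b * ((L / T) powr (1 / 2) * (E * (1 - L)) powr (real k / 2 - 1)
        * (1 - L)) / (L powr \<gamma> * (1 - L) powr a)
      = (T powr \<gamma>' / L powr \<gamma> * (L / T) powr (1 / 2)) * ((1 - T) powr b * ((1 - L) powr (real k / 2 - 1) * (1 - L) /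
          (1 - L) powr a)) * E powr (real k / 2 - 1)"
      using L E by (simp add: powr_mult mult_ac)
    ultimately show ?thesis by (simp only:)
  qed
  also have "\<dots> \<le> T powr (\<gamma>' - \<gamma>) * (L / T) powr (1 / 2 - \<gamma>) * ((1 - T) powr b * (1 - L) powr (- b)) * E powr (real k /
      2 - 1)"
    using L T ab by (intro mult_right_mono mult_left_mono powr_mono') auto
  also have "(1 - T) powr b * (1 - L) powr (- b) = ((1 - T) / (1 - L)) powr b"
    using L T by (simp add: powr_divide powr_minus_divide)
  finally show ?thesis unfolding L_def T_def E_def .
qed

text \<open>The order of the singularity of (1 - exp(-z))^(k/2-1) at z = 0: the exponent is negative
  only for k = 1.\<close>

definition sing_exp :: "nat \<Rightarrow> real" where
  "sing_exp k = (if k = 1 then 1 / 2 else 0)"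

text \<open>For k = 1 use 1 - exp(-z) >= z/(1+z) and the subadditivity of the square root; for k >=
  2 the left-hand side is at most 1.\<close>

lemma sing_factor_le:
  assumes "z > 0" "k \<ge> 1"
  shows "(1 - exp (- z)) powr (real k / 2 - 1) \<le> 1 + z powr (- sing_exp k)"
proof (cases "k = 1")
  case True
  have "exp (- z) \<le> 1 / (1 + z)"
    using exp_ge_add_one_self[of z] assms by (simp add: exp_minus field_simps)
  then have le: "z / (1 + z) \<le> 1 - exp (- z)" using assms by (simp add: field_simps)
  have "(1 - exp (- z)) powr (real k / 2 - 1) \<le> (z / (1 + z)) powr (real k / 2 - 1)"
    using assms True le by (intro powr_mono2') auto
  also have "\<dots> = inverse (sqrt (z / (1 + z)))" using assms True by (simp add: powr_minus powr_half_sqrt)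
  also have "\<dots> = sqrt (1 + 1 / z)" unfolding real_sqrt_inverse[symmetric] using assms by (simp add: field_simps)
  also have "\<dots> \<le> sqrt 1 + sqrt (1 / z)" by (rule sqrt_add_le_add_sqrt) (use assms in auto)
  also have "\<dots> = 1 + z powr (- sing_exp k)"
    using assms True by (simp add: sing_exp_def powr_minus powr_half_sqrt real_sqrt_divide inverse_eq_divide)
  finally show ?thesis .
next
  case False
  then have "(1 - exp (- z)) powr (real k / 2 - 1) \<le> 1"
    using assms by (intro powr_le1) auto
  then show ?thesis by (simp add: add_increasing2)
qed

text \<open>The powers of \<open>\<sigma>/\<tau>\<close> and of \<open>(1 - \<tau>)/(1 - \<sigma>)\<close> are both decaying; lowering them to a common exponent
  \<open>\<delta>\<close> leaves the cross ratio, which is \<open>exp (\<xi> - \<eta>)\<close> in logistic coordinates.\<close>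

lemma log_kernel_le_convolution:
  assumes lt: "\<xi> < \<eta>" and k: "k \<ge> 1" and ab: "a - b \<le> real k / 2" and \<gamma>: "\<gamma> \<le> \<gamma>'" and \<delta>: "0 < \<delta>" "\<delta> \<le> 1 / 2 - \<gamma>" "\<delta>
      \<le> b"
  shows "log_kernel k \<gamma> \<gamma>' a b \<eta> \<xi> \<le> exp (- \<delta> * (\<eta> - \<xi>)) * (1 + (\<eta> - \<xi>) powr (- sing_exp k))"
proof -
  define L T where "L = logistic \<xi>" and "T = logistic \<eta>"
  have L: "0 < L" "L < 1" and T: "0 < T" "T < 1" and LT: "L < T" using lt by (simp_all add: L_def T_def)
  have cr: "L / T * ((1 - T) / (1 - L)) = exp (\<xi> - \<eta>)" unfolding L_def T_def by (rule logistic_cross_ratio)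
  have "log_kernel k \<gamma> \<gamma>' a b \<eta> \<xi> \<le> T powr (\<gamma>' - \<gamma>) * (L / T) powr (1 / 2 - \<gamma>) * ((1 - T) / (1 - L)) powr b
      * (1 - exp (\<xi> - \<eta>)) powr (real k / 2 - 1)"
    unfolding L_def T_def by (rule log_kernel_le[OF lt ab])
  also have "\<dots> \<le> 1 * (L / T) powr \<delta> * ((1 - T) / (1 - L)) powr \<delta> * (1 + (\<eta> - \<xi>) powr (- sing_exp k))"
  proof (intro mult_mono)
    show "T powr (\<gamma>' - \<gamma>) \<le> 1" using T \<gamma> by (intro powr_le1) auto
    show "(L / T) powr (1 / 2 - \<gamma>) \<le> (L / T) powr \<delta>" using L T LT \<delta> by (intro powr_mono') auto
    show "((1 - T) / (1 - L)) powr b \<le> ((1 - T) / (1 - L)) powr \<delta>" using L T LT \<delta> by (intro powr_mono') auto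
    show "(1 - exp (\<xi> - \<eta>)) powr (real k / 2 - 1) \<le> 1 + (\<eta> - \<xi>) powr (- sing_exp k)"
      using sing_factor_le[of "\<eta> - \<xi>" k] lt k by simp
  qed auto
  also have "1 * (L / T) powr \<delta> * ((1 - T) / (1 - L)) powr \<delta> = (L / T * ((1 - T) / (1 - L))) powr \<delta>"
    using L T by (subst powr_mult) auto
  also have "\<dots> = exp (- \<delta> * (\<eta> - \<xi>))" unfolding cr by (simp add: powr_def algebra_simps)
  finally show ?thesis .
qed

lemma nn_integral_exp_powr_less_top:
  assumes "c > 0" "s > (0 :: real)"
  shows "(\<integral>\<^sup>+z\<in>{0<..}. ennreal (exp (- c * z) * z powr (s - 1)) \<partial>lborel) < \<infinity>"
proof -
  obtain C where C: "C > 0" "(\<integral>\<^sup>+z\<in>{0<..}. ennreal (exp (- z / 2) * z powr (s - 1)) \<partial>lborel) = ennreal C"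
    using nn_integral_exp_powr_finite[OF assms(2)] by auto
  have "(\<integral>\<^sup>+z\<in>{0<..}. ennreal (exp (- z / 2) * z powr (s - 1)) \<partial>lborel)
      = ennreal (2 * c) * (\<integral>\<^sup>+z. ennreal (exp (- c * z) * (2 * c * z) powr (s - 1)) * indicator {0<..} (2 * c * z)
          \<partial>lborel)"
    using assms by (subst nn_integral_real_affine[where c="2 * c" and t=0]) auto
  also have "(\<integral>\<^sup>+z. ennreal (exp (- c * z) * (2 * c * z) powr (s - 1)) * indicator {0<..} (2 * c * z) \<partial>lborel)
      = (\<integral>\<^sup>+z. ennreal ((2 * c) powr (s - 1)) * (ennreal (exp (- c * z) * z powr (s - 1)) * indicator {0<..} z)
          \<partial>lborel)"
    using assms by (intro nn_integral_cong) (auto simp: indicator_def powr_mult ennreal_mult[symmetric]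
        zero_less_mult_iff mult_ac)
  also have "\<dots> = ennreal ((2 * c) powr (s - 1)) * (\<integral>\<^sup>+z\<in>{0<..}. ennreal (exp (- c * z) * z powr (s - 1)) \<partial>lborel)"
    by (rule nn_integral_cmult) measurable
  finally have eq: "(\<integral>\<^sup>+z\<in>{0<..}. ennreal (exp (- z / 2) * z powr (s - 1)) \<partial>lborel)
      = ennreal (2 * c) * (ennreal ((2 * c) powr (s - 1)) * (\<integral>\<^sup>+z\<in>{0<..}. ennreal (exp (- c * z) * z powr (s - 1))
          \<partial>lborel))" .
  have "ennreal (2 * c) * (ennreal ((2 * c) powr (s - 1)) * (\<integral>\<^sup>+z\<in>{0<..}. ennreal (exp (- c * z) * z powr (s - 1))
      \<partial>lborel)) < \<infinity>"
    unfolding eq[symmetric] C(2) by simp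
  then show ?thesis using assms by (auto simp: ennreal_mult_less_top)
qed

lemma one_plus_powr_le:
  assumes "x \<ge> 0" "q > (0 :: real)"
  shows "(1 + x) powr q \<le> 2 powr q * (1 + x powr q)"
proof -
  have "(1 + x) powr q \<le> (2 * max 1 x) powr q" using assms by (intro powr_mono2) auto
  also have "\<dots> = 2 powr q * (max 1 x) powr q" using assms by (simp add: powr_mult)
  also have "(max 1 x) powr q \<le> 1 + x powr q" using assms by (auto simp: max_def)
  finally show ?thesis by simp
qed

text \<open>Boundedness from L^p to L^r of the positive operator with kernel K, stated for p-th and
  r-th powers. Finiteness almost everywhere is a separate clause because \<open>enn2real\<close>
  would hide infinite values.\<close>

definition kernel_bounded :: "(real \<Rightarrow> real \<Rightarrow> real) \<Rightarrow> real \<Rightarrow> real \<Rightarrow> bool" where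
  "kernel_bounded K p r \<longleftrightarrow> (\<exists>C\<ge>0. \<forall>\<phi>\<in>borel_measurable borel. \<forall>N. (\<forall>\<xi>. 0 \<le> \<phi> \<xi>) \<longrightarrow> 0 \<le> N \<longrightarrow>
     (\<integral>\<^sup>+\<xi>. ennreal (\<phi> \<xi> powr p) \<partial>lborel) = ennreal N \<longrightarrow>
     (AE \<eta> in lborel. (\<integral>\<^sup>+\<xi>. ennreal (K \<eta> \<xi> * \<phi> \<xi>) \<partial>lborel) < \<infinity>) \<and>
     (\<integral>\<^sup>+\<eta>. ennreal (enn2real (\<integral>\<^sup>+\<xi>. ennreal (K \<eta> \<xi> * \<phi> \<xi>) \<partial>lborel) powr r) \<partial>lborel) \<le> ennreal (C * N powr (r / p)))"

lemma radon_bound_of_kernel_bounded: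
  fixes a :: "'m :: finite"
  assumes card: "CARD('m) = n + 1" and k: "1 \<le> k" "k \<le> n - 1" and p: "p > 0" and r: "r > 0"
    and K: "kernel_bounded (log_kernel k ((\<alpha>2 + 1) / (2 * p)) ((\<beta>2 + real k + 1) / (2 * r))
              ((\<alpha>1 + real n) / (2 * p)) ((\<beta>1 + real n - real k) / (2 * r))) p r"
  shows "radon_bound a k p r \<alpha>1 \<alpha>2 \<beta>1 \<beta>2"
proof -
  let ?\<gamma> = "(\<alpha>2 + 1) / (2 * p)" and ?\<gamma>' = "(\<beta>2 + real k + 1) / (2 * r)" and ?a = "(\<alpha>1 + real n) / (2 * p)"
      and ?b = "(\<beta>1 + real n - real k) / (2 * r)"
  let ?K = "log_kernel k ?\<gamma> ?\<gamma>' ?a ?b"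
  obtain C where C: "C \<ge> 0" "\<forall>\<phi>\<in>borel_measurable borel. \<forall>N. (\<forall>\<xi>. 0 \<le> \<phi> \<xi>) \<longrightarrow> 0 \<le> N \<longrightarrow>
     (\<integral>\<^sup>+\<xi>. ennreal (\<phi> \<xi> powr p) \<partial>lborel) = ennreal N \<longrightarrow>
     (AE \<eta> in lborel. (\<integral>\<^sup>+\<xi>. ennreal (?K \<eta> \<xi> * \<phi> \<xi>) \<partial>lborel) < \<infinity>) \<and>
     (\<integral>\<^sup>+\<eta>. ennreal (enn2real (\<integral>\<^sup>+\<xi>. ennreal (?K \<eta> \<xi> * \<phi> \<xi>) \<partial>lborel) powr r) \<partial>lborel) \<le> ennreal (C * N powr (r / p))"
    using K unfolding kernel_bounded_def by blast
  show ?thesis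
  proof (rule radon_boundI[OF card k p r _ C(1)])
    fix F :: "real \<Rightarrow> real" assume F[measurable]: "F \<in> borel_measurable borel" and fin: "sphere_weighted n p \<alpha>1 \<alpha>2 F
        < \<infinity>"
    let ?\<phi> = "log_density ?\<gamma> ?a F"
    define N where "N = enn2real (sphere_weighted n p \<alpha>1 \<alpha>2 F)"
    have N: "sphere_weighted n p \<alpha>1 \<alpha>2 F = ennreal N" "N \<ge> 0" using fin by (auto simp: N_def)
    have "(\<integral>\<^sup>+\<xi>. ennreal (?\<phi> \<xi> powr p) \<partial>lborel) = ennreal N"
      using sphere_weighted_logistic[OF F p, of n \<alpha>1 \<alpha>2] N by simp
    then have AE: "AE \<eta> in lborel. (\<integral>\<^sup>+\<xi>. ennreal (?K \<eta> \<xi> * ?\<phi> \<xi>) \<partial>lborel) < \<infinity>" and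
      bd: "(\<integral>\<^sup>+\<eta>. ennreal (enn2real (\<integral>\<^sup>+\<xi>. ennreal (?K \<eta> \<xi> * ?\<phi> \<xi>) \<partial>lborel) powr r) \<partial>lborel)
          \<le> ennreal (C * N powr (r / p))"
      using C(2)[rule_format, of ?\<phi> N] N log_density_nonneg by auto
    \<comment> \<open>Finiteness for almost every eta is carried over to almost every tau by
      changing variables in the integral of the indicator of an infinite profile.\<close>
    have "(\<integral>\<^sup>+\<tau>\<in>{0<..<1}. (if radon_profile k F \<tau> = \<infinity> then 1 else 0) \<partial>lborel)
        = (\<integral>\<^sup>+\<eta>. (if radon_profile k F (logistic \<eta>) = \<infinity> then 1 else 0) * ennreal (logistic \<eta> * (1 - logistic \<eta>))
            \<partial>lborel)"
      by (rule nn_integral_logistic) measurable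
    also have "\<dots> = (\<integral>\<^sup>+(\<eta> :: real). 0 \<partial>lborel)"
    proof (rule nn_integral_cong_AE, use AE in eventually_elim)
      fix \<eta> assume "(\<integral>\<^sup>+\<xi>. ennreal (?K \<eta> \<xi> * ?\<phi> \<xi>) \<partial>lborel) < \<infinity>"
      then have "radon_profile k F (logistic \<eta>) \<noteq> \<infinity>"
        unfolding radon_profile_logistic[OF F, symmetric]
            by (auto simp: ennreal_mult_less_top less_imp_neq[symmetric])
      then show "(if radon_profile k F (logistic \<eta>) = \<infinity> then 1 else 0) * ennreal (logistic \<eta> * (1 - logistic \<eta>)) = 0"
          by simp
    qed
    finally have "(\<integral>\<^sup>+\<tau>\<in>{0<..<1}. (if radon_profile k F \<tau> = \<infinity> then 1 else 0) \<partial>lborel) = 0" by simp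
    then have "AE \<tau> in lborel. (if radon_profile k F \<tau> = \<infinity> then 1 else 0) * indicator {0<..<1} \<tau> = (0 :: ennreal)"
      by (subst (asm) nn_integral_0_iff_AE) measurable
    then have "AE \<tau> in lborel. \<tau> \<in> {0<..<1} \<longrightarrow> radon_profile k F \<tau> < \<infinity>"
      by eventually_elim (auto simp: less_top split: if_splits)
    moreover have "profile_weighted n k r \<beta>1 \<beta>2 F \<le> ennreal (C * N powr (r / p))"
      using bd profile_weighted_logistic[OF F r, of n k \<beta>1 \<beta>2 ?\<gamma> ?a] by simp
    ultimately show "(AE \<tau> in lborel. \<tau> \<in> {0<..<1} \<longrightarrow> radon_profile k F \<tau> < \<infinity>) \<and>
        profile_weighted n k r \<beta>1 \<beta>2 F \<le> ennreal (C * enn2real (sphere_weighted n p \<alpha>1 \<alpha>2 F) powr (r / p))"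
      unfolding N_def by blast
  qed
qed


section \<open>Kernel bounds for p > 1 + alpha_2\<close>

lemma kernel_bounded_young:
  assumes K[measurable]: "case_prod K \<in> borel_measurable (borel \<Otimes>\<^sub>M borel)" and K0: "\<And>\<eta> \<xi>. 0 \<le> K \<eta> \<xi>"
    and p: "1 \<le> p" "p \<le> r" and q: "q > 0" "1 / q = 1 + 1 / r - 1 / p"
    and A: "A < \<infinity>" "\<And>\<xi>. (\<integral>\<^sup>+\<eta>. ennreal (K \<eta> \<xi> powr q) \<partial>lborel) \<le> A"
    and A': "p = 1 \<or> (\<forall>\<eta>. (\<integral>\<^sup>+\<xi>. ennreal (K \<eta> \<xi> powr q) \<partial>lborel) \<le> A)"
  shows "kernel_bounded K p r"
proof -
  \<comment> \<open>A positive real bound is required by \<open>kernel_young\<close>; adding 1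
    covers the case A = 0.\<close>
  define B where "B = enn2real A + 1"
  have B: "B > 0" "A \<le> ennreal B" using A(1) by (auto simp: B_def add_nonneg_pos intro!: order_trans[OF _
      ennreal_leI[of "enn2real A"]])
  show ?thesis
    unfolding kernel_bounded_def
  proof (intro exI[of _ "B powr (r / q)"] conjI ballI allI impI)
    fix \<phi> :: "real \<Rightarrow> real" and N assume \<phi>: "\<phi> \<in> borel_measurable borel" "\<forall>\<xi>. 0 \<le> \<phi> \<xi>" "0 \<le> N"
      "(\<integral>\<^sup>+\<xi>. ennreal (\<phi> \<xi> powr p) \<partial>lborel) = ennreal N"
    have 1: "(\<integral>\<^sup>+\<eta>. ennreal (K \<eta> \<xi> powr q) \<partial>lborel) \<le> ennreal B" for \<xi> using A(2) B(2) order_trans by blast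
    have 2: "p = 1 \<or> (\<forall>\<eta>. (\<integral>\<^sup>+\<xi>. ennreal (K \<eta> \<xi> powr q) \<partial>lborel) \<le> ennreal B)" using A' B(2) order_trans by blast
    note Y = kernel_young[OF K K0 \<phi>(1) \<phi>(2)[rule_format] p q B(1) 1 2 \<phi>(4,3)]
    show "AE \<eta> in lborel. (\<integral>\<^sup>+\<xi>. ennreal (K \<eta> \<xi> * \<phi> \<xi>) \<partial>lborel) < \<infinity>" by (rule Y(1))
    show "(\<integral>\<^sup>+\<eta>. ennreal (enn2real (\<integral>\<^sup>+\<xi>. ennreal (K \<eta> \<xi> * \<phi> \<xi>) \<partial>lborel) powr r) \<partial>lborel)
        \<le> ennreal (B powr (r / q) * N powr (r / p))" by (rule Y(2))
  qed simp
qed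

lemma kernel_bounded_half:
  assumes K0: "\<And>\<eta> \<xi>. 0 \<le> K \<eta> \<xi>" and M: "M > 0" "\<And>\<eta> \<xi>. K \<eta> \<xi> \<le> M * half_kernel (\<eta> - \<xi>)"
    and p: "1 < p" and r: "r > 0" "1 / p - 1 / r = 1 / 2"
  shows "kernel_bounded K p r"
proof -
  obtain C where C: "C > 0" "\<forall>\<phi>\<in>borel_measurable borel. \<forall>N. (\<forall>\<xi>. 0 \<le> \<phi> \<xi>) \<longrightarrow> 0 \<le> N \<longrightarrow>
      (\<integral>\<^sup>+\<xi>. ennreal (\<phi> \<xi> powr p) \<partial>lborel) = ennreal N \<longrightarrow>
     (AE \<eta> in lborel. (\<integral>\<^sup>+\<xi>. ennreal (half_kernel (\<eta> - \<xi>) * \<phi> \<xi>) \<partial>lborel) < \<infinity>) \<and>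
     (\<integral>\<^sup>+\<eta>. ennreal (enn2real (\<integral>\<^sup>+\<xi>. ennreal (half_kernel (\<eta> - \<xi>) * \<phi> \<xi>) \<partial>lborel) powr r) \<partial>lborel)
         \<le> ennreal (C * N powr (r / p))"
    using fractional_half[OF p r] by blast
  show ?thesis
    unfolding kernel_bounded_def
  proof (intro exI[of _ "M powr r * C"] conjI ballI allI impI)
    show "0 \<le> M powr r * C" using C by simp
    fix \<phi> :: "real \<Rightarrow> real" and N assume \<phi>: "\<phi> \<in> borel_measurable borel" "\<forall>\<xi>. 0 \<le> \<phi> \<xi>" "0 \<le> N"
      "(\<integral>\<^sup>+\<xi>. ennreal (\<phi> \<xi> powr p) \<partial>lborel) = ennreal N"
    note [measurable] = \<phi>(1)
    define h where "h \<eta> = (\<integral>\<^sup>+\<xi>. ennreal (half_kernel (\<eta> - \<xi>) * \<phi> \<xi>) \<partial>lborel)" for \<eta>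
    have [measurable]: "h \<in> borel_measurable borel" unfolding h_def by measurable
    have h: "AE \<eta> in lborel. h \<eta> < \<infinity>" "(\<integral>\<^sup>+\<eta>. ennreal (enn2real (h \<eta>) powr r) \<partial>lborel) \<le> ennreal (C * N powr (r / p))"
      using C(2)[rule_format, of \<phi> N] \<phi> unfolding h_def by auto
    have le: "(\<integral>\<^sup>+\<xi>. ennreal (K \<eta> \<xi> * \<phi> \<xi>) \<partial>lborel) \<le> ennreal M * h \<eta>" for \<eta>
    proof -
      have "(\<integral>\<^sup>+\<xi>. ennreal (K \<eta> \<xi> * \<phi> \<xi>) \<partial>lborel) \<le> (\<integral>\<^sup>+\<xi>. ennreal M * ennreal (half_kernel (\<eta> - \<xi>) * \<phi> \<xi>) \<partial>lborel)"
        using M \<phi>(2) by (intro nn_integral_mono) (auto simp: ennreal_mult'[symmetric] mult.assoc[symmetric] intro!: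
            ennreal_leI mult_right_mono)
      also have "\<dots> = ennreal M * h \<eta>" unfolding h_def by (rule nn_integral_cmult) measurable
      finally show ?thesis .
    qed
    show "AE \<eta> in lborel. (\<integral>\<^sup>+\<xi>. ennreal (K \<eta> \<xi> * \<phi> \<xi>) \<partial>lborel) < \<infinity>"
      using h(1) by eventually_elim (rule le_less_trans[OF le], auto simp: ennreal_mult_less_top)
    have "(\<integral>\<^sup>+\<eta>. ennreal (enn2real (\<integral>\<^sup>+\<xi>. ennreal (K \<eta> \<xi> * \<phi> \<xi>) \<partial>lborel) powr r) \<partial>lborel)
      \<le> (\<integral>\<^sup>+\<eta>. ennreal (M powr r) * ennreal (enn2real (h \<eta>) powr r) \<partial>lborel)"
    proof (rule nn_integral_mono_AE, use h(1) in eventually_elim)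
      fix \<eta> assume fin: "h \<eta> < \<infinity>"
      have "enn2real (\<integral>\<^sup>+\<xi>. ennreal (K \<eta> \<xi> * \<phi> \<xi>) \<partial>lborel) \<le> enn2real (ennreal M * h \<eta>)"
        using le fin by (intro enn2real_mono) (auto simp: ennreal_mult_less_top)
      also have "\<dots> = M * enn2real (h \<eta>)" using M by (simp add: enn2real_mult)
      finally have "enn2real (\<integral>\<^sup>+\<xi>. ennreal (K \<eta> \<xi> * \<phi> \<xi>) \<partial>lborel) powr r \<le> (M * enn2real (h \<eta>)) powr r"
        using r by (intro powr_mono2) auto
      then show "ennreal (enn2real (\<integral>\<^sup>+\<xi>. ennreal (K \<eta> \<xi> * \<phi> \<xi>) \<partial>lborel) powr r)
          \<le> ennreal (M powr r) * ennreal (enn2real (h \<eta>) powr r)"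
        using M by (simp add: powr_mult ennreal_mult[symmetric] ennreal_leI)
    qed
    also have "\<dots> = ennreal (M powr r) * (\<integral>\<^sup>+\<eta>. ennreal (enn2real (h \<eta>) powr r) \<partial>lborel)"
        by (rule nn_integral_cmult) measurable
    also have "\<dots> \<le> ennreal (M powr r) * ennreal (C * N powr (r / p))" by (rule mult_left_mono[OF h(2)]) simp
    also have "\<dots> = ennreal (M powr r * C * N powr (r / p))" using C by (simp add: ennreal_mult[symmetric] mult.assoc)
    finally show "(\<integral>\<^sup>+\<eta>. ennreal (enn2real (\<integral>\<^sup>+\<xi>. ennreal (K \<eta> \<xi> * \<phi> \<xi>) \<partial>lborel) powr r) \<partial>lborel)
        \<le> ennreal (M powr r * C * N powr (r / p))" .
  qed
qed

definition exp_kernel :: "real \<Rightarrow> real \<Rightarrow> real \<Rightarrow> real" where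
  "exp_kernel \<delta> \<theta> z = (if 0 < z then exp (- \<delta> * z) * (1 + z powr (- \<theta>)) else 0)"

lemma exp_kernel_measurable [measurable]: "exp_kernel \<delta> \<theta> \<in> borel_measurable borel"
  unfolding exp_kernel_def by measurable

text \<open>The condition \<open>q * \<theta> < 1\<close> is integrability at 0, and the exponential
  takes care of infinity. With theta = 1/2 it reads q < 2.\<close>

lemma nn_integral_exp_kernel_less_top:
  assumes "\<delta> > 0" "q > 0" "q * \<theta> < 1"
  shows "(\<integral>\<^sup>+z. ennreal (exp_kernel \<delta> \<theta> z powr q) \<partial>lborel) < \<infinity>"
proof -
  have "(\<integral>\<^sup>+z. ennreal (exp_kernel \<delta> \<theta> z powr q) \<partial>lborel)
     \<le> (\<integral>\<^sup>+z. ennreal (2 powr q) * (ennreal (exp (- (\<delta> * q) * z) * z powr (1 - 1)) * indicator {0<..} z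
           + ennreal (exp (- (\<delta> * q) * z) * z powr (1 - q * \<theta> - 1)) * indicator {0<..} z) \<partial>lborel)"
  proof (rule nn_integral_mono, goal_cases)
    case (1 z)
    show ?case
    proof (cases "z > 0")
      case True
      have "exp_kernel \<delta> \<theta> z powr q = exp (- (\<delta> * q) * z) * (1 + z powr (- \<theta>)) powr q"
        using True by (simp add: exp_kernel_def powr_mult powr_def[of "exp _"] mult_ac)
      also have "\<dots> \<le> exp (- (\<delta> * q) * z) * (2 powr q * (1 + (z powr (- \<theta>)) powr q))"
        by (intro mult_left_mono one_plus_powr_le) (use assms in auto)
      also have "\<dots> = 2 powr q * (exp (- (\<delta> * q) * z) * z powr (1 - 1) + exp (- (\<delta> * q) * z) * z powr (1 - q * \<theta> - 1))"
        using True by (simp add: powr_powr algebra_simps)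
      finally show ?thesis using True
        by (simp add: ennreal_mult[symmetric] ennreal_plus[symmetric] ennreal_leI del: ennreal_plus)
    qed (simp add: exp_kernel_def)
  qed
  also have "\<dots> = ennreal (2 powr q) * ((\<integral>\<^sup>+z\<in>{0<..}. ennreal (exp (- (\<delta> * q) * z) * z powr (1 - 1)) \<partial>lborel)
      + (\<integral>\<^sup>+z\<in>{0<..}. ennreal (exp (- (\<delta> * q) * z) * z powr (1 - q * \<theta> - 1)) \<partial>lborel))"
    by (subst nn_integral_cmult, measurable, subst nn_integral_add) measurable
  also have "\<dots> < \<infinity>"
    using nn_integral_exp_powr_less_top[of "\<delta> * q" 1] nn_integral_exp_powr_less_top[of "\<delta> * q" "1 - q * \<theta>"] assms
    by (auto simp: ennreal_mult_less_top)
  finally show ?thesis .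
qed

lemma log_kernel_le_exp_kernel:
  assumes "k \<ge> 1" "a - b \<le> real k / 2" "\<gamma> \<le> \<gamma>'" "0 < \<delta>" "\<delta> \<le> 1 / 2 - \<gamma>" "\<delta> \<le> b"
  shows "log_kernel k \<gamma> \<gamma>' a b \<eta> \<xi> \<le> exp_kernel \<delta> (sing_exp k) (\<eta> - \<xi>)"
proof (cases "\<xi> < \<eta>")
  case True
  then show ?thesis using log_kernel_le_convolution[OF True assms] by (simp add: exp_kernel_def)
qed (simp add: log_kernel_def exp_kernel_def)

lemma kernel_bounded_subcritical:
  assumes k: "k \<ge> 1" and ab: "a - b \<le> real k / 2" and b: "b > 0" and \<gamma>: "\<gamma> \<le> \<gamma>'" "\<gamma> < 1 / 2"
    and p: "1 \<le> p" "p \<le> r" and sing: "k = 1 \<Longrightarrow> 1 / p - 1 / r \<le> 1 / 2" "k = 1 \<Longrightarrow> p = 1 \<Longrightarrow> r < 2"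
  shows "kernel_bounded (log_kernel k \<gamma> \<gamma>' a b) p r"
proof -
  define \<delta> where "\<delta> = min (1 / 2 - \<gamma>) b"
  have \<delta>: "0 < \<delta>" "\<delta> \<le> 1 / 2 - \<gamma>" "\<delta> \<le> b" using b \<gamma> by (auto simp: \<delta>_def)
  have r: "r > 0" using p by linarith
  note le = log_kernel_le_exp_kernel[OF k ab \<gamma>(1) \<delta>]
  show ?thesis
  \<comment> \<open>In the first case q = 2, and the square of z^(-1/2) just fails to be integrable
    at 0; this is where the order-1/2 inequality enters.\<close>
  proof (cases "k = 1 \<and> 1 / p - 1 / r = 1 / 2")
    case True
    have p1: "1 < p"
    proof (rule ccontr)
      assume "\<not> 1 < p"
      then have "p = 1" using p by simp
      then show False using True sing(2) r by (auto simp: field_simps)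
    qed
    \<comment> \<open>The constant comes from 1 + sqrt z <= 2 + z, with 1 <= exp(delta z) and z <=
      exp(delta z)/delta. The exponential decay is given up, since the power z^(-1/2) alone suffices
      at this endpoint.\<close>
    have "exp_kernel \<delta> (1 / 2) z \<le> (2 + 1 / \<delta>) * half_kernel z" for z
    proof (cases "z > 0")
      case True
      have "sqrt z \<le> 1 + z" using True by (intro real_le_lsqrt[THEN order_trans[OF _ order_refl]] real_le_lsqrt) (auto
          simp: power2_eq_square algebra_simps)
      moreover have "1 + \<delta> * z \<le> exp (\<delta> * z)" by (rule exp_ge_add_one_self)
      moreover have "1 \<le> exp (\<delta> * z)" using True \<delta> by simp
      moreover have "z \<le> 1 / \<delta> * exp (\<delta> * z)"
      proof -
        have "\<delta> * z \<le> exp (\<delta> * z)" using exp_ge_add_one_self[of "\<delta> * z"] by linarith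
        then show ?thesis using \<delta>(1) by (simp add: pos_le_divide_eq mult.commute)
      qed
      ultimately have "1 + sqrt z \<le> (2 + 1 / \<delta>) * exp (\<delta> * z)"
        unfolding distrib_right by linarith
      then have "exp (- \<delta> * z) * (1 + sqrt z) \<le> 2 + 1 / \<delta>"
        by (simp add: exp_minus field_simps)
      then have "exp (- \<delta> * z) * (1 + sqrt z) * z powr (- 1 / 2) \<le> (2 + 1 / \<delta>) * z powr (- 1 / 2)"
        by (rule mult_right_mono) simp
      moreover have "exp (- \<delta> * z) * (1 + z powr (- (1 / 2))) \<le> exp (- \<delta> * z) * (1 + sqrt z) * z powr (- 1 / 2)"
      proof -
        have "sqrt z * z powr (- 1 / 2) = 1" using True by (simp add: powr_minus powr_half_sqrt)
        then have "(1 + sqrt z) * z powr (- 1 / 2) = 1 + z powr (- (1 / 2))" by (simp add: distrib_right)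
        then show ?thesis by (simp only: mult.assoc)
      qed
      ultimately have "exp (- \<delta> * z) * (1 + z powr (- (1 / 2))) \<le> (2 + 1 / \<delta>) * z powr (- 1 / 2)"
        by (rule order_trans[rotated])
      then show ?thesis using True by (simp add: exp_kernel_def half_kernel_def)
    qed (simp add: exp_kernel_def half_kernel_def)
    then have "log_kernel k \<gamma> \<gamma>' a b \<eta> \<xi> \<le> (2 + 1 / \<delta>) * half_kernel (\<eta> - \<xi>)" for \<eta> \<xi>
      using le[of \<eta> \<xi>] True order_trans by (fastforce simp: sing_exp_def)
    then show ?thesis
      using True \<delta> p1 r by (intro kernel_bounded_half[of _ "2 + 1 / \<delta>"] log_kernel_nonneg) (auto simp: add_pos_pos)
  next
    case False
    define q where "q = 1 / (1 + 1 / r - 1 / p)"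
    have pos: "1 + 1 / r - 1 / p > 0"
    proof -
      have "1 / p \<le> 1" "1 / r > 0" using p r by auto
      then show ?thesis by linarith
    qed
    have q: "q > 0" "1 / q = 1 + 1 / r - 1 / p" using pos by (auto simp: q_def)
    have "q * sing_exp k < 1"
    proof (cases "k = 1")
      case True
      then have "1 / p - 1 / r < 1 / 2" using False sing(1) by auto
      then have "1 / q > 1 / 2" using q by linarith
      then have "q < 2" using q(1) by (simp add: field_simps)
      then show ?thesis using True by (simp add: sing_exp_def)
    qed (simp add: sing_exp_def)
    then have fin: "(\<integral>\<^sup>+z. ennreal (exp_kernel \<delta> (sing_exp k) z powr q) \<partial>lborel) < \<infinity>"
      using nn_integral_exp_kernel_less_top \<delta> q by blast
    have pw: "ennreal (log_kernel k \<gamma> \<gamma>' a b \<eta> \<xi> powr q) \<le> ennreal (exp_kernel \<delta> (sing_exp k) (\<eta> - \<xi>) powr q)" for \<eta> \<xi>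
      using le q log_kernel_nonneg by (intro ennreal_leI powr_mono2) auto
    have "(\<integral>\<^sup>+\<eta>. ennreal (log_kernel k \<gamma> \<gamma>' a b \<eta> \<xi> powr q) \<partial>lborel) \<le> (\<integral>\<^sup>+z. ennreal (exp_kernel \<delta> (sing_exp k) z powr
        q) \<partial>lborel)" for \<xi>
    proof -
      have "(\<integral>\<^sup>+\<eta>. ennreal (log_kernel k \<gamma> \<gamma>' a b \<eta> \<xi> powr q) \<partial>lborel) \<le> (\<integral>\<^sup>+\<eta>. ennreal (exp_kernel \<delta> (sing_exp k) (\<eta> -
          \<xi>) powr q) \<partial>lborel)"
        by (rule nn_integral_mono) (rule pw)
      also have "\<dots> = (\<integral>\<^sup>+z. ennreal (exp_kernel \<delta> (sing_exp k) z powr q) \<partial>lborel)"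
        by (rule nn_integral_reflect_real(2)) measurable
      finally show ?thesis .
    qed
    moreover have "(\<integral>\<^sup>+\<xi>. ennreal (log_kernel k \<gamma> \<gamma>' a b \<eta> \<xi> powr q) \<partial>lborel)
        \<le> (\<integral>\<^sup>+z. ennreal (exp_kernel \<delta> (sing_exp k) z powr q) \<partial>lborel)" for \<eta>
    proof -
      have "(\<integral>\<^sup>+\<xi>. ennreal (log_kernel k \<gamma> \<gamma>' a b \<eta> \<xi> powr q) \<partial>lborel) \<le> (\<integral>\<^sup>+\<xi>. ennreal (exp_kernel \<delta> (sing_exp k) (\<eta> -
          \<xi>) powr q) \<partial>lborel)"
        by (rule nn_integral_mono) (rule pw)
      also have "\<dots> = (\<integral>\<^sup>+z. ennreal (exp_kernel \<delta> (sing_exp k) z powr q) \<partial>lborel)"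
        by (rule nn_integral_reflect_real(1)) measurable
      finally show ?thesis .
    qed
    ultimately show ?thesis
      by (intro kernel_bounded_young[OF log_kernel_measurable log_kernel_nonneg p q fin]) auto
  qed
qed


section \<open>The kernel bound in the critical case p = 1 + alpha_2 = 1\<close>

lemma logistic_product_le:
  assumes "\<xi> < \<eta>"
  shows "logistic \<eta> * ((1 - logistic \<eta>) / (1 - logistic \<xi>)) \<le> exp (- \<bar>\<eta>\<bar>) + exp (\<xi> - \<eta>)"
proof -
  define y where "y = exp \<eta>"
  have y: "y > 0" by (simp add: y_def)
  have eq: "logistic \<eta> * ((1 - logistic \<eta>) / (1 - logistic \<xi>)) = y / (1 + y)\<^sup>2 + exp \<xi> * (y / (1 + y)\<^sup>2)"
    unfolding one_minus_logistic unfolding logistic_def y_def[symmetric] using y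
    by (simp add: field_simps power2_eq_square) (simp add: add_divide_distrib)
  have sq: "(1 + y)\<^sup>2 = 1 + 2 * y + y\<^sup>2" by (simp add: power2_eq_square algebra_simps)
  have pos: "0 < (1 + y)\<^sup>2" using y by simp
  have "1 \<le> (1 + y)\<^sup>2" "y\<^sup>2 \<le> (1 + y)\<^sup>2" using y unfolding sq by auto
  then have "y / (1 + y)\<^sup>2 \<le> y / 1" "y / (1 + y)\<^sup>2 \<le> y / y\<^sup>2"
    using y pos by (auto intro!: divide_left_mono simp del: div_by_1)
  then have 1: "y / (1 + y)\<^sup>2 \<le> y" and 2: "y / (1 + y)\<^sup>2 \<le> 1 / y"
    using y by (simp_all add: power2_eq_square)
  \<comment> \<open>For y = exp eta the smaller of y and 1/y is exp(-|eta|).\<close>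
  have "y / (1 + y)\<^sup>2 \<le> exp (- \<bar>\<eta>\<bar>)"
    using 1 2 unfolding y_def by (auto simp: abs_if exp_minus inverse_eq_divide)
  moreover have "exp \<xi> * (y / (1 + y)\<^sup>2) \<le> exp \<xi> * (1 / y)" using 2 by (intro mult_left_mono) auto
  then have "exp \<xi> * (y / (1 + y)\<^sup>2) \<le> exp (\<xi> - \<eta>)" by (simp add: y_def exp_diff)
  ultimately show ?thesis unfolding eq by linarith
qed

lemma nn_integral_exp_abs_less_top:
  assumes "s > 0"
  shows "(\<integral>\<^sup>+\<eta>. ennreal (exp (- s * \<bar>\<eta>\<bar>)) \<partial>lborel) < \<infinity>"
proof -
  define g where "g z = ennreal (exp (- s * z) * z powr (1 - 1)) * indicator {0<..} z" for z :: real
  have [measurable]: "g \<in> borel_measurable borel" unfolding g_def by measurable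
  have fin: "(\<integral>\<^sup>+z. g z \<partial>lborel) < \<infinity>" unfolding g_def by (rule nn_integral_exp_powr_less_top) (use assms in auto)
  have "(\<integral>\<^sup>+\<eta>. ennreal (exp (- s * \<bar>\<eta>\<bar>)) \<partial>lborel) = (\<integral>\<^sup>+\<eta>. g \<eta> + g (0 - \<eta>) \<partial>lborel)"
  proof (rule nn_integral_cong_AE)
    show "AE \<eta> in lborel. ennreal (exp (- s * \<bar>\<eta>\<bar>)) = g \<eta> + g (0 - \<eta>)"
      using AE_lborel_singleton[of "0 :: real"] by eventually_elim (auto simp: g_def indicator_def abs_if)
  qed
  also have "\<dots> = (\<integral>\<^sup>+z. g z \<partial>lborel) + (\<integral>\<^sup>+z. g z \<partial>lborel)"
    by (subst nn_integral_add) (auto simp: nn_integral_reflect_real(1)[of g 0, simplified])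
  also have "\<dots> < \<infinity>" using fin by simp
  finally show ?thesis .
qed

text \<open>Here gamma = 1/2, so the power of sigma/tau is trivial and gives no decay as xi tends to
  minus infinity. The strict inequality gamma' > 1/2 gives a power of tau instead, hence decay in
  eta. The resulting bound is no longer a function of eta - xi, but its integral over eta is bounded
  uniformly in xi, which is all that Young's inequality with p = 1 and q = r asks for.\<close>

lemma kernel_bounded_critical:
  assumes k: "k \<ge> 1" and ab: "a - b \<le> real k / 2" and b: "b > 0" and \<gamma>': "1 / 2 < \<gamma>'"
    and r: "1 \<le> r" and sing: "k = 1 \<Longrightarrow> r < 2"
  shows "kernel_bounded (log_kernel k (1 / 2) \<gamma>' a b) 1 r"
proof -
  define \<delta> where "\<delta> = min (\<gamma>' - 1 / 2) b"
  have \<delta>: "0 < \<delta>" "\<delta> \<le> \<gamma>' - 1 / 2" "\<delta> \<le> b" using b \<gamma>' by (auto simp: \<delta>_def)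
  define s where "s = \<delta> * r"
  have s: "s > 0" using \<delta> r by (simp add: s_def)
  define u where "u = r * sing_exp k"
  have u: "0 \<le> u" "u < 1" using r sing by (auto simp: u_def sing_exp_def)
  \<comment> \<open>The terms that depend on z alone. The last one arises from splitting
    exp(-s|eta|) z^(-u) at z = 1. Integrability at 0 means u < 1, which for k = 1 is the hypothesis
    r < 2.\<close>
  define g where "g z = (if 0 < z then ennreal (exp (- s * z) * z powr (1 - 1)) + ennreal (exp (- s * z)
      * z powr (1 - u - 1)) else 0)
      + ennreal (z powr (1 - u - 1)) * indicator {0<..<1} z" for z
  have [measurable]: "g \<in> borel_measurable borel" unfolding g_def by measurable
  define M where "M = 2 powr s * 2 powr r"
  have pt: "ennreal (log_kernel k (1 / 2) \<gamma>' a b \<eta> \<xi> powr r) \<le> ennreal M * (2 * ennreal (exp (- s * \<bar>\<eta>\<bar>))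
      + g (\<eta> - \<xi>))" for \<eta> \<xi>
  proof (cases "\<xi> < \<eta>")
    case True
    define L T z where "L = logistic \<xi>" and "T = logistic \<eta>" and "z = \<eta> - \<xi>"
    have L: "0 < L" "L < 1" and T: "0 < T" "T < 1" and LT: "L < T" and z: "z > 0" using True
        by (simp_all add: L_def T_def z_def)
    define e1 e2 where "e1 = exp (- \<bar>\<eta>\<bar>)" and "e2 = exp (- z)"
    have e: "e1 > 0" "e2 > 0" by (simp_all add: e1_def e2_def)
    have "log_kernel k (1 / 2) \<gamma>' a b \<eta> \<xi> \<le> T powr (\<gamma>' - 1 / 2) * (L / T) powr (1 / 2 - 1 / 2) * ((1 - T) / (1 - L))
        powr b * (1 - exp (\<xi> - \<eta>)) powr (real k / 2 - 1)"
      unfolding L_def T_def by (rule log_kernel_le[OF True ab])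
    also have "\<dots> \<le> T powr \<delta> * 1 * ((1 - T) / (1 - L)) powr \<delta> * (1 + z powr (- sing_exp k))"
    proof (intro mult_mono)
      show "T powr (\<gamma>' - 1 / 2) \<le> T powr \<delta>" using T \<delta> by (intro powr_mono') auto
      show "((1 - T) / (1 - L)) powr b \<le> ((1 - T) / (1 - L)) powr \<delta>" using L T LT \<delta> by (intro powr_mono') auto
      show "(1 - exp (\<xi> - \<eta>)) powr (real k / 2 - 1) \<le> 1 + z powr (- sing_exp k)"
        using sing_factor_le[OF z k] by (simp add: z_def)
    qed auto
    also have "T powr \<delta> * 1 * ((1 - T) / (1 - L)) powr \<delta> = (T * ((1 - T) / (1 - L))) powr \<delta>"
      using L T by (subst powr_mult) auto
    also have "\<dots> \<le> (e1 + e2) powr \<delta>"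
      using logistic_product_le[OF True] L T \<delta> unfolding L_def[symmetric] T_def[symmetric] e1_def e2_def z_def
      by (intro powr_mono2) auto
    finally have "log_kernel k (1 / 2) \<gamma>' a b \<eta> \<xi> \<le> (e1 + e2) powr \<delta> * (1 + z powr (- sing_exp k))"
        by (simp add: mult_right_mono)
    then have "log_kernel k (1 / 2) \<gamma>' a b \<eta> \<xi> powr r \<le> ((e1 + e2) powr \<delta> * (1 + z powr (- sing_exp k))) powr r"
      using r by (intro powr_mono2 log_kernel_nonneg) auto
    also have "\<dots> = (e1 + e2) powr s * (1 + z powr (- sing_exp k)) powr r"
      using e by (simp add: powr_mult powr_powr s_def)
    also have "\<dots> \<le> (2 powr s * (e1 powr s + e2 powr s)) * (2 powr r * (1 + (z powr (- sing_exp k)) powr r))"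
    proof (intro mult_mono one_plus_powr_le)
      have "(e1 + e2) powr s = e1 powr s * (1 + e2 / e1) powr s"
      proof -
        have "e1 + e2 = e1 * (1 + e2 / e1)" using e by (simp add: distrib_left)
        then show ?thesis using e by (simp only:) (subst powr_mult, auto)
      qed
      also have "\<dots> \<le> e1 powr s * (2 powr s * (1 + (e2 / e1) powr s))"
        using e s by (intro mult_left_mono one_plus_powr_le) auto
      also have "\<dots> = 2 powr s * (e1 powr s + e2 powr s)"
        using e by (simp add: powr_divide field_simps)
      finally show "(e1 + e2) powr s \<le> 2 powr s * (e1 powr s + e2 powr s)" .
    qed (use r e in auto)
    also have "(z powr (- sing_exp k)) powr r = z powr (- u)" by (simp add: powr_powr u_def mult.commute)
    also have "e1 powr s = exp (- s * \<bar>\<eta>\<bar>)" by (simp add: e1_def powr_def mult.commute)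
    also have "e2 powr s = exp (- s * z)" by (simp add: e2_def powr_def mult.commute)
    also have "2 powr s * (exp (- s * \<bar>\<eta>\<bar>) + exp (- s * z)) * (2 powr r * (1 + z powr (- u)))
       = M * (exp (- s * \<bar>\<eta>\<bar>) + exp (- s * \<bar>\<eta>\<bar>) * z powr (- u) + exp (- s * z) + exp (- s * z) * z powr (- u))"
      unfolding M_def by (simp add: algebra_simps)
    also have "\<dots> \<le> M * (2 * exp (- s * \<bar>\<eta>\<bar>) + (if z < 1 then z powr (- u) else 0) + exp (- s * z) + exp (- s * z)
        * z powr (- u))"
    proof -
      \<comment> \<open>For z < 1 the exponential is at most 1, and for z >= 1 the power is.\<close>
      have "exp (- s * \<bar>\<eta>\<bar>) * z powr (- u) \<le> exp (- s * \<bar>\<eta>\<bar>) + (if z < 1 then z powr (- u) else 0)"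
      proof (cases "z < 1")
        case True
        have "exp (- s * \<bar>\<eta>\<bar>) * z powr (- u) \<le> 1 * z powr (- u)" using s by (intro mult_right_mono) auto
        then show ?thesis using True by (simp add: add_increasing)
      next
        case False
        have "z powr (- u) \<le> z powr 0" using False u by (intro powr_mono) auto
        then have "exp (- s * \<bar>\<eta>\<bar>) * z powr (- u) \<le> exp (- s * \<bar>\<eta>\<bar>) * 1" using z by (intro mult_left_mono) auto
        then show ?thesis using False by simp
      qed
      then show ?thesis by (intro mult_left_mono) (auto simp: M_def)
    qed
    finally have "ennreal (log_kernel k (1 / 2) \<gamma>' a b \<eta> \<xi> powr r) \<le> ennreal (M * (2 * exp (- s * \<bar>\<eta>\<bar>) + (if z
        < 1 then z powr (- u) else 0) + exp (- s * z) + exp (- s * z) * z powr (- u)))"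
      by (rule ennreal_leI)
    also have "\<dots> = ennreal M * (2 * ennreal (exp (- s * \<bar>\<eta>\<bar>)) + g z)"
      using z by (simp add: g_def M_def indicator_def ennreal_mult add_ac)
    finally show ?thesis unfolding z_def .
  qed (use r in \<open>simp add: log_kernel_def\<close>)
  define A where "A = ennreal M * (2 * (\<integral>\<^sup>+\<eta>. ennreal (exp (- s * \<bar>\<eta>\<bar>)) \<partial>lborel) + (\<integral>\<^sup>+z. g z \<partial>lborel))"
  have "(\<integral>\<^sup>+z. g z \<partial>lborel) = (\<integral>\<^sup>+z\<in>{0<..}. ennreal (exp (- s * z) * z powr (1 - 1)) \<partial>lborel)
     + (\<integral>\<^sup>+z\<in>{0<..}. ennreal (exp (- s * z) * z powr (1 - u - 1)) \<partial>lborel) + (\<integral>\<^sup>+z\<in>{0<..<1}. ennreal (z powr (1 - u -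
         1)) \<partial>lborel)"
    by (subst nn_integral_add[symmetric], measurable, subst nn_integral_add[symmetric], measurable)
       (auto simp: g_def indicator_def intro!: nn_integral_cong)
  also have "\<dots> < \<infinity>"
    using nn_integral_exp_powr_less_top[OF s, of 1] nn_integral_exp_powr_less_top[OF s, of "1 - u"]
        nn_integral_powr_from_0[of "1 - u" 1] u by simp
  finally have A: "A < \<infinity>" unfolding A_def using nn_integral_exp_abs_less_top[OF s]
      by (simp add: ennreal_mult_less_top)
  have "(\<integral>\<^sup>+\<eta>. ennreal (log_kernel k (1 / 2) \<gamma>' a b \<eta> \<xi> powr r) \<partial>lborel) \<le> A" for \<xi>
  proof -
    have "(\<integral>\<^sup>+\<eta>. ennreal (log_kernel k (1 / 2) \<gamma>' a b \<eta> \<xi> powr r) \<partial>lborel) \<le> (\<integral>\<^sup>+\<eta>. ennreal M * (2 * ennreal (exp (- s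
        * \<bar>\<eta>\<bar>)) + g (\<eta> - \<xi>)) \<partial>lborel)"
      by (rule nn_integral_mono) (rule pt)
    also have "\<dots> = A" unfolding A_def
      by (simp add: nn_integral_cmult nn_integral_add nn_integral_reflect_real(2)[of g])
    finally show ?thesis .
  qed
  then show ?thesis
    using r by (intro kernel_bounded_young[OF log_kernel_measurable log_kernel_nonneg _ _ _ _ A, of _ r]) auto
qed

lemma radon_bound_sufficient:
  fixes a :: "'m :: finite"
  assumes card: "CARD('m) = n + 1" and k: "1 \<le> k" "k \<le> n - 1"
    and p: "p \<ge> 1" "p \<ge> 1 + \<alpha>2" "\<alpha>2 > 0 \<longrightarrow> p > 1 + \<alpha>2" and r: "p \<le> r"
    and sing: "k = 1 \<Longrightarrow> 1 / p - 1 / r \<le> 1 / 2" "k = 1 \<Longrightarrow> p = 1 \<Longrightarrow> r < 2"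
    and N: "cond_N n k p r \<alpha>1 \<alpha>2 \<beta>1 \<beta>2"
  shows "radon_bound a k p r \<alpha>1 \<alpha>2 \<beta>1 \<beta>2"
proof -
  let ?\<gamma> = "(\<alpha>2 + 1) / (2 * p)" and ?\<gamma>' = "(\<beta>2 + real k + 1) / (2 * r)" and ?a = "(\<alpha>1 + real n) / (2 * p)"
      and ?b = "(\<beta>1 + real n - real k) / (2 * r)"
  have pr: "p > 0" "r > 0" using p r by linarith+
  \<comment> \<open>The exponents in the kernel are half of those in (N), because sigma and tau are
    squared cosines.\<close>
  have half: "x / (2 * y) = (x / y) / 2" for x y :: real by simp
  have N': "\<beta>1 > real k - real n" "(\<alpha>1 + real n) / p - (\<beta>1 + real n - real k) / r \<le> real k"
    "(\<beta>2 + real k + 1) / r \<ge> (\<alpha>2 + 1) / p" "p = 1 + \<alpha>2 \<Longrightarrow> (\<beta>2 + real k + 1) / r > (\<alpha>2 + 1) / p"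
    using N unfolding cond_N_def by auto
  have b: "?b > 0" using N' pr by (intro divide_pos_pos) auto
  have ab: "?a - ?b \<le> real k / 2" using divide_right_mono[OF N'(2), of 2] unfolding half
      by (simp add: diff_divide_distrib)
  have \<gamma>: "?\<gamma> \<le> ?\<gamma>'" using divide_right_mono[OF N'(3), of 2] unfolding half by simp
  have "kernel_bounded (log_kernel k ?\<gamma> ?\<gamma>' ?a ?b) p r"
  proof (cases "p = 1 + \<alpha>2")
    case True
    \<comment> \<open>Equality with alpha_2 > 0 is excluded by the strict hypothesis, and with
      alpha_2 < 0 by p >= 1.\<close>
    then have "\<alpha>2 = 0" "p = 1" using p by auto
    moreover have "?\<gamma> < ?\<gamma>'" using divide_strict_right_mono[OF N'(4)[OF True], of 2] unfolding half by simp
    ultimately show ?thesis using kernel_bounded_critical[OF k(1) ab b] sing(2) r by simp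
  next
    case False
    then have "?\<gamma> < 1 / 2" using p pr by (simp add: field_simps)
    then show ?thesis using kernel_bounded_subcritical[OF k(1) ab b \<gamma> _ p(1) r] sing by blast
  qed
  then show ?thesis by (rule radon_bound_of_kernel_bounded[OF card k pr])
qed

section \<open>Necessity\<close>

text \<open>The absolute value of the exponent makes one pair of constants serve both signs, so
  weights with arbitrary real exponents need no case distinction in the tests.\<close>

lemma powr_dyadic_bounds:
  fixes \<epsilon> x s :: real
  assumes "0 < \<epsilon>" "\<epsilon> \<le> x" "x \<le> 2 * \<epsilon>"
  shows "2 powr (- \<bar>s\<bar>) * \<epsilon> powr s \<le> x powr s" "x powr s \<le> 2 powr \<bar>s\<bar> * \<epsilon> powr s"
proof -
  define y where "y = x / \<epsilon>"
  have y: "1 \<le> y" "y \<le> 2" and x: "x = y * \<epsilon>" using assms by (auto simp: y_def field_simps)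
  have "2 powr (- \<bar>s\<bar>) \<le> y powr s \<and> y powr s \<le> 2 powr \<bar>s\<bar>"
  proof (cases "s \<ge> 0")
    case True
    have "y powr s \<le> 2 powr s" "1 powr s \<le> y powr s" using y True by (intro powr_mono2; simp)+
    moreover have "2 powr (- s) \<le> (1 :: real)" using True powr_mono[of "- s" 0 2] by simp
    ultimately show ?thesis using True by simp
  next
    case False
    have "2 powr s \<le> y powr s" "y powr s \<le> 1 powr s" using y False by (intro powr_mono2'; simp)+
    moreover have "1 \<le> 2 powr (- s)" using False powr_mono[of 0 "- s" 2] by simp
    ultimately show ?thesis using False by simp
  qed
  then show "2 powr (- \<bar>s\<bar>) * \<epsilon> powr s \<le> x powr s" "x powr s \<le> 2 powr \<bar>s\<bar> * \<epsilon> powr s"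
    unfolding x using y assms by (auto simp: powr_mult intro!: mult_right_mono)
qed

lemma powr_quarter_bounds:
  fixes x s :: real
  assumes "1 / 4 \<le> x" "x \<le> 1"
  shows "4 powr (- \<bar>s\<bar>) \<le> x powr s" "x powr s \<le> 4 powr \<bar>s\<bar>"
proof -
  have q: "(1 / 4) powr s = 4 powr (- s)" for s :: real by (simp add: powr_divide powr_minus_divide)
  have "4 powr (- \<bar>s\<bar>) \<le> x powr s \<and> x powr s \<le> 4 powr \<bar>s\<bar>"
  proof (cases "s \<ge> 0")
    case True
    have "(1 / 4) powr s \<le> x powr s" "x powr s \<le> 1 powr s" using assms True by (intro powr_mono2; simp)+
    moreover have "1 \<le> 4 powr s" using True powr_mono[of 0 s 4] by simp
    ultimately show ?thesis using True q[of s] by simp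
  next
    case False
    have "1 powr s \<le> x powr s" "x powr s \<le> (1 / 4) powr s" using assms False by (intro powr_mono2'; simp)+
    moreover have "4 powr s \<le> (1 :: real)" using False powr_mono[of s 0 4] by simp
    ultimately show ?thesis using False q[of s] by simp
  qed
  then show "4 powr (- \<bar>s\<bar>) \<le> x powr s" "x powr s \<le> 4 powr \<bar>s\<bar>" by auto
qed

lemma powr_exponent_le:
  fixes x y C \<epsilon>0 :: real
  assumes "0 < \<epsilon>0" and C: "\<And>\<epsilon>. 0 < \<epsilon> \<Longrightarrow> \<epsilon> \<le> \<epsilon>0 \<Longrightarrow> \<epsilon> powr x \<le> C * \<epsilon> powr y"
  shows "y \<le> x"
proof (rule ccontr)
  assume "\<not> y \<le> x"
  then have d: "y - x > 0" by simp
  define c where "c = \<bar>C\<bar> + 1"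
  have c: "c > 0" "C < c" by (auto simp: c_def)
  \<comment> \<open>Small enough that c eps^(y-x) <= 1, although c > C and the hypothesis demands C
    eps^(y-x) >= 1.\<close>
  define \<epsilon> where "\<epsilon> = min \<epsilon>0 (c powr (- 1 / (y - x)))"
  have \<epsilon>: "0 < \<epsilon>" "\<epsilon> \<le> \<epsilon>0" using assms c by (auto simp: \<epsilon>_def)
  have "\<epsilon> powr (y - x) \<le> (c powr (- 1 / (y - x))) powr (y - x)"
    using \<epsilon> d by (intro powr_mono2) (auto simp: \<epsilon>_def)
  also have "\<dots> = c powr (- 1)" unfolding powr_powr using d by simp
  also have "\<dots> = 1 / c" using c by (simp add: powr_minus_divide)
  finally have "c * \<epsilon> powr (y - x) \<le> 1" using c by (simp add: field_simps)
  moreover have "C * \<epsilon> powr (y - x) < c * \<epsilon> powr (y - x)" using c \<epsilon> by (intro mult_strict_right_mono) auto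
  moreover have "1 \<le> C * \<epsilon> powr (y - x)"
  proof -
    have "\<epsilon> powr x * 1 \<le> \<epsilon> powr x * (C * \<epsilon> powr (y - x))"
      using C[OF \<epsilon>] \<epsilon> by (simp add: powr_diff field_simps)
    then show ?thesis using \<epsilon> by (simp add: mult_le_cancel_left_pos)
  qed
  ultimately show False by linarith
qed

lemma nn_integral_inverse_real:
  fixes x y :: real
  assumes "0 < x" "x \<le> y"
  shows "(\<integral>\<^sup>+t\<in>{x..y}. ennreal (1 / t) \<partial>lborel) = ennreal (ln y - ln x)"
  using assms by (intro nn_integral_FTC_Icc) (auto intro!: derivative_eq_intros)

section \<open>Indicators in the squared cosine as test functions\<close>

definition test_fun :: "real \<Rightarrow> real \<Rightarrow> real \<Rightarrow> real" where
  "test_fun u v x = indicator {u<..<v} (x\<^sup>2)"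

lemma test_fun_measurable [measurable]: "test_fun u v \<in> borel_measurable borel"
  unfolding test_fun_def by measurable

lemma test_fun_range: "0 \<le> test_fun u v x \<and> test_fun u v x \<le> 1"
  by (auto simp: test_fun_def indicator_def)

lemma test_fun_sqrt: "0 \<le> \<sigma> \<Longrightarrow> test_fun u v (sqrt \<sigma>) = indicator {u<..<v} \<sigma>"
  by (simp add: test_fun_def)

lemma radon_profile_test_fun_less_top:
  assumes "k \<ge> 1"
  shows "radon_profile k (test_fun u v) \<tau> < \<infinity>"
proof -
  have "radon_profile k (test_fun u v) \<tau> \<le> (\<integral>\<^sup>+\<sigma>\<in>{0<..<1}. ennreal (\<sigma> powr (1 / 2 - 1) * (1 - \<sigma>) powr (real k / 2 - 1))
      \<partial>lborel)"
    unfolding radon_profile_def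
    by (rule nn_integral_mono)
       (use test_fun_range[of u v] in \<open>auto simp: indicator_def ennreal_mult[symmetric] intro!: ennreal_leI
           mult_left_le_one_le\<close>)
  also have "\<dots> = ennreal (Beta (1 / 2) (real k / 2))" by (rule nn_integral_Beta) (use assms in auto)
  finally show ?thesis using le_less_trans by fastforce
qed

lemma radon_profile_test_fun_ge:
  assumes k: "k \<ge> 1" and \<tau>: "0 < \<tau>" and xy: "0 \<le> x" "x \<le> y" "y \<le> 1" "u \<le> \<tau> * x" "\<tau> * y \<le> v"
    and m: "m \<ge> 0" "\<And>\<sigma>. x < \<sigma> \<Longrightarrow> \<sigma> < y \<Longrightarrow> m \<le> \<sigma> powr (1 / 2 - 1) * (1 - \<sigma>) powr (real k / 2 - 1)"
  shows "m * (y - x) \<le> enn2real (radon_profile k (test_fun u v) \<tau>)"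
proof -
  have "ennreal (m * (y - x)) = (\<integral>\<^sup>+\<sigma>. ennreal m * indicator {x<..<y} \<sigma> \<partial>lborel)"
    using m xy by (simp add: nn_integral_cmult_indicator ennreal_mult)
  also have "\<dots> \<le> radon_profile k (test_fun u v) \<tau>"
    unfolding radon_profile_def
  proof (rule nn_integral_mono, goal_cases)
    case (1 \<sigma>)
    show ?case
    proof (cases "x < \<sigma> \<and> \<sigma> < y")
      case True
      have "\<tau> * x < \<tau> * \<sigma>" "\<tau> * \<sigma> < \<tau> * y" using True \<tau> by auto
      then have "u < \<tau> * \<sigma>" "\<tau> * \<sigma> < v" using xy by linarith+
      moreover have "0 < \<sigma>" "\<sigma> < 1" using True xy by linarith+
      ultimately show ?thesis using True m \<tau> by (simp add: test_fun_sqrt ennreal_leI)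
    qed (auto simp: indicator_def)
  qed
  finally have le: "ennreal (m * (y - x)) \<le> radon_profile k (test_fun u v) \<tau>" .
  then have "enn2real (ennreal (m * (y - x))) \<le> enn2real (radon_profile k (test_fun u v) \<tau>)"
    using radon_profile_test_fun_less_top[OF k] by (intro enn2real_mono) auto
  then show ?thesis using m xy by simp
qed

lemma sphere_weighted_test_fun_le:
  assumes uv: "0 < u" "u \<le> v" "v < 1" and p: "p > 0" and w: "w \<ge> 0"
    and "\<And>\<sigma>. u < \<sigma> \<Longrightarrow> \<sigma> < v \<Longrightarrow> cone_weight ((\<alpha>2 + 1) / 2) ((\<alpha>1 + real n) / 2) \<sigma> \<le> w"
  shows "sphere_weighted n p \<alpha>1 \<alpha>2 (test_fun u v) \<le> ennreal (w * (v - u))"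
proof -
  have "sphere_weighted n p \<alpha>1 \<alpha>2 (test_fun u v) \<le> (\<integral>\<^sup>+\<sigma>. ennreal w * indicator {u<..<v} \<sigma> \<partial>lborel)"
    unfolding sphere_weighted_def
    by (rule nn_integral_mono) (use assms in \<open>auto simp: test_fun_sqrt indicator_def intro!: ennreal_leI\<close>)
  also have "\<dots> = ennreal (w * (v - u))" using uv w by (simp add: nn_integral_cmult_indicator ennreal_mult)
  finally show ?thesis .
qed

lemma profile_weighted_ge:
  assumes st: "0 \<le> s" "s \<le> t" "t \<le> 1" and w: "w \<ge> 0" and c: "c \<ge> 0" and r: "r > 0"
    and P: "\<And>\<tau>. s < \<tau> \<Longrightarrow> \<tau> < t \<Longrightarrow> c \<le> enn2real (radon_profile k F \<tau>)"
    and W: "\<And>\<tau>. s < \<tau> \<Longrightarrow> \<tau> < t \<Longrightarrow> w \<le> cone_weight ((\<beta>2 + real k + 1) / 2) ((\<beta>1 + real n - real k) / 2) \<tau>"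
  shows "ennreal (c powr r * w * (t - s)) \<le> profile_weighted n k r \<beta>1 \<beta>2 F"
proof -
  have "ennreal (c powr r * w * (t - s)) = (\<integral>\<^sup>+\<tau>. ennreal (c powr r * w) * indicator {s<..<t} \<tau> \<partial>lborel)"
    using st w by (simp add: nn_integral_cmult_indicator ennreal_mult)
  also have "\<dots> \<le> profile_weighted n k r \<beta>1 \<beta>2 F"
    unfolding profile_weighted_def
  proof (rule nn_integral_mono, goal_cases)
    case (1 \<tau>)
    show ?case
    proof (cases "s < \<tau> \<and> \<tau> < t")
      case True
      have "c powr r * w \<le> enn2real (radon_profile k F \<tau>) powr r * cone_weight ((\<beta>2 + real k + 1) / 2) ((\<beta>1
          + real n - real k) / 2) \<tau>"
        using True P W c r w by (intro mult_mono powr_mono2) auto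
      then show ?thesis using True st by (simp add: ennreal_leI)
    qed (auto simp: indicator_def)
  qed
  finally show ?thesis .
qed

lemma test_bound:
  assumes C: "\<And>u v. 0 < u \<Longrightarrow> v < 1 \<Longrightarrow> sphere_weighted n p \<alpha>1 \<alpha>2 (test_fun u v) < \<infinity> \<Longrightarrow>
      profile_weighted n k r \<beta>1 \<beta>2 (test_fun u v) \<le> ennreal (C * enn2real (sphere_weighted n p \<alpha>1 \<alpha>2 (test_fun u v))
          powr (r / p))"
    and C0: "C \<ge> 0" and pr: "p > 0" "r > 0"
    and uv: "0 < u" "u \<le> v" "v < 1" and S: "S \<ge> 0" "sphere_weighted n p \<alpha>1 \<alpha>2 (test_fun u v) \<le> ennreal S"
    and x: "ennreal x \<le> profile_weighted n k r \<beta>1 \<beta>2 (test_fun u v)"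
  shows "x \<le> C * S powr (r / p)"
proof -
  define I where "I = enn2real (sphere_weighted n p \<alpha>1 \<alpha>2 (test_fun u v))"
  have fin: "sphere_weighted n p \<alpha>1 \<alpha>2 (test_fun u v) < \<infinity>" using S(2) by (rule le_less_trans) simp
  have "I \<le> S" unfolding I_def using S by (intro enn2real_leI) auto
  then have "I powr (r / p) \<le> S powr (r / p)" using pr by (intro powr_mono2) (auto simp: I_def)
  then have "C * I powr (r / p) \<le> C * S powr (r / p)" using C0 by (rule mult_left_mono)
  moreover have "ennreal x \<le> ennreal (C * I powr (r / p))" using x C[OF uv(1,3) fin] unfolding I_def
      by (rule order_trans)
  then have "x \<le> C * I powr (r / p)" using C0 by simp
  ultimately show ?thesis by linarith
qed

lemma radon_bound_necessary:
  fixes a :: "'m :: finite"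
  assumes card: "CARD('m) = n + 1" and k: "1 \<le> k" "k \<le> n - 1"
    and p: "p \<ge> 1" "p \<ge> 1 + \<alpha>2" "\<alpha>2 > 0 \<longrightarrow> p > 1 + \<alpha>2" and r: "p \<le> r"
    and bound: "radon_bound a k p r \<alpha>1 \<alpha>2 \<beta>1 \<beta>2"
  shows "cond_N n k p r \<alpha>1 \<alpha>2 \<beta>1 \<beta>2"
proof -
  have pr: "p > 0" "r > 0" using p r by linarith+
  define A1 A2 B1 B2 where "A1 = (\<alpha>1 + real n) / 2" and "A2 = (\<alpha>2 + 1) / 2" and "B1 = (\<beta>1 + real n - real k) / 2"
      and "B2 = (\<beta>2 + real k + 1) / 2"
  note defs = A1_def[symmetric] A2_def[symmetric] B1_def[symmetric] B2_def[symmetric]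
  obtain C where C0: "C \<ge> 0" and C: "\<And>u v. sphere_weighted n p \<alpha>1 \<alpha>2 (test_fun u v) < \<infinity> \<Longrightarrow>
      profile_weighted n k r \<beta>1 \<beta>2 (test_fun u v) \<le> ennreal (C * enn2real (sphere_weighted n p \<alpha>1 \<alpha>2 (test_fun u v))
          powr (r / p))"
    using radon_boundD[OF card k pr bound] test_fun_range by (metis test_fun_measurable)
  note T = test_bound[OF C C0 pr]
  define s where "s = real k / 2 - 1"
  \<comment> \<open>For a fixed test function the profile stays bounded below as tau tends to 1, so
    the weight (1-tau)^(B1-1) must be integrable there. For B1 <= 0 it dominates 1/(1-tau), whose
    integral over h <= 1 - tau <= 1/4 diverges logarithmically as h tends to 0.\<close>
  have B1: "B1 > 0"
  proof (rule ccontr)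
    assume "\<not> B1 > 0"
    then have B1: "B1 \<le> 0" by simp
    define w where "w = 4 powr \<bar>A2 - 1\<bar> * 4 powr \<bar>A1 - 1\<bar>"
    have SW: "sphere_weighted n p \<alpha>1 \<alpha>2 (test_fun (1/4) (1/2)) \<le> ennreal (w * (1/2 - 1/4))"
    proof (rule sphere_weighted_test_fun_le)
      fix \<sigma> :: real assume "1/4 < \<sigma>" "\<sigma> < 1/2"
      then show "cone_weight ((\<alpha>2 + 1) / 2) ((\<alpha>1 + real n) / 2) \<sigma> \<le> w"
        unfolding cone_weight_def defs w_def by (intro mult_mono powr_quarter_bounds(2)) auto
    qed (use pr in \<open>auto simp: w_def\<close>)
    define m where "m = 4 powr (- \<bar>s\<bar>)"
    have P: "m * (1 / 8) \<le> enn2real (radon_profile k (test_fun (1/4) (1/2)) \<tau>)" if \<tau>: "1/2 < \<tau>" "\<tau> < 1" for \<tau>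
    proof -
      \<comment> \<open>The upper end 3/(8 tau), not 1/(2 tau), keeps sigma <= 3/4 for all tau >
        1/2, so (1-sigma)^s is bounded below for either sign of s.\<close>
      have "m * (3 / (8 * \<tau>) - 1 / (4 * \<tau>)) \<le> enn2real (radon_profile k (test_fun (1/4) (1/2)) \<tau>)"
      proof (rule radon_profile_test_fun_ge[OF k(1)])
        fix \<sigma> assume \<sigma>: "1 / (4 * \<tau>) < \<sigma>" "\<sigma> < 3 / (8 * \<tau>)"
        have "3 / (8 * \<tau>) \<le> 3 / 4" "1 / (4 * \<tau>) > 0" using \<tau> by (auto simp: field_simps)
        then have \<sigma>': "0 < \<sigma>" "\<sigma> \<le> 3 / 4" using \<sigma> by linarith+
        have "1 \<le> \<sigma> powr (1 / 2 - 1)" using \<sigma>' powr_mono2'[of "1/2 - 1" \<sigma> 1] by simp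
        moreover have "m \<le> (1 - \<sigma>) powr s" unfolding m_def using \<sigma>' by (intro powr_quarter_bounds) auto
        ultimately have "1 * m \<le> \<sigma> powr (1 / 2 - 1) * (1 - \<sigma>) powr s" by (intro mult_mono) (auto simp: m_def)
        then show "m \<le> \<sigma> powr (1 / 2 - 1) * (1 - \<sigma>) powr (real k / 2 - 1)" by (simp add: s_def)
      qed (use \<tau> in \<open>auto simp: m_def field_simps\<close>)
      moreover have "m * (1 / 8) \<le> m * (3 / (8 * \<tau>) - 1 / (4 * \<tau>))"
        using \<tau> by (intro mult_left_mono) (auto simp: m_def field_simps)
      ultimately show ?thesis by linarith
    qed
    define c where "c = (m * (1 / 8)) powr r * 4 powr (- \<bar>B2 - 1\<bar>)"
    have c: "c > 0" by (simp add: c_def m_def)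
    have log: "c * (ln (1 / 4) - ln h) \<le> C * (w * (1/2 - 1/4)) powr (r / p)" if h: "0 < h" "h < 1 / 4" for h
    proof (rule T[where u="1/4" and v="1/2"])
      have "ennreal (c * (ln (1 / 4) - ln h)) = ennreal c * (\<integral>\<^sup>+t\<in>{h..1/4}. ennreal (1 / t) \<partial>lborel)"
        using nn_integral_inverse_real[of h "1 / 4"] h c by (simp add: ennreal_mult ln_le_cancel_iff del:
            ln_divide_pos)
      also have "\<dots> = (\<integral>\<^sup>+t. ennreal c * (ennreal (1 / t) * indicator {h..1/4} t) \<partial>lborel)"
        by (rule nn_integral_cmult[symmetric]) measurable
      also have "\<dots> = (\<integral>\<^sup>+\<tau>. ennreal c * (ennreal (1 / (1 - \<tau>)) * indicator {h..1/4} (1 - \<tau>)) \<partial>lborel)"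
        by (subst nn_integral_real_affine[where c="-1" and t=1]) auto
      also have "\<dots> \<le> profile_weighted n k r \<beta>1 \<beta>2 (test_fun (1/4) (1/2))"
        unfolding profile_weighted_def
      proof (rule nn_integral_mono, goal_cases)
        case (1 \<tau>)
        show ?case
        proof (cases "h \<le> 1 - \<tau> \<and> 1 - \<tau> \<le> 1/4")
          case True
          then have \<tau>: "3/4 \<le> \<tau>" "\<tau> < 1" using h by auto
          have "(1 - \<tau>) powr (- 1) \<le> (1 - \<tau>) powr (B1 - 1)" using \<tau> B1 by (intro powr_mono') auto
          then have "1 / (1 - \<tau>) \<le> (1 - \<tau>) powr (B1 - 1)" using \<tau> by (simp add: powr_minus_divide)
          moreover have "4 powr (- \<bar>B2 - 1\<bar>) \<le> \<tau> powr (B2 - 1)" using \<tau> by (intro powr_quarter_bounds) auto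
          moreover have "(m * (1 / 8)) powr r \<le> enn2real (radon_profile k (test_fun (1/4) (1/2)) \<tau>) powr r"
            using P[of \<tau>] \<tau> pr by (intro powr_mono2) (auto simp: m_def)
          ultimately have "(m * (1 / 8)) powr r * (4 powr (- \<bar>B2 - 1\<bar>) * (1 / (1 - \<tau>)))
             \<le> enn2real (radon_profile k (test_fun (1/4) (1/2)) \<tau>) powr r * (\<tau> powr (B2 - 1) * (1 - \<tau>) powr (B1 - 1))"
            using \<tau> by (intro mult_mono) auto
          then have "c * (1 / (1 - \<tau>)) \<le> enn2real (radon_profile k (test_fun (1/4) (1/2)) \<tau>) powr r * cone_weight B2
              B1 \<tau>"
            by (simp add: c_def cone_weight_def)
          then show ?thesis using True \<tau> c unfolding defs by (simp add: ennreal_mult[symmetric] ennreal_leI)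
        qed simp
      qed
      finally show "ennreal (c * (ln (1 / 4) - ln h)) \<le> profile_weighted n k r \<beta>1 \<beta>2 (test_fun (1/4) (1/2))" .
    qed (use SW in \<open>auto simp: w_def\<close>)
    define D where "D = C * (w * (1/2 - 1/4)) powr (r / p)"
    have D: "D \<ge> 0" using C0 by (simp add: D_def)
    \<comment> \<open>Makes the difference of logarithms D/c + 1, one more than the bound
      allows.\<close>
    define h where "h = 1 / 4 * exp (- (D / c + 1))"
    have "D / c \<ge> 0" using D c by simp
    then have h: "0 < h" "h < 1 / 4" by (auto simp: h_def)
    have "ln h = ln (1 / 4) - (D / c + 1)" unfolding h_def by (subst ln_mult) auto
    then have "c * (D / c + 1) \<le> D" using log[OF h] unfolding D_def by simp
    then show False using c by (simp add: distrib_left)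
  qed
  \<comment> \<open>Test functions on 1 - 2 eps < sigma < 1 - eps, evaluated for tau at distance of
    order eps from 1. The profile is at least of order eps^(k/2), an interval of length eps/2 times
    (1-sigma)^(k/2-1); the exponents of eps are then compared.\<close>
  have N2: "A1 * (r / p) \<le> real k / 2 * r + B1"
  proof -
    define w where "w = 4 powr \<bar>A2 - 1\<bar> * 2 powr \<bar>A1 - 1\<bar>"
    define m where "m = 2 powr (- \<bar>s\<bar>)"
    define d where "d = 4 powr (- \<bar>B2 - 1\<bar>) * (2 powr (- \<bar>B1 - 1\<bar>) * (1 / 8) powr (B1 - 1))"
    define c where "c = (m / 2) powr r * d * (1 / 8)"
    have c: "c > 0" by (simp add: c_def d_def m_def)
    have main: "c * \<epsilon> powr (real k / 2 * r + B1) \<le> C * w powr (r / p) * \<epsilon> powr (A1 * (r / p))" if \<epsilon>: "0 < \<epsilon>" "\<epsilon>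
        \<le> 1 / 8" for \<epsilon>
    proof -
      have "c * \<epsilon> powr (real k / 2 * r + B1) \<le> C * (w * \<epsilon> powr A1) powr (r / p)"
      proof (rule T[where u="1 - 2 * \<epsilon>" and v="1 - \<epsilon>"])
        have "sphere_weighted n p \<alpha>1 \<alpha>2 (test_fun (1 - 2 * \<epsilon>) (1 - \<epsilon>)) \<le> ennreal (w * \<epsilon> powr (A1 - 1) * (1 - \<epsilon> - (1 -
            2 * \<epsilon>)))"
        proof (rule sphere_weighted_test_fun_le)
          fix \<sigma> assume \<sigma>: "1 - 2 * \<epsilon> < \<sigma>" "\<sigma> < 1 - \<epsilon>"
          have "\<sigma> powr (A2 - 1) * (1 - \<sigma>) powr (A1 - 1) \<le> 4 powr \<bar>A2 - 1\<bar> * (2 powr \<bar>A1 - 1\<bar> * \<epsilon> powr (A1 - 1))"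
            using \<sigma> \<epsilon> by (intro mult_mono powr_quarter_bounds(2) powr_dyadic_bounds(2)) auto
          then show "cone_weight ((\<alpha>2 + 1) / 2) ((\<alpha>1 + real n) / 2) \<sigma> \<le> w * \<epsilon> powr (A1 - 1)"
            unfolding cone_weight_def defs w_def by (simp add: mult.assoc)
        qed (use pr \<epsilon> in \<open>auto simp: w_def\<close>)
        also have "w * \<epsilon> powr (A1 - 1) * (1 - \<epsilon> - (1 - 2 * \<epsilon>)) = w * \<epsilon> powr A1" using \<epsilon> by (simp add: powr_diff)
        finally show "sphere_weighted n p \<alpha>1 \<alpha>2 (test_fun (1 - 2 * \<epsilon>) (1 - \<epsilon>)) \<le> ennreal (w * \<epsilon> powr A1)" .
        have "ennreal ((m * \<epsilon> powr s * (\<epsilon> / 2)) powr r * (d * \<epsilon> powr (B1 - 1)) * ((1 - \<epsilon> / 8) - (1 - \<epsilon> / 4)))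
            \<le> profile_weighted n k r \<beta>1 \<beta>2 (test_fun (1 - 2 * \<epsilon>) (1 - \<epsilon>))"
        proof (rule profile_weighted_ge)
          fix \<tau> assume \<tau>: "1 - \<epsilon> / 4 < \<tau>" "\<tau> < 1 - \<epsilon> / 8"
          have "m * \<epsilon> powr s * ((1 - \<epsilon>) - (1 - 3 / 2 * \<epsilon>)) \<le> enn2real (radon_profile k (test_fun (1 - 2
              * \<epsilon>) (1 - \<epsilon>)) \<tau>)"
          proof (rule radon_profile_test_fun_ge[OF k(1)])
            \<comment> \<open>The lower end 1 - 3/2 eps for sigma leaves room for the factor tau > 1
              - eps/4.\<close>
            have "1 - 2 * \<epsilon> \<le> (1 - \<epsilon> / 4) * (1 - 3 / 2 * \<epsilon>)" using \<epsilon> by (simp add: algebra_simps)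
            also have "\<dots> \<le> \<tau> * (1 - 3 / 2 * \<epsilon>)" using \<tau> \<epsilon> by (intro mult_right_mono) auto
            finally show "1 - 2 * \<epsilon> \<le> \<tau> * (1 - 3 / 2 * \<epsilon>)" .
            show "\<tau> * (1 - \<epsilon>) \<le> 1 - \<epsilon>" using \<tau> \<epsilon> by (intro mult_left_le_one_le) auto
            fix \<sigma> assume \<sigma>: "1 - 3 / 2 * \<epsilon> < \<sigma>" "\<sigma> < 1 - \<epsilon>"
            have "1 \<le> \<sigma> powr (1 / 2 - 1)" using \<sigma> \<epsilon> powr_mono2'[of "1/2 - 1" \<sigma> 1] by simp
            moreover have "m * \<epsilon> powr s \<le> (1 - \<sigma>) powr s" unfolding m_def using \<sigma> \<epsilon> by (intro powr_dyadic_bounds) auto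
            ultimately have "1 * (m * \<epsilon> powr s) \<le> \<sigma> powr (1 / 2 - 1) * (1 - \<sigma>) powr s"
                by (intro mult_mono) (auto simp: m_def)
            then show "m * \<epsilon> powr s \<le> \<sigma> powr (1 / 2 - 1) * (1 - \<sigma>) powr (real k / 2 - 1)" by (simp add: s_def)
          qed (use \<tau> \<epsilon> in \<open>auto simp: m_def\<close>)
          then show "m * \<epsilon> powr s * (\<epsilon> / 2) \<le> enn2real (radon_profile k (test_fun (1 - 2 * \<epsilon>) (1 - \<epsilon>)) \<tau>)" by simp
          have "4 powr (- \<bar>B2 - 1\<bar>) * (2 powr (- \<bar>B1 - 1\<bar>) * (\<epsilon> / 8) powr (B1 - 1))
              \<le> \<tau> powr (B2 - 1) * (1 - \<tau>) powr (B1 - 1)"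
            using \<tau> \<epsilon> by (intro mult_mono powr_quarter_bounds(1) powr_dyadic_bounds(1)) auto
          moreover have "(\<epsilon> / 8) powr (B1 - 1) = (1 / 8) powr (B1 - 1) * \<epsilon> powr (B1 - 1)" using \<epsilon>
              by (subst powr_mult[symmetric]) auto
          ultimately show "d * \<epsilon> powr (B1 - 1) \<le> cone_weight ((\<beta>2 + real k + 1) / 2) ((\<beta>1 + real n - real k) / 2) \<tau>"
            unfolding cone_weight_def defs d_def by (simp add: mult.assoc)
        qed (use \<epsilon> pr in \<open>auto simp: m_def d_def\<close>)
        moreover have "(m * \<epsilon> powr s * (\<epsilon> / 2)) powr r * (d * \<epsilon> powr (B1 - 1)) * ((1 - \<epsilon> / 8) - (1 - \<epsilon> / 4))
            = c * \<epsilon> powr (real k / 2 * r + B1)"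
        proof -
          have e1: "m * \<epsilon> powr s * (\<epsilon> / 2) = m / 2 * \<epsilon> powr (real k / 2)" using \<epsilon> by (simp add: s_def powr_diff)
          have e2: "(m / 2 * \<epsilon> powr (real k / 2)) powr r = (m / 2) powr r * \<epsilon> powr (real k / 2 * r)"
            by (subst powr_mult) (simp_all add: powr_powr m_def)
          show ?thesis unfolding e1 e2 using \<epsilon> by (simp add: c_def powr_add powr_diff)
        qed
        ultimately show "ennreal (c * \<epsilon> powr (real k / 2 * r + B1)) \<le> profile_weighted n k r \<beta>1 \<beta>2 (test_fun (1 - 2
            * \<epsilon>) (1 - \<epsilon>))" by simp
      qed (use \<epsilon> in \<open>auto simp: w_def\<close>)
      also have "(w * \<epsilon> powr A1) powr (r / p) = w powr (r / p) * \<epsilon> powr (A1 * (r / p))"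
        using \<epsilon> by (subst powr_mult) (auto simp: w_def powr_powr)
      finally show ?thesis by (simp add: mult.assoc)
    qed
    show ?thesis
    proof (rule powr_exponent_le[of "1 / 8" _ "C * w powr (r / p) / c"])
      fix \<epsilon> :: real assume "0 < \<epsilon>" "\<epsilon> \<le> 1 / 8"
      from main[OF this] show "\<epsilon> powr (real k / 2 * r + B1) \<le> C * w powr (r / p) / c * \<epsilon> powr (A1 * (r / p))"
        using c by (simp add: field_simps)
    qed simp
  qed
  \<comment> \<open>The last two conditions share the test functions on (delta, 2 delta). Their
    weighted integral is at most of order delta^A2, and their profile is at least of order
    (delta/tau)^(1/2) for tau >= 4 delta.\<close>
  define w where "w = 2 powr \<bar>A2 - 1\<bar> * 4 powr \<bar>A1 - 1\<bar>"
  have SW0: "sphere_weighted n p \<alpha>1 \<alpha>2 (test_fun \<delta> (2 * \<delta>)) \<le> ennreal (w * \<delta> powr A2)" if \<delta>: "0 < \<delta>" "\<delta> \<le> 1 / 16"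
      for \<delta>
  proof -
    have "sphere_weighted n p \<alpha>1 \<alpha>2 (test_fun \<delta> (2 * \<delta>)) \<le> ennreal (w * \<delta> powr (A2 - 1) * (2 * \<delta> - \<delta>))"
    proof (rule sphere_weighted_test_fun_le)
      fix \<sigma> assume \<sigma>: "\<delta> < \<sigma>" "\<sigma> < 2 * \<delta>"
      have "\<sigma> powr (A2 - 1) * (1 - \<sigma>) powr (A1 - 1) \<le> (2 powr \<bar>A2 - 1\<bar> * \<delta> powr (A2 - 1)) * 4 powr \<bar>A1 - 1\<bar>"
        using \<sigma> \<delta> by (intro mult_mono powr_quarter_bounds(2) powr_dyadic_bounds(2)) auto
      then show "cone_weight ((\<alpha>2 + 1) / 2) ((\<alpha>1 + real n) / 2) \<sigma> \<le> w * \<delta> powr (A2 - 1)"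
        unfolding cone_weight_def defs w_def by (simp add: mult_ac)
    qed (use pr \<delta> in \<open>auto simp: w_def\<close>)
    also have "w * \<delta> powr (A2 - 1) * (2 * \<delta> - \<delta>) = w * \<delta> powr A2" using \<delta> by (simp add: powr_diff)
    finally show ?thesis .
  qed
  define m where "m = 4 powr (- \<bar>s\<bar>) / 2"
  have m: "m > 0" by (simp add: m_def)
  have P0: "m * (\<delta> / \<tau>) powr (1 / 2) \<le> enn2real (radon_profile k (test_fun \<delta> (2 * \<delta>)) \<tau>)"
    if \<delta>: "0 < \<delta>" and \<tau>: "4 * \<delta> \<le> \<tau>" for \<delta> \<tau>
  proof -
    have \<tau>0: "\<tau> > 0" using \<delta> \<tau> by linarith
    have "4 powr (- \<bar>s\<bar>) * (2 * \<delta> / \<tau>) powr (1 / 2 - 1) * (2 * \<delta> / \<tau> - \<delta> / \<tau>)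
        \<le> enn2real (radon_profile k (test_fun \<delta> (2 * \<delta>)) \<tau>)"
    proof (rule radon_profile_test_fun_ge[OF k(1) \<tau>0])
      fix \<sigma> assume \<sigma>: "\<delta> / \<tau> < \<sigma>" "\<sigma> < 2 * \<delta> / \<tau>"
      have "2 * \<delta> / \<tau> \<le> 1 / 2" "\<delta> / \<tau> > 0" using \<tau> \<delta> \<tau>0 by (auto simp: field_simps)
      then have \<sigma>': "0 < \<sigma>" "\<sigma> \<le> 1 / 2" using \<sigma> by linarith+
      have "(2 * \<delta> / \<tau>) powr (1 / 2 - 1) \<le> \<sigma> powr (1 / 2 - 1)" using \<sigma> \<sigma>' by (intro powr_mono2') auto
      moreover have "4 powr (- \<bar>s\<bar>) \<le> (1 - \<sigma>) powr s" using \<sigma>' by (intro powr_quarter_bounds) auto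
      ultimately have "(2 * \<delta> / \<tau>) powr (1 / 2 - 1) * 4 powr (- \<bar>s\<bar>) \<le> \<sigma> powr (1 / 2 - 1) * (1 - \<sigma>) powr s"
          by (intro mult_mono) auto
      then show "4 powr (- \<bar>s\<bar>) * (2 * \<delta> / \<tau>) powr (1 / 2 - 1) \<le> \<sigma> powr (1 / 2 - 1) * (1 - \<sigma>) powr (real k / 2 - 1)"
        by (simp add: s_def mult.commute)
    qed (use \<tau> \<delta> \<tau>0 in \<open>auto simp: field_simps\<close>)
    moreover have "m * (\<delta> / \<tau>) powr (1 / 2) \<le> 4 powr (- \<bar>s\<bar>) * (2 * \<delta> / \<tau>) powr (1 / 2 - 1) * (2 * \<delta> / \<tau> - \<delta> / \<tau>)"
    proof -
      define x where "x = \<delta> / \<tau>"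
      have x: "x > 0" using \<delta> \<tau>0 by (simp add: x_def)
      have "x powr (1 / 2) / 2 \<le> (2 * x) powr (1 / 2 - 1) * x"
      proof -
        have "(2 * x) powr (1 / 2) = (2 * x) powr (1 / 2 - 1 + 1)" by simp
        also have "\<dots> = (2 * x) powr (1 / 2 - 1) * (2 * x)" using x by (subst powr_add) simp
        finally have "(2 * x) powr (1 / 2 - 1) * (2 * x) = (2 * x) powr (1 / 2)" by simp
        then have "(2 * x) powr (1 / 2 - 1) * x = (2 * x) powr (1 / 2) / 2" by simp
        moreover have "x powr (1 / 2) \<le> (2 * x) powr (1 / 2)" using x by (intro powr_mono2) auto
        ultimately show ?thesis by simp
      qed
      then have "4 powr (- \<bar>s\<bar>) * (x powr (1 / 2) / 2) \<le> 4 powr (- \<bar>s\<bar>) * ((2 * x) powr (1 / 2 - 1) * x)"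
        by (rule mult_left_mono) simp
      moreover have "2 * \<delta> / \<tau> = 2 * x" by (simp add: x_def)
      ultimately show ?thesis unfolding m_def x_def[symmetric] by (simp add: mult.assoc)
    qed
    ultimately show ?thesis by linarith
  qed
  \<comment> \<open>Only tau between 4 delta and 8 delta is used; there the profile is bounded below
    independently of delta.\<close>
  have N3: "A2 * (r / p) \<le> B2"
  proof -
    define d where "d = 2 powr (- \<bar>B2 - 1\<bar>) * 4 powr (B2 - 1) * 4 powr (- \<bar>B1 - 1\<bar>)"
    define c where "c = (m * (1 / 8) powr (1 / 2)) powr r * d * 4"
    have c: "c > 0" using m by (simp add: c_def d_def)
    have main: "c * \<delta> powr B2 \<le> C * w powr (r / p) * \<delta> powr (A2 * (r / p))" if \<delta>: "0 < \<delta>" "\<delta> \<le> 1 / 16" for \<delta>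
    proof -
      have "c * \<delta> powr B2 \<le> C * (w * \<delta> powr A2) powr (r / p)"
      proof (rule T[where u=\<delta> and v="2 * \<delta>"])
        show "sphere_weighted n p \<alpha>1 \<alpha>2 (test_fun \<delta> (2 * \<delta>)) \<le> ennreal (w * \<delta> powr A2)" by (rule SW0[OF \<delta>])
        have "ennreal ((m * (1 / 8) powr (1 / 2)) powr r * (d * \<delta> powr (B2 - 1)) * (8 * \<delta> - 4 * \<delta>))
            \<le> profile_weighted n k r \<beta>1 \<beta>2 (test_fun \<delta> (2 * \<delta>))"
        proof (rule profile_weighted_ge)
          fix \<tau> assume \<tau>: "4 * \<delta> < \<tau>" "\<tau> < 8 * \<delta>"
          have "(1 / 8) powr (1 / 2) \<le> (\<delta> / \<tau>) powr (1 / 2)" using \<tau> \<delta> by (intro powr_mono2) (auto simp: field_simps)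
          then have "m * (1 / 8) powr (1 / 2) \<le> m * (\<delta> / \<tau>) powr (1 / 2)" using m by (intro mult_left_mono) auto
          then show "m * (1 / 8) powr (1 / 2) \<le> enn2real (radon_profile k (test_fun \<delta> (2 * \<delta>)) \<tau>)"
            using P0[of \<delta> \<tau>] \<delta> \<tau> by linarith
          have "(2 powr (- \<bar>B2 - 1\<bar>) * (4 * \<delta>) powr (B2 - 1)) * 4 powr (- \<bar>B1 - 1\<bar>)
              \<le> \<tau> powr (B2 - 1) * (1 - \<tau>) powr (B1 - 1)"
            using \<tau> \<delta> by (intro mult_mono powr_quarter_bounds(1) powr_dyadic_bounds(1)) auto
          then show "d * \<delta> powr (B2 - 1) \<le> cone_weight ((\<beta>2 + real k + 1) / 2) ((\<beta>1 + real n - real k) / 2) \<tau>"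
            unfolding cone_weight_def defs d_def using \<delta> by (simp add: powr_mult mult_ac)
        qed (use \<delta> pr m in \<open>auto simp: d_def\<close>)
        moreover have "(m * (1 / 8) powr (1 / 2)) powr r * (d * \<delta> powr (B2 - 1)) * (8 * \<delta> - 4 * \<delta>) = c * \<delta> powr B2"
          using \<delta> by (simp add: c_def powr_diff)
        ultimately show "ennreal (c * \<delta> powr B2) \<le> profile_weighted n k r \<beta>1 \<beta>2 (test_fun \<delta> (2 * \<delta>))" by simp
      qed (use \<delta> in \<open>auto simp: w_def\<close>)
      also have "(w * \<delta> powr A2) powr (r / p) = w powr (r / p) * \<delta> powr (A2 * (r / p))"
        using \<delta> by (subst powr_mult) (auto simp: w_def powr_powr)
      finally show ?thesis by (simp add: mult.assoc)
    qed
    show ?thesis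
    proof (rule powr_exponent_le[of "1 / 16" _ "C * w powr (r / p) / c"])
      fix \<delta> :: real assume "0 < \<delta>" "\<delta> \<le> 1 / 16"
      from main[OF this] show "\<delta> powr B2 \<le> C * w powr (r / p) / c * \<delta> powr (A2 * (r / p))"
        using c by (simp add: field_simps)
    qed simp
  qed
  \<comment> \<open>At equality A2 = 1/2 and B2 = r/2, and all scales of tau between 4 delta and 1/2
    contribute equally: the integrand is at least a constant times delta^(r/2)/tau. The integral
    then exceeds the permitted delta^(r/2) by a factor of order ln(1/delta).\<close>
  have N4: "A2 * (r / p) \<noteq> B2" if crit: "p = 1 + \<alpha>2"
  proof
    assume eq: "A2 * (r / p) = B2"
    have al: "\<alpha>2 = 0" "p = 1" using crit p by auto
    then have A2: "A2 = 1 / 2" and B2: "B2 = r / 2" using eq by (auto simp: A2_def)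
    define c where "c = m powr r * 4 powr (- \<bar>B1 - 1\<bar>)"
    have c: "c > 0" using m by (simp add: c_def)
    have log: "c * (ln (1 / 2) - ln (4 * \<delta>)) \<le> C * w powr r" if \<delta>: "0 < \<delta>" "\<delta> \<le> 1 / 16" for \<delta>
    proof -
      have "c * \<delta> powr (r / 2) * (ln (1 / 2) - ln (4 * \<delta>)) \<le> C * (w * \<delta> powr A2) powr (r / p)"
      proof (rule T[where u=\<delta> and v="2 * \<delta>"])
        show "sphere_weighted n p \<alpha>1 \<alpha>2 (test_fun \<delta> (2 * \<delta>)) \<le> ennreal (w * \<delta> powr A2)" by (rule SW0[OF \<delta>])
        have "ennreal (c * \<delta> powr (r / 2) * (ln (1 / 2) - ln (4 * \<delta>))) = ennreal (c * \<delta> powr (r / 2)) * (\<integral>\<^sup>+t\<in>{4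
            * \<delta>..1/2}. ennreal (1 / t) \<partial>lborel)"
          using c \<delta> by (subst nn_integral_inverse_real) (auto simp: ennreal_mult')
        also have "\<dots> = (\<integral>\<^sup>+t. ennreal (c * \<delta> powr (r / 2)) * (ennreal (1 / t) * indicator {4 * \<delta>..1/2} t) \<partial>lborel)"
          by (rule nn_integral_cmult[symmetric]) measurable
        also have "\<dots> \<le> profile_weighted n k r \<beta>1 \<beta>2 (test_fun \<delta> (2 * \<delta>))"
          unfolding profile_weighted_def
        proof (rule nn_integral_mono, goal_cases)
          case (1 \<tau>)
          show ?case
          proof (cases "4 * \<delta> \<le> \<tau> \<and> \<tau> \<le> 1/2")
            case True
            then have \<tau>: "4 * \<delta> \<le> \<tau>" "\<tau> \<le> 1 / 2" "\<tau> > 0" using \<delta> by auto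
            have "(m * (\<delta> / \<tau>) powr (1 / 2)) powr r \<le> enn2real (radon_profile k (test_fun \<delta> (2 * \<delta>)) \<tau>) powr r"
              using P0[OF \<delta>(1) \<tau>(1)] pr m by (intro powr_mono2) auto
            moreover have "4 powr (- \<bar>B1 - 1\<bar>) \<le> (1 - \<tau>) powr (B1 - 1)" using \<tau> by (intro powr_quarter_bounds) auto
            ultimately have "(m * (\<delta> / \<tau>) powr (1 / 2)) powr r * (\<tau> powr (B2 - 1) * 4 powr (- \<bar>B1 - 1\<bar>))
               \<le> enn2real (radon_profile k (test_fun \<delta> (2 * \<delta>)) \<tau>) powr r * (\<tau> powr (B2 - 1) * (1 - \<tau>) powr (B1 - 1))"
              by (intro mult_mono) auto
            moreover have "(m * (\<delta> / \<tau>) powr (1 / 2)) powr r * (\<tau> powr (B2 - 1) * 4 powr (- \<bar>B1 - 1\<bar>))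
                = c * \<delta> powr (r / 2) * (1 / \<tau>)"
              using m \<delta> \<tau> by (simp add: B2 c_def powr_mult powr_powr powr_divide powr_diff)
            ultimately have "c * \<delta> powr (r / 2) * (1 / \<tau>) \<le> enn2real (radon_profile k (test_fun \<delta> (2 * \<delta>)) \<tau>) powr r
                * cone_weight B2 B1 \<tau>"
              by (simp add: cone_weight_def)
            then show ?thesis using True \<tau> c unfolding defs by (simp add: ennreal_mult[symmetric] ennreal_leI)
          qed simp
        qed
        finally show "ennreal (c * \<delta> powr (r / 2) * (ln (1 / 2) - ln (4 * \<delta>)))
            \<le> profile_weighted n k r \<beta>1 \<beta>2 (test_fun \<delta> (2 * \<delta>))" .
      qed (use \<delta> in \<open>auto simp: w_def\<close>)
      also have "(w * \<delta> powr A2) powr (r / p) = w powr r * \<delta> powr (r / 2)"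
        using \<delta> al by (subst powr_mult) (auto simp: w_def powr_powr A2)
      finally have "\<delta> powr (r / 2) * (c * (ln (1 / 2) - ln (4 * \<delta>))) \<le> \<delta> powr (r / 2) * (C * w powr r)"
          by (simp only: mult_ac)
      then show ?thesis using \<delta> by (simp add: mult_le_cancel_left_pos)
    qed
    define D where "D = C * w powr r"
    have D: "D \<ge> 0" using C0 by (simp add: D_def)
    \<comment> \<open>Gives ln(1/4) - ln(4 delta) = D/c + 1, again one more than the bound
      allows.\<close>
    define \<delta> where "\<delta> = 1 / 16 * exp (- (D / c + 1))"
    have "D / c \<ge> 0" using D c by simp
    then have \<delta>: "0 < \<delta>" "\<delta> \<le> 1 / 16" by (auto simp: \<delta>_def)
    have "4 * \<delta> = 1 / 4 * exp (- (D / c + 1))" by (simp add: \<delta>_def)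
    then have "ln (4 * \<delta>) = ln (1 / 4 * exp (- (D / c + 1)))" by (simp only:)
    also have "\<dots> = ln (1 / 4) + ln (exp (- (D / c + 1)))" by (subst ln_mult) auto
    also have "\<dots> = ln (1 / 4) - (D / c + 1)" by (simp only: ln_exp)
    finally have "ln (4 * \<delta>) = ln (1 / 4) - (D / c + 1)" .
    moreover have "ln (1 / 4 :: real) \<le> ln (1 / 2)" by simp
    ultimately have "c * (D / c + 1) \<le> c * (ln (1 / 2) - ln (4 * \<delta>))" using c by (intro mult_left_mono) auto
    also have "\<dots> \<le> D" using log[OF \<delta>] unfolding D_def .
    finally show False using c by (simp add: distrib_left)
  qed
  have e1: "(\<alpha>1 + real n) / p = 2 * (A1 * (r / p)) / r" and e2: "(\<alpha>2 + 1) / p = 2 * (A2 * (r / p)) / r"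
    and e3: "(\<beta>1 + real n - real k) / r = 2 * B1 / r" and e4: "(\<beta>2 + real k + 1) / r = 2 * B2 / r"
    using pr by (simp_all add: A1_def A2_def B1_def B2_def del: distrib_left_numeral right_diff_distrib_numeral)
  show ?thesis
    unfolding cond_N_def e1 e2 e3 e4
  proof (intro conjI impI)
    show "\<beta>1 > real k - real n" using B1 by (simp add: B1_def)
    have "2 * (A1 * (r / p)) / r - 2 * B1 / r = 2 * (A1 * (r / p) - B1) / r" by (simp add: diff_divide_distrib)
    also have "\<dots> \<le> 2 * (real k / 2 * r) / r" using N2 pr by (intro divide_right_mono) auto
    finally show "2 * (A1 * (r / p)) / r - 2 * B1 / r \<le> real k" using pr by simp
    show "2 * (A2 * (r / p)) / r \<le> 2 * B2 / r" using N3 pr by (intro divide_right_mono) auto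
    show "2 * (A2 * (r / p)) / r < 2 * B2 / r" if "p = 1 + \<alpha>2"
      using N3 N4[OF that] pr by (intro divide_strict_right_mono) auto
  qed
qed

theorem theorem4p8:
  fixes a :: "'m::finite" and n k :: nat and p r \<alpha>1 \<alpha>2 \<beta>1 \<beta>2 :: real
  assumes "CARD('m) = n + 1" and "n \<ge> 2"
    and "1 \<le> k" and "k \<le> n - 1"
    and "p \<ge> max 1 (1 + \<alpha>2)" and "\<alpha>2 > 0 \<longrightarrow> p > 1 + \<alpha>2"
    and "p \<le> r"
  shows "(k \<ge> 2 \<longrightarrow> (radon_bound a k p r \<alpha>1 \<alpha>2 \<beta>1 \<beta>2 \<longleftrightarrow> cond_N n k p r \<alpha>1 \<alpha>2 \<beta>1 \<beta>2))
       \<and> (k = 1 \<and> (p > 1 \<longrightarrow> 1 / p - 1 / r \<le> 1 / 2) \<and> (p = 1 \<longrightarrow> r < 2) \<longrightarrow>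
            (radon_bound a k p r \<alpha>1 \<alpha>2 \<beta>1 \<beta>2 \<longleftrightarrow> cond_N n k p r \<alpha>1 \<alpha>2 \<beta>1 \<beta>2))"
proof -
  have p: "p \<ge> 1" "p \<ge> 1 + \<alpha>2" using assms(5) by auto
  have suff: "radon_bound a k p r \<alpha>1 \<alpha>2 \<beta>1 \<beta>2 \<longleftrightarrow> cond_N n k p r \<alpha>1 \<alpha>2 \<beta>1 \<beta>2"
    if "k = 1 \<Longrightarrow> 1 / p - 1 / r \<le> 1 / 2" "k = 1 \<Longrightarrow> p = 1 \<Longrightarrow> r < 2"
    using radon_bound_sufficient[OF assms(1,3,4) p assms(6,7) that] radon_bound_necessary[OF assms(1,3,4) p
        assms(6,7)]
    by blast
  \<comment> \<open>For p = 1 the condition r < 2 says 1 - 1/r < 1/2, so both alternatives for k = 1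
    imply the same inequality.\<close>
  have "1 / p - 1 / r \<le> 1 / 2" if "p > 1 \<longrightarrow> 1 / p - 1 / r \<le> 1 / 2" "p = 1 \<longrightarrow> r < 2"
  proof (cases "p = 1")
    case True
    then show ?thesis using that assms(7) by (simp add: field_simps)
  next
    case False
    then show ?thesis using that p by simp
  qed
  then show ?thesis using suff by auto
qed

end
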